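(* Let $(T,d_T)$ be a complete separable metric space, let $K\colon T\times T\to\mathbb{R}$ be a continuous positive-semidefinite kernel whose reproducing kernel Hilbert space (RKHS) $H(K)$ is infinite-dimensional and separable, and let $(X(t))_{t\in T}\sim\mathcal{GP}(0,K)$ be a zero-mean Gaussian process with covariance $K$ and continuous paths. Let $\Phi=(\phi_n)_{n=1}^\infty$ be an orthonormal basis of $H(K)$ and suppose that there is a $\Phi$-scaling $A=(\alpha_n)_{n=1}^\infty$ of $H(K)$ such that $\sum_{n=1}^\infty\alpha_n^{-1}<\infty$ and $K_{A,\Phi}$ is continuous. Let $\mathfrak{R}$ be the collection of all continuous scaled kernels $K_{B,\Phi}$, $B$ a $\Phi$-scaling of $H(K)$; let $\mathcal{S}(\mathfrak{R})$ be the $\sigma$-algebra on $C(T)$ generated by the collection of RKHSs $\{H(R):R\in\mathfrak{R}\}$; and let $S_{\mathfrak{R}}(K)$ be the largest subset of $C(T)$ that is contained in every $H\in\mathcal{S}(\mathfrak{R})$ such that $\mathbb{P}[X\in H]=1$. Suppose that $d_K(t,t')=\|K(\cdot,t)-K(\cdot,t')\|_K$ is a metric on $T$. Then $S_{\mathfrak{R}}(K)$ consists precisely of the functions $f=\sum_{n=1}^\infty f_n\phi_n$ such that $$\liminf_{n\to\infty}f_n^2>0\quad\text{and}\quad\sup_{n\ge1}f_n^2<\infty.$$ Furthermore, for every $H\in\mathcal{S}(\mathfrak{R})$ such that $\mathbb{P}[X\in H]=1$ there exists $F\in\mathcal{S}(\mathfrak{R})$ such that $S_{\mathfrak{R}}(K)$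 is a proper subset of $F$ and $F$ is a proper subset of $H$.
   Context: Kernels. $K$ is positive-semidefinite if $\sum_{i,j=1}^N a_ia_jK(t_i,t_j)\ge 0$ for all $N\ge1$, $a_i\in\mathbb{R}$, $t_i\in T$. $H(K)$ denotes the RKHS of $K$, with norm $\|\cdot\|_K$. $C(T)$ is the set of continuous real-valued functions on $T$. Scalings. For an orthonormal basis $\Phi=(\phi_n)_{n=1}^\infty$ of $H(K)$, a positive sequence $A=(\alpha_n)_{n=1}^\infty$ is a $\Phi$-scaling of $H(K)$ if $\sum_{n=1}^\infty\alpha_n\phi_n(t)^2<\infty$ for every $t\in T$. The scaled kernel is $K_{A,\Phi}(t,t')=\sum_{n=1}^\infty\alpha_n\phi_n(t)\phi_n(t')$, and $H(K_{A,\Phi})$ denotes its RKHS (the scaled RKHS). Expansions $f=\sum_{n=1}^\infty f_n\phi_n$ have real coefficients and converge pointwise on $T$. Law of $X$. Let $\tilde{\mathcal{B}}$ be the $\sigma$-algebra on $\mathbb{R}^T$ generated by the cylinder sets $\{f\in\mathbb{R}^T:(f(t_1),\dots,f(t_n))\in B\}$, $n\in\mathbb{N}$, $t_1,\dots,t_n\in T$, $B\subset\mathbb{R}^n$ Borel; let $\tilde\mu_X$ be the law of $X$ on $(\mathbb{R}^T,\tilde{\mathcal{B}})$ and $(\mathbb{R}^T,\tilde{\mathcal{B}}_0,\tilde\mu_{X,0})$ its completion. By continuity of paths $C(T)$ has outer measure one. Set $\mathcal{B}=\{C(T)\cap H:H\in\tilde{\mathcal{B}}_0\}$ and $\mu_X(C(T)\cap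 H)=\tilde\mu_{X,0}(H)$ for $H\in\tilde{\mathcal{B}}_0$. For $H\in\mathcal{B}$, $\mathbb{P}[X\in H]$ stands for $\mu_X(H)$. It is known that the RKHS of any continuous positive-semidefinite kernel on $T\times T$ belongs to $\mathcal{B}$, so $\mathcal{S}(\mathfrak{R})\subset\mathcal{B}$.
   Formalization: The formal theorem additionally assumes that, for every continuous scaled kernel K_{B,Φ}, expansions f=∑f_nφ_n with ∑f_n²/β_n<∞ have unique coefficients; without this the f_n are not determined by f and the claim can fail. *)

theory Defs
  imports "HOL-Probability.Probability"
begin

definition psd_kernel :: "('t \<Rightarrow> 't \<Rightarrow> real) \<Rightarrow> bool" where
  "psd_kernel K \<longleftrightarrow>
     (\<forall>(N::nat) (a :: nat \<Rightarrow> real) (t :: nat \<Rightarrow> 't). N \<ge> 1 \<longrightarrow>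
        (\<Sum>i<N. \<Sum>j<N. a i * a j * K (t i) (t j)) \<ge> 0)"

definition continuous_kernel :: "('t::topological_space \<Rightarrow> 't \<Rightarrow> real) \<Rightarrow> bool" where
  "continuous_kernel K \<longleftrightarrow> continuous_on UNIV (\<lambda>(s, t). K s t)"

definition continuous_functions :: "('t::topological_space \<Rightarrow> real) set" where
  "continuous_functions = {f. continuous_on UNIV f}"


subsection \<open>Reproducing kernel Hilbert spaces\<close>

text \<open>\<^prop>\<open>is_rkhs K H ip\<close>: the set \<open>H\<close> of functions with pointwise operations and
  inner product \<open>ip\<close> is a Hilbert space in which \<open>K\<close> is reproducing. Values of \<open>ip\<close>
  outside \<open>H\<close> are irrelevant.\<close>

definition is_rkhs ::
  "('t \<Rightarrow> 't \<Rightarrow> real) \<Rightarrow> ('t \<Rightarrow> real) set \<Rightarrow> (('t \<Rightarrow> real) \<Rightarrow> ('t \<Rightarrow> real) \<Rightarrow> real) \<Rightarrow> bool" where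
  "is_rkhs K H ip \<longleftrightarrow>
     (\<lambda>t. 0) \<in> H \<and>
     (\<forall>f\<in>H. \<forall>g\<in>H. (\<lambda>t. f t + g t) \<in> H) \<and>
     (\<forall>c. \<forall>f\<in>H. (\<lambda>t. c * f t) \<in> H) \<and>
     (\<forall>f\<in>H. \<forall>g\<in>H. ip f g = ip g f) \<and>
     (\<forall>f\<in>H. \<forall>g\<in>H. \<forall>h\<in>H. ip (\<lambda>t. f t + g t) h = ip f h + ip g h) \<and>
     (\<forall>c. \<forall>f\<in>H. \<forall>g\<in>H. ip (\<lambda>t. c * f t) g = c * ip f g) \<and>
     (\<forall>f\<in>H. ip f f \<ge> 0) \<and>
     (\<forall>f\<in>H. ip f f = 0 \<longrightarrow> f = (\<lambda>t. 0)) \<and>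
     (\<forall>u :: nat \<Rightarrow> 't \<Rightarrow> real.
        range u \<subseteq> H \<and>
        (\<forall>e>0. \<exists>N. \<forall>m\<ge>N. \<forall>n\<ge>N.
           sqrt (ip (\<lambda>t. u m t - u n t) (\<lambda>t. u m t - u n t)) < e) \<longrightarrow>
        (\<exists>f\<in>H. (\<lambda>n. sqrt (ip (\<lambda>t. u n t - f t) (\<lambda>t. u n t - f t))) \<longlonglongrightarrow> 0)) \<and>
     (\<forall>t. (\<lambda>s. K s t) \<in> H) \<and>
     (\<forall>f\<in>H. \<forall>t. ip f (\<lambda>s. K s t) = f t)"

text \<open>By the Moore-Aronszajn theorem, for a symmetric positive-semidefinite \<open>K\<close> the set
  and the inner product restricted to it exist and are unique.\<close>

definition rkhs :: "('t \<Rightarrow> 't \<Rightarrow> real) \<Rightarrow> ('t \<Rightarrow> real) set" where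
  "rkhs K = (THE H. \<exists>ip. is_rkhs K H ip)"

definition rkhs_inner :: "('t \<Rightarrow> 't \<Rightarrow> real) \<Rightarrow> ('t \<Rightarrow> real) \<Rightarrow> ('t \<Rightarrow> real) \<Rightarrow> real" where
  "rkhs_inner K = (SOME ip. is_rkhs K (rkhs K) ip)"

definition rkhs_norm :: "('t \<Rightarrow> 't \<Rightarrow> real) \<Rightarrow> ('t \<Rightarrow> real) \<Rightarrow> real" where
  "rkhs_norm K f = sqrt (rkhs_inner K f f)"

definition rkhs_infinite_dim :: "('t \<Rightarrow> 't \<Rightarrow> real) \<Rightarrow> bool" where
  "rkhs_infinite_dim K \<longleftrightarrow>
     \<not> (\<exists>B. finite B \<and> B \<subseteq> rkhs K \<and>
           (\<forall>f\<in>rkhs K. \<exists>c :: ('t \<Rightarrow> real) \<Rightarrow> real. f = (\<lambda>t. \<Sum>g\<in>B. c g * g t)))"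

definition rkhs_separable :: "('t \<Rightarrow> 't \<Rightarrow> real) \<Rightarrow> bool" where
  "rkhs_separable K \<longleftrightarrow>
     (\<exists>D. countable D \<and> D \<subseteq> rkhs K \<and>
        (\<forall>f\<in>rkhs K. \<forall>e>0. \<exists>g\<in>D. rkhs_norm K (\<lambda>t. f t - g t) < e))"

definition rkhs_orthonormal_basis :: "('t \<Rightarrow> 't \<Rightarrow> real) \<Rightarrow> (nat \<Rightarrow> 't \<Rightarrow> real) \<Rightarrow> bool" where
  "rkhs_orthonormal_basis K \<phi> \<longleftrightarrow>
     range \<phi> \<subseteq> rkhs K \<and>
     (\<forall>m n. rkhs_inner K (\<phi> m) (\<phi> n) = (if m = n then 1 else 0)) \<and>
     (\<forall>f\<in>rkhs K.
        (\<lambda>N. rkhs_norm K (\<lambda>t. f t - (\<Sum>n<N. rkhs_inner K f (\<phi> n) * \<phi> n t))) \<longlonglongrightarrow> 0)"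

definition kernel_dist :: "('t \<Rightarrow> 't \<Rightarrow> real) \<Rightarrow> 't \<Rightarrow> 't \<Rightarrow> real" where
  "kernel_dist K t t' = rkhs_norm K (\<lambda>s. K s t - K s t')"


subsection \<open>Scalings\<close>

text \<open>Sequences are indexed from 0 instead of 1 throughout.\<close>

definition scaling :: "(nat \<Rightarrow> 't \<Rightarrow> real) \<Rightarrow> (nat \<Rightarrow> real) \<Rightarrow> bool" where
  "scaling \<phi> \<alpha> \<longleftrightarrow> (\<forall>n. \<alpha> n > 0) \<and> (\<forall>t. summable (\<lambda>n. \<alpha> n * (\<phi> n t)\<^sup>2))"

definition scaled_kernel :: "(nat \<Rightarrow> real) \<Rightarrow> (nat \<Rightarrow> 't \<Rightarrow> real) \<Rightarrow> 't \<Rightarrow> 't \<Rightarrow> real" where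
  "scaled_kernel \<alpha> \<phi> t t' = (\<Sum>n. \<alpha> n * \<phi> n t * \<phi> n t')"

definition scaled_kernels ::
  "(nat \<Rightarrow> 't::topological_space \<Rightarrow> real) \<Rightarrow> ('t \<Rightarrow> 't \<Rightarrow> real) set" where
  "scaled_kernels \<phi> =
     {scaled_kernel \<beta> \<phi> | \<beta>. scaling \<phi> \<beta> \<and> continuous_kernel (scaled_kernel \<beta> \<phi>)}"

definition expansion :: "(nat \<Rightarrow> 't \<Rightarrow> real) \<Rightarrow> (nat \<Rightarrow> real) \<Rightarrow> ('t \<Rightarrow> real) \<Rightarrow> bool" where
  "expansion \<phi> c f \<longleftrightarrow> (\<forall>t. (\<lambda>n. c n * \<phi> n t) sums f t)"

text \<open>Expansion coefficients of elements of scaled RKHSs are well defined. Equivalently,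
  \<open>sqrt (\<beta> n) * \<phi> n\<close> is an orthonormal basis of the RKHS of every continuous scaled kernel
  \<^term>\<open>scaled_kernel \<beta> \<phi>\<close>, whose elements are then the \<open>f = (\<Sum>n. c n * \<phi> n)\<close> with squared
  norm \<open>\<Sum>n. (c n)\<^sup>2 / \<beta> n\<close>. This does not follow from \<open>\<phi>\<close> being an orthonormal basis of
  \<^term>\<open>rkhs K\<close>: on the discrete space of naturals, let \<open>\<phi> 0 = - e 0\<close> and
  \<open>\<phi> (Suc n) = e n - e (Suc n)\<close> (unit vectors \<open>e n\<close>), orthonormal in the RKHS of
  \<open>K s t = (\<Sum>n. \<phi> n s * \<phi> n t)\<close>. Every positive sequence is a scaling, and the constant
  coefficients 1 and 0 both expand the zero function. The sample paths almost surely
  avoid \<^term>\<open>rkhs K\<close>, so zero is not in the sample support set, although its coefficients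
  1 are bounded away from zero and infinity.\<close>

definition coefficients_well_defined :: "(nat \<Rightarrow> 't::topological_space \<Rightarrow> real) \<Rightarrow> bool" where
  "coefficients_well_defined \<phi> \<longleftrightarrow>
     (\<forall>\<beta> c d f.
        scaling \<phi> \<beta> \<and> continuous_kernel (scaled_kernel \<beta> \<phi>) \<and>
        summable (\<lambda>n. (c n)\<^sup>2 / \<beta> n) \<and> summable (\<lambda>n. (d n)\<^sup>2 / \<beta> n) \<and>
        expansion \<phi> c f \<and> expansion \<phi> d f \<longrightarrow> c = d)"


subsection \<open>Gaussian processes and the law on continuous functions\<close>

definition gaussian_law :: "real \<Rightarrow> real \<Rightarrow> real measure" where
  "gaussian_law m v =
     (if v = 0 then return borel m
      else density lborel (\<lambda>x. ennreal (normal_density m (sqrt v) x)))"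

text \<open>Finite-dimensional distributions are Gaussian (possibly degenerate) iff all finite
  linear combinations are.\<close>

definition gaussian_process :: "'w measure \<Rightarrow> ('t \<Rightarrow> 'w \<Rightarrow> real) \<Rightarrow> bool" where
  "gaussian_process M X \<longleftrightarrow>
     prob_space M \<and>
     (\<forall>t. X t \<in> borel_measurable M) \<and>
     (\<forall>F (a :: 't \<Rightarrow> real). finite F \<longrightarrow>
        (\<exists>m v. v \<ge> 0 \<and> distr M borel (\<lambda>\<omega>. \<Sum>t\<in>F. a t * X t \<omega>) = gaussian_law m v))"

definition centered_gaussian_process ::
  "'w measure \<Rightarrow> ('t \<Rightarrow> 'w \<Rightarrow> real) \<Rightarrow> ('t \<Rightarrow> 't \<Rightarrow> real) \<Rightarrow> bool" where
  "centered_gaussian_process M X K \<longleftrightarrow>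
     gaussian_process M X \<and>
     (\<forall>t. integral\<^sup>L M (X t) = 0) \<and>
     (\<forall>s t. integral\<^sup>L M (\<lambda>\<omega>. X s \<omega> * X t \<omega>) = K s t)"

definition completed_law :: "'w measure \<Rightarrow> ('t \<Rightarrow> 'w \<Rightarrow> real) \<Rightarrow> ('t \<Rightarrow> real) measure" where
  "completed_law M X = completion (distr M (PiM UNIV (\<lambda>_. borel)) (\<lambda>\<omega> t. X t \<omega>))"

text \<open>The trace of the completed law on the continuous functions. Since these need not be
  measurable in \<^term>\<open>completed_law M X\<close>, \<^const>\<open>restrict_space\<close> does not apply. As they have
  outer measure one, the value does not depend on the choice of \<open>G\<close>.\<close>

definition path_law ::
  "'w measure \<Rightarrow> ('t::topological_space \<Rightarrow> 'w \<Rightarrow> real) \<Rightarrow> ('t \<Rightarrow> real) measure" where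
  "path_law M X =
     measure_of continuous_functions
       {continuous_functions \<inter> G | G. G \<in> sets (completed_law M X)}
       (\<lambda>A. emeasure (completed_law M X)
              (SOME G. G \<in> sets (completed_law M X) \<and> continuous_functions \<inter> G = A))"


subsection \<open>The sample support set\<close>

definition rkhs_sigma ::
  "('t::topological_space \<Rightarrow> 't \<Rightarrow> real) set \<Rightarrow> ('t \<Rightarrow> real) set set" where
  "rkhs_sigma \<R> = sigma_sets continuous_functions (rkhs ` \<R>)"

definition sample_support ::
  "'w measure \<Rightarrow> ('t::topological_space \<Rightarrow> 'w \<Rightarrow> real) \<Rightarrow> ('t \<Rightarrow> 't \<Rightarrow> real) set \<Rightarrow>
     ('t \<Rightarrow> real) set" where
  "sample_support M X \<R> =
     (GREATEST S. S \<subseteq> continuous_functions \<and>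
        (\<forall>H\<in>rkhs_sigma \<R>. emeasure (path_law M X) H = 1 \<longrightarrow> S \<subseteq> H))"

end

theory Submission
  imports Defs
begin

text \<open>Almost surely \<open>X = (\<Sum>n. \<zeta> n * \<phi> n)\<close> pointwise, where the \<open>\<zeta> n\<close> are jointly Gaussian,
  uncorrelated and of variance 1. Hence the RKHS of a continuous scaled kernel with weights \<open>\<beta>\<close>
  contains almost all paths if \<open>(\<Sum>n. 1 / \<beta> n)\<close> converges and almost none if it diverges. A function
  whose squared coefficients are eventually bounded away from 0 and bounded belongs to exactly
  the same of these spaces as \<open>X\<close>, hence to exactly the sets of full measure in the generated
  \<open>\<sigma>\<close>-algebra. If the squared coefficients are unbounded or have 0 as a cluster point,
  enlarging \<open>1 / \<alpha>\<close> along a sparse subsequence yields a scaled RKHS that separates the function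
  from \<open>X\<close>. Finally, a set in the generated \<open>\<sigma>\<close>-algebra depends on countably many RKHSs only, which
  cannot detect that the coefficients are unbounded along a sufficiently sparse subsequence.\<close>

section \<open>Semi-inner products on spaces of functions\<close>

text \<open>Only laws of finite linear combinations of the \<open>X t\<close> are given, whereas the
  coefficients \<open>\<zeta> n\<close> are limits of such combinations. Estimates are therefore
  made on finite combinations and carried to the limit by Fatou's lemma, with some slack; divergence
  of weighted sums of squares needs only fourth moments, which polarization reduces to
  one-dimensional laws. Different scaled kernels become comparable because uniqueness of
  coefficients, assumed inside each scaled RKHS, extends to pairs of them through the sum of their
  weights. Test spaces arise by adding a nonnegative sequence to \<open>1 / \<alpha>\<close>: the
  weights can then only decrease, continuity of the kernel is inherited by smaller weights, and
  summability of inverse weights is an additive condition. As \<open>rkhs\<close> is a definite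
  description, existence has to be settled as well: for \<open>K\<close> it comes from the closed
  span of the process in L2, for scaled kernels from l2. The set of continuous functions need not be
  measurable for the product \<sigma>-algebra, so full measure is phrased as an almost-everywhere
  implication on continuous functions.\<close>

lemma discriminant_nonpos:
  fixes p b a :: real
  assumes "\<And>c. 0 \<le> p - 2 * c * b + c\<^sup>2 * a" "a \<ge> 0"
  shows "b\<^sup>2 \<le> p * a"
proof (cases "a = 0")
  case True
  have "b = 0"
  proof (rule ccontr)
    assume "b \<noteq> 0"
    \<comment> \<open>For a = 0 the form is affine in c, and this choice of c gives it the value
      -1.\<close>
    then show False
      using assms(1)[of "(p + 1) / (2 * b)"] True by (simp add: field_simps)
  qed
  then show ?thesis using True by simp
next
  case False
  then show ?thesis
    using assms(1)[of "b / a"] assms(2) by (simp add: field_simps power2_eq_square)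
qed

lemma tendsto_zero_sq_le:
  fixes f g :: "'a \<Rightarrow> real"
  assumes "\<And>x. (f x)\<^sup>2 \<le> g x" "(g \<longlongrightarrow> 0) F"
  shows "(f \<longlongrightarrow> 0) F"
proof -
  have "((\<lambda>x. (f x)\<^sup>2) \<longlongrightarrow> 0) F"
    by (rule tendsto_sandwich[OF _ _ tendsto_const assms(2)]) (simp_all add: assms(1))
  then show ?thesis by simp
qed

text \<open>Spanned by an indexed family, not by a set, so that one finite index set with
  coefficients describes both a combination of kernel sections and the corresponding combination of
  the variables \<open>X t\<close>.\<close>

definition finite_span :: "('i \<Rightarrow> 'x \<Rightarrow> real) \<Rightarrow> ('x \<Rightarrow> real) set" where
  "finite_span v = {\<lambda>x. \<Sum>i\<in>F. a i * v i x | F a. finite F}"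

lemma finite_spanI: "finite F \<Longrightarrow> (\<lambda>x. \<Sum>i\<in>F. a i * v i x) \<in> finite_span v"
  unfolding finite_span_def by blast

lemma finite_span_base: "v i \<in> finite_span v"
  using finite_spanI[of "{i}" "\<lambda>_. 1" v] by simp

lemma finite_span_zero: "(\<lambda>x. 0) \<in> finite_span v"
  using finite_spanI[of "{}" undefined v] by simp

lemma finite_span_scale: "f \<in> finite_span v \<Longrightarrow> (\<lambda>x. c * f x) \<in> finite_span v"
  unfolding finite_span_def by (force simp: sum_distrib_left mult.assoc[symmetric])

lemma finite_span_add:
  assumes "f \<in> finite_span v" "g \<in> finite_span v"
  shows "(\<lambda>x. f x + g x) \<in> finite_span v"
proof -
  obtain F a where F: "finite F" "f = (\<lambda>x. \<Sum>i\<in>F. a i * v i x)"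
    using assms(1) by (auto simp: finite_span_def)
  obtain G b where G: "finite G" "g = (\<lambda>x. \<Sum>i\<in>G. b i * v i x)"
    using assms(2) by (auto simp: finite_span_def)
  define c where "c i = (if i \<in> F then a i else 0) + (if i \<in> G then b i else 0)" for i
  have "f x = (\<Sum>i\<in>F \<union> G. (if i \<in> F then a i else 0) * v i x)" for x
    unfolding F(2) using F(1) G(1) by (intro sum.mono_neutral_cong_left) auto
  moreover have "g x = (\<Sum>i\<in>F \<union> G. (if i \<in> G then b i else 0) * v i x)" for x
    unfolding G(2) using F(1) G(1) by (intro sum.mono_neutral_cong_left) auto
  ultimately have "(\<lambda>x. f x + g x) = (\<lambda>x. \<Sum>i\<in>F \<union> G. c i * v i x)"
    by (auto simp: c_def distrib_right sum.distrib)
  then show ?thesis using finite_spanI[of "F \<union> G" c v] F(1) G(1) by simp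
qed

lemma finite_span_diff:
  "f \<in> finite_span v \<Longrightarrow> g \<in> finite_span v \<Longrightarrow> (\<lambda>x. f x - g x) \<in> finite_span v"
  using finite_span_add[of f v "\<lambda>x. (-1) * g x"] finite_span_scale[of g v "-1"] by simp

text \<open>A semi-inner product: square-integrable functions, not identified up to null sets, form
  an instance along with every RKHS.\<close>

locale function_inner_product =
  fixes V :: "('a \<Rightarrow> real) set" and ip :: "('a \<Rightarrow> real) \<Rightarrow> ('a \<Rightarrow> real) \<Rightarrow> real"
  assumes zero: "(\<lambda>x. 0) \<in> V"
    and add: "f \<in> V \<Longrightarrow> g \<in> V \<Longrightarrow> (\<lambda>x. f x + g x) \<in> V"
    and scale: "f \<in> V \<Longrightarrow> (\<lambda>x. c * f x) \<in> V"
    and sym: "f \<in> V \<Longrightarrow> g \<in> V \<Longrightarrow> ip f g = ip g f"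
    and ip_add: "f \<in> V \<Longrightarrow> g \<in> V \<Longrightarrow> h \<in> V \<Longrightarrow> ip (\<lambda>x. f x + g x) h = ip f h + ip g h"
    and ip_scale: "f \<in> V \<Longrightarrow> g \<in> V \<Longrightarrow> ip (\<lambda>x. c * f x) g = c * ip f g"
    and nonneg: "f \<in> V \<Longrightarrow> ip f f \<ge> 0"
begin

lemma diff: "f \<in> V \<Longrightarrow> g \<in> V \<Longrightarrow> (\<lambda>x. f x - g x) \<in> V"
  using add[of f "\<lambda>x. (-1) * g x"] scale[of g "-1"] by simp

lemma lincomb: "finite I \<Longrightarrow> (\<And>i. i \<in> I \<Longrightarrow> h i \<in> V) \<Longrightarrow> (\<lambda>x. \<Sum>i\<in>I. a i * h i x) \<in> V"
  by (induction I rule: finite_induct) (simp_all add: zero add[OF scale])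

lemma ip_diff: "f \<in> V \<Longrightarrow> g \<in> V \<Longrightarrow> h \<in> V \<Longrightarrow> ip (\<lambda>x. f x - g x) h = ip f h - ip g h"
  using ip_add[of f "\<lambda>x. (-1) * g x" h] scale[of g "-1"] ip_scale[of g h "-1"] by simp

lemma ip_zero: "f \<in> V \<Longrightarrow> ip (\<lambda>x. 0) f = 0"
  using ip_scale[of f f 0] by simp

lemma ip_lincomb:
  "finite I \<Longrightarrow> (\<And>i. i \<in> I \<Longrightarrow> h i \<in> V) \<Longrightarrow> g \<in> V \<Longrightarrow>
    ip (\<lambda>x. \<Sum>i\<in>I. a i * h i x) g = (\<Sum>i\<in>I. a i * ip (h i) g)"
proof (induction I rule: finite_induct)
  case empty
  then show ?case by (simp add: ip_zero)
next
  case (insert i I)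
  then show ?case
    using ip_add[of "\<lambda>x. a i * h i x" "\<lambda>x. \<Sum>i\<in>I. a i * h i x" g]
    by (simp add: scale lincomb ip_scale)
qed

lemma norm_add: "f \<in> V \<Longrightarrow> g \<in> V \<Longrightarrow> ip (\<lambda>x. f x + g x) (\<lambda>x. f x + g x) = ip f f + 2 * ip f g + ip g g"
  using add[of f g] sym[of f "\<lambda>x. f x + g x"] sym[of g "\<lambda>x. f x + g x"] sym[of f g]
  by (simp add: ip_add)

lemma norm_diff: "f \<in> V \<Longrightarrow> g \<in> V \<Longrightarrow> ip (\<lambda>x. f x - g x) (\<lambda>x. f x - g x) = ip f f - 2 * ip f g + ip g g"
  using diff[of f g] sym[of f "\<lambda>x. f x - g x"] sym[of g "\<lambda>x. f x - g x"] sym[of f g]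
  by (simp add: ip_diff)

lemma norm_scale: "f \<in> V \<Longrightarrow> ip (\<lambda>x. c * f x) (\<lambda>x. c * f x) = c\<^sup>2 * ip f f"
  using ip_scale[of f "\<lambda>x. c * f x" c] sym[of f "\<lambda>x. c * f x"] ip_scale[of f f c] scale[of f c]
  by (simp add: power2_eq_square)

text \<open>Parallelogram law with one term dropped. It stands in for the triangle inequality, since
  distances are mostly handled squared.\<close>

lemma norm_diff_le:
  assumes "f \<in> V" "g \<in> V" "h \<in> V"
  shows "ip (\<lambda>x. f x - h x) (\<lambda>x. f x - h x) \<le>
    2 * ip (\<lambda>x. f x - g x) (\<lambda>x. f x - g x) + 2 * ip (\<lambda>x. g x - h x) (\<lambda>x. g x - h x)"
proof -
  define u where "u = (\<lambda>x. f x - g x)"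
  define v where "v = (\<lambda>x. g x - h x)"
  have uv: "u \<in> V" "v \<in> V" using assms diff by (auto simp: u_def v_def)
  have "0 \<le> ip u u - 2 * ip u v + ip v v"
    using norm_diff[OF uv] nonneg[OF diff[OF uv]] by simp
  moreover have "(\<lambda>x. f x - h x) = (\<lambda>x. u x + v x)" by (auto simp: u_def v_def)
  ultimately show ?thesis
    using norm_add[OF uv] by (simp add: u_def v_def)
qed

lemma Cauchy_Schwarz:
  assumes "f \<in> V" "g \<in> V"
  shows "(ip f g)\<^sup>2 \<le> ip f f * ip g g"
proof -
  have "0 \<le> ip f f - 2 * c * ip f g + c\<^sup>2 * ip g g" for c
    using norm_diff[of f "\<lambda>x. c * g x"] nonneg[OF diff[of f "\<lambda>x. c * g x"]]
      assms scale[of g c] norm_scale[of g c] sym[of f "\<lambda>x. c * g x"] ip_scale[of g f c] sym[of f g]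
    by simp
  then show ?thesis by (rule discriminant_nonpos[OF _ nonneg[OF assms(2)]])
qed

lemma norm_add_le:
  assumes "f \<in> V" "g \<in> V"
  shows "ip (\<lambda>x. f x + g x) (\<lambda>x. f x + g x) \<le> 2 * ip f f + 2 * ip g g"
  using norm_add[OF assms] norm_diff[OF assms] nonneg[OF diff[OF assms]] by simp

lemma norm_swap:
  assumes "f \<in> V" "g \<in> V"
  shows "ip (\<lambda>x. f x - g x) (\<lambda>x. f x - g x) = ip (\<lambda>x. g x - f x) (\<lambda>x. g x - f x)"
  using norm_diff[OF assms] norm_diff[OF assms(2,1)] sym[OF assms] by simp

lemma ip_lincomb_right:
  assumes "finite I" "\<And>i. i \<in> I \<Longrightarrow> h i \<in> V" "g \<in> V"
  shows "ip g (\<lambda>x. \<Sum>i\<in>I. a i * h i x) = (\<Sum>i\<in>I. a i * ip g (h i))"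
  using ip_lincomb[OF assms] sym[OF lincomb[OF assms(1,2)] assms(3)] sym[OF assms(2,3)]
  by simp

lemma norm_lincomb:
  assumes "finite I" "\<And>i. i \<in> I \<Longrightarrow> h i \<in> V"
  shows "ip (\<lambda>x. \<Sum>i\<in>I. a i * h i x) (\<lambda>x. \<Sum>i\<in>I. a i * h i x) =
    (\<Sum>i\<in>I. \<Sum>j\<in>I. a i * a j * ip (h i) (h j))"
proof -
  let ?f = "\<lambda>x. \<Sum>i\<in>I. a i * h i x"
  have "ip ?f ?f = (\<Sum>i\<in>I. a i * ip (h i) ?f)"
    using assms by (intro ip_lincomb lincomb)
  also have "\<dots> = (\<Sum>i\<in>I. a i * (\<Sum>j\<in>I. a j * ip (h i) (h j)))"
    using assms by (intro sum.cong refl arg_cong2[of _ _ _ _ "(*)"] ip_lincomb_right)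
  finally show ?thesis by (simp add: sum_distrib_left mult.assoc)
qed

lemma ip_tendsto:
  assumes u: "\<And>n. u n \<in> V" "f \<in> V" "(\<lambda>n. ip (\<lambda>x. u n x - f x) (\<lambda>x. u n x - f x)) \<longlonglongrightarrow> 0"
    and w: "\<And>n. w n \<in> V" "g \<in> V" "(\<lambda>n. ip (\<lambda>x. w n x - g x) (\<lambda>x. w n x - g x)) \<longlonglongrightarrow> 0"
  shows "(\<lambda>n. ip (u n) (w n)) \<longlonglongrightarrow> ip f g"
proof -
  have a: "(\<lambda>x. u n x - f x) \<in> V" and b: "(\<lambda>x. w n x - g x) \<in> V" for n
    using diff u w by auto
  have 1: "(\<lambda>n. ip (\<lambda>x. u n x - f x) (\<lambda>x. w n x - g x)) \<longlonglongrightarrow> 0"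
    by (rule tendsto_zero_sq_le[OF Cauchy_Schwarz[OF a b]]) (use tendsto_mult_zero[OF u(3) w(3)] in simp)
  have 2: "(\<lambda>n. ip (\<lambda>x. u n x - f x) g) \<longlonglongrightarrow> 0"
    by (rule tendsto_zero_sq_le[OF Cauchy_Schwarz[OF a w(2)]]) (rule tendsto_mult_left_zero[OF u(3)])
  have 3: "(\<lambda>n. ip (\<lambda>x. w n x - g x) f) \<longlonglongrightarrow> 0"
    by (rule tendsto_zero_sq_le[OF Cauchy_Schwarz[OF b u(2)]]) (rule tendsto_mult_left_zero[OF w(3)])
  \<comment> \<open>Each summand contains a difference that tends to 0, and together they telescope
    to the difference of the inner products.\<close>
  have "ip (\<lambda>x. u n x - f x) (\<lambda>x. w n x - g x) + ip (\<lambda>x. u n x - f x) g + ip (\<lambda>x. w n x - g x) f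
      = ip (u n) (w n) - ip f g" for n
  proof -
    have "ip (\<lambda>x. u n x - f x) (\<lambda>x. w n x - g x) =
        ip (w n) (u n) - ip (w n) f - (ip g (u n) - ip g f)"
      using sym[OF a[of n] b[of n]] ip_diff[OF w(1)[of n] w(2) a[of n]]
        sym[OF w(1)[of n] a[of n]] sym[OF w(2) a[of n]]
        ip_diff[OF u(1)[of n] u(2) w(1)[of n]] ip_diff[OF u(1)[of n] u(2) w(2)]
        sym[OF u(1) w(1), of n n] sym[OF u(2) w(1), of n] sym[OF u(1) w(2), of n] sym[OF u(2) w(2)]
      by linarith
    then show ?thesis
      using ip_diff[OF u(1)[of n] u(2) w(2)] ip_diff[OF w(1)[of n] w(2) u(2)]
        sym[OF u(1) w(1), of n n] sym[OF u(1) w(2), of n] sym[OF u(2) w(2)]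
      by linarith
  qed
  then have "(\<lambda>n. ip (u n) (w n) - ip f g) \<longlonglongrightarrow> 0"
    using tendsto_add_zero[OF tendsto_add_zero[OF 1 2] 3] by simp
  then show ?thesis by (simp add: LIM_zero_cancel)
qed

lemma finite_span_subset:
  "(\<And>i. v i \<in> V) \<Longrightarrow> finite_span v \<subseteq> V"
  unfolding finite_span_def using lincomb by blast

end

section \<open>Square-integrable functions\<close>

text \<open>Functions instead of classes: with counting measure on the naturals this is l2, so
  sequence spaces and random variables share one theory.\<close>

definition L2 :: "'a measure \<Rightarrow> ('a \<Rightarrow> real) set" where
  "L2 M = {f. f \<in> borel_measurable M \<and> integrable M (\<lambda>x. (f x)\<^sup>2)}"

abbreviation L2_inner :: "'a measure \<Rightarrow> ('a \<Rightarrow> real) \<Rightarrow> ('a \<Rightarrow> real) \<Rightarrow> real" where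
  "L2_inner M f g \<equiv> \<integral>x. f x * g x \<partial>M"

lemma L2_mult_integrable:
  assumes "f \<in> L2 M" "g \<in> L2 M"
  shows "integrable M (\<lambda>x. f x * g x)"
proof (rule Bochner_Integration.integrable_bound)
  show "integrable M (\<lambda>x. (f x)\<^sup>2 + (g x)\<^sup>2)" using assms by (auto simp: L2_def)
  show "(\<lambda>x. f x * g x) \<in> borel_measurable M" using assms by (auto simp: L2_def)
  have "\<bar>f x * g x\<bar> \<le> (f x)\<^sup>2 + (g x)\<^sup>2" for x
    using zero_le_power2[of "f x - g x"] zero_le_power2[of "f x + g x"]
      zero_le_power2[of "f x"] zero_le_power2[of "g x"]
    unfolding abs_le_iff power2_diff power2_sum by linarith
  then show "AE x in M. norm (f x * g x) \<le> norm ((f x)\<^sup>2 + (g x)\<^sup>2)" by simp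
qed

interpretation L2: function_inner_product "L2 M" "L2_inner M" for M :: "'a measure"
proof
  fix f g assume f: "f \<in> L2 M" and g: "g \<in> L2 M"
  have "integrable M (\<lambda>x. (f x)\<^sup>2 + 2 * (f x * g x) + (g x)\<^sup>2)"
    using f g L2_mult_integrable[OF f g] by (auto simp: L2_def)
  moreover have "(\<lambda>x. (f x + g x)\<^sup>2) = (\<lambda>x. (f x)\<^sup>2 + 2 * (f x * g x) + (g x)\<^sup>2)"
    by (auto simp: power2_eq_square algebra_simps)
  ultimately show "(\<lambda>x. f x + g x) \<in> L2 M" using f g by (auto simp: L2_def)
next
  fix f g h assume "f \<in> L2 M" "g \<in> L2 M" "h \<in> L2 M"
  then show "L2_inner M (\<lambda>x. f x + g x) h = L2_inner M f h + L2_inner M g h"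
    by (simp add: distrib_right L2_mult_integrable)
next
  fix f g :: "'a \<Rightarrow> real" show "L2_inner M f g = L2_inner M g f" by (simp add: mult.commute)
  fix c show "L2_inner M (\<lambda>x. c * f x) g = c * L2_inner M f g" by (simp add: mult.assoc)
qed (auto simp: L2_def power_mult_distrib)

lemma L2_inner_self_nn:
  "f \<in> L2 M \<Longrightarrow> (\<integral>\<^sup>+x. ennreal ((f x)\<^sup>2) \<partial>M) = ennreal (L2_inner M f f)"
  by (simp add: L2_def nn_integral_eq_integral power2_eq_square[symmetric])

lemma L2I_nn:
  assumes "f \<in> borel_measurable M" "(\<integral>\<^sup>+x. ennreal ((f x)\<^sup>2) \<partial>M) \<le> ennreal c"
  shows "f \<in> L2 M" 
proof -
  have "(\<integral>\<^sup>+x. ennreal ((f x)\<^sup>2) \<partial>M) < \<infinity>"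
    using assms(2) by (metis ennreal_less_top infinity_ennreal_def le_less_trans)
  then show ?thesis
    using assms(1) by (auto simp: L2_def intro!: integrableI_nonneg)
qed

lemma L2_inner_self_le_nn:
  assumes "f \<in> borel_measurable M" "(\<integral>\<^sup>+x. ennreal ((f x)\<^sup>2) \<partial>M) \<le> ennreal c" "c \<ge> 0"
  shows "L2_inner M f f \<le> c"
  using L2_inner_self_nn[OF L2I_nn[OF assms(1,2)]] assms by simp

text \<open>Fatou's lemma applied to the squares. The bound is asked only eventually, so any number
  above the limit of the squared norms can serve as \<open>c\<close>.\<close>

lemma L2_Fatou:
  assumes "\<And>j. f j \<in> L2 M" "g \<in> borel_measurable M"
    and "AE x in M. (\<lambda>j. f j x) \<longlonglongrightarrow> g x"
    and le: "\<forall>\<^sub>F j in sequentially. L2_inner M (f j) (f j) \<le> c"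
  shows "g \<in> L2 M" "L2_inner M g g \<le> c"
proof -
  have m: "f j \<in> borel_measurable M" for j using assms(1) by (auto simp: L2_def)
  have c: "c \<ge> 0"
  proof -
    obtain j where "L2_inner M (f j) (f j) \<le> c"
      using eventually_happens[OF le] by auto
    then show ?thesis using L2.nonneg[OF assms(1)[of j]] by linarith
  qed
  have "(\<integral>\<^sup>+x. ennreal ((g x)\<^sup>2) \<partial>M) = (\<integral>\<^sup>+x. liminf (\<lambda>j. ennreal ((f j x)\<^sup>2)) \<partial>M)"
  proof (rule nn_integral_cong_AE, use assms(3) in eventually_elim)
    case (elim x)
    then have "(\<lambda>j. ennreal ((f j x)\<^sup>2)) \<longlonglongrightarrow> ennreal ((g x)\<^sup>2)"
      by (intro tendsto_intros)
    then show ?case using lim_imp_Liminf[OF sequentially_bot] by metis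
  qed
  also have "\<dots> \<le> liminf (\<lambda>j. \<integral>\<^sup>+x. ennreal ((f j x)\<^sup>2) \<partial>M)"
    by (rule nn_integral_liminf) (use m in measurable)
  also have "\<dots> = liminf (\<lambda>j. ennreal (L2_inner M (f j) (f j)))"
    using L2_inner_self_nn[OF assms(1)] by simp
  also have "\<dots> \<le> liminf (\<lambda>j::nat. ennreal c)"
    by (rule Liminf_mono) (use le in eventually_elim, auto intro: ennreal_leI)
  also have "\<dots> = ennreal c" by (simp add: Liminf_const)
  finally have *: "(\<integral>\<^sup>+x. ennreal ((g x)\<^sup>2) \<partial>M) \<le> ennreal c" .
  show "g \<in> L2 M" "L2_inner M g g \<le> c"
    using L2I_nn[OF assms(2) *] L2_inner_self_le_nn[OF assms(2) * c] by auto
qed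

text \<open>A single term is at most the whole sum B, hence |d j| is at most sqrt B times 2^-j and a
  geometric series dominates.\<close>

lemma summable_of_weighted_squares:
  fixes d :: "nat \<Rightarrow> real"
  assumes s: "summable (\<lambda>j. 4^j * (d j)\<^sup>2)"
  shows "summable d"
proof -
  define B where "B = (\<Sum>j. 4^j * (d j)\<^sup>2)"
  have "norm (d j) \<le> sqrt B * (1/2)^j" for j
  proof -
    have nn: "0 \<le> 4^j * (d j)\<^sup>2" for j by simp
    have "4^j * (d j)\<^sup>2 \<le> B"
      unfolding B_def using sum_le_suminf[OF s, of "{j}"] nn by auto
    then have "(2^j * \<bar>d j\<bar>)\<^sup>2 \<le> B"
      unfolding power_mult_distrib power2_abs by (simp add: power_even_eq[symmetric] power_mult)
    then have "2^j * \<bar>d j\<bar> \<le> sqrt B" by (rule real_le_rsqrt)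
    then show ?thesis by (simp add: power_one_over field_simps)
  qed
  moreover have "summable (\<lambda>j. sqrt B * (1/2)^j)"
    by (intro summable_mult summable_geometric) simp
  ultimately show ?thesis
    by (meson summable_comparison_test')
qed

text \<open>The differences \<open>D j\<close> satisfy \<open>(\<Sum>j. 4^j * (D j)\<^sup>2) < \<infinity>\<close> almost everywhere; the
  weight \<open>4^j\<close> replaces the finiteness of the measure that an \<open>L1\<close> argument would need.\<close>

lemma L2_fast_Cauchy_AE_convergent:
  assumes f: "\<And>j. f j \<in> L2 M"
    and fast: "\<And>j. L2_inner M (\<lambda>x. f (Suc j) x - f j x) (\<lambda>x. f (Suc j) x - f j x) \<le> c * (1/8)^j"
  shows "\<exists>g\<in>borel_measurable M. AE x in M. (\<lambda>j. f j x) \<longlonglongrightarrow> g x"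
proof -
  have m[measurable]: "f j \<in> borel_measurable M" for j using f by (auto simp: L2_def)
  define D where "D j x = f (Suc j) x - f j x" for j x
  have D: "D j \<in> L2 M" for j unfolding D_def by (rule L2.diff[OF f f])
  have Dm[measurable]: "D j \<in> borel_measurable M" for j using D by (auto simp: L2_def)
  have c: "c \<ge> 0" using fast[of 0] order_trans[OF L2.nonneg[OF D[of 0]]] unfolding D_def by simp
  have "(\<integral>\<^sup>+x. (\<Sum>j. ennreal (4^j * (D j x)\<^sup>2)) \<partial>M) = (\<Sum>j. \<integral>\<^sup>+x. ennreal (4^j * (D j x)\<^sup>2) \<partial>M)"
    by (rule nn_integral_suminf) measurable
  also have "\<dots> \<le> (\<Sum>j. ennreal (c * (1/2)^j))"
  proof (rule suminf_le[OF _ summableI summableI])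
    fix j
    have "(\<integral>\<^sup>+x. ennreal (4^j * (D j x)\<^sup>2) \<partial>M) = ennreal (4^j) * (\<integral>\<^sup>+x. ennreal ((D j x)\<^sup>2) \<partial>M)"
      by (subst nn_integral_cmult[symmetric]) (auto simp: ennreal_mult')
    also have "\<dots> = ennreal (4^j * L2_inner M (D j) (D j))"
      using L2_inner_self_nn[OF D[of j]] by (simp add: ennreal_mult')
    also have "\<dots> \<le> ennreal (4^j * (c * (1/8)^j))"
      using fast[of j] by (intro ennreal_leI mult_left_mono) (auto simp: D_def)
    \<comment> \<open>Decay at rate 8 leaves a factor 1/2 after the weight 4 has been paid.\<close>
    also have "4^j * (c * (1/8)^j) = c * (1/2::real)^j"
      by (simp add: power_divide field_simps) (simp flip: power_mult_distrib)
    finally show "(\<integral>\<^sup>+x. ennreal (4^j * (D j x)\<^sup>2) \<partial>M) \<le> ennreal (c * (1/2)^j)" .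
  qed
  also have "\<dots> < \<infinity>"
    using c by (subst suminf_ennreal2) (auto intro!: summable_mult)
  finally have fin: "(\<integral>\<^sup>+x. (\<Sum>j. ennreal (4^j * (D j x)\<^sup>2)) \<partial>M) < \<infinity>" .
  have "AE x in M. (\<Sum>j. ennreal (4^j * (D j x)\<^sup>2)) \<noteq> \<infinity>"
    by (rule nn_integral_PInf_AE[OF _ less_imp_neq[OF fin]]) measurable
  then have conv: "AE x in M. convergent (\<lambda>j. f j x)"
  proof eventually_elim
    case (elim x)
    then have s: "summable (\<lambda>j. 4^j * (D j x)\<^sup>2)"
      by (intro summable_suminf_not_top) (simp_all)
    then have "summable (\<lambda>j. D j x)" by (rule summable_of_weighted_squares)
    then have "convergent (\<lambda>n. \<Sum>j<n. D j x)" by (simp add: summable_iff_convergent)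
    moreover have "(\<Sum>j<n. D j x) = f n x - f 0 x" for n
      unfolding D_def by (induction n) auto
    ultimately have "convergent (\<lambda>n. f n x - f 0 x)" by simp
    then show ?case by (simp add: convergent_diff_const_right_iff)
  qed
  define g where "g x = lim (\<lambda>j. f j x)" for x
  have "g \<in> borel_measurable M" unfolding g_def by measurable
  moreover have "AE x in M. (\<lambda>j. f j x) \<longlonglongrightarrow> g x"
    using conv by eventually_elim (simp add: g_def convergent_LIMSEQ_iff)
  ultimately show ?thesis by blast
qed

text \<open>Riesz-Fischer: a rapidly Cauchy subsequence has an almost everywhere limit, and Fatou's
  lemma in one of the two indices turns the Cauchy estimate into an estimate of the distance to that
  limit.\<close>

lemma L2_complete:
  assumes f: "\<And>n. f n \<in> L2 M"
    and Cauchy: "\<And>e. e > 0 \<Longrightarrow> \<exists>N. \<forall>m\<ge>N. \<forall>n\<ge>N.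
       L2_inner M (\<lambda>x. f m x - f n x) (\<lambda>x. f m x - f n x) < e"
  shows "\<exists>g\<in>L2 M. (\<lambda>n. L2_inner M (\<lambda>x. f n x - g x) (\<lambda>x. f n x - g x)) \<longlonglongrightarrow> 0"
proof -
  have "\<exists>N. \<forall>m\<ge>N. \<forall>n\<ge>N. L2_inner M (\<lambda>x. f m x - f n x) (\<lambda>x. f m x - f n x) < (1/8)^j" for j :: nat
    by (rule Cauchy) simp
  then obtain N where N: "\<And>j m n. m \<ge> N j \<Longrightarrow> n \<ge> N j \<Longrightarrow>
      L2_inner M (\<lambda>x. f m x - f n x) (\<lambda>x. f m x - f n x) < (1/8)^(j::nat)"
    by metis
  \<comment> \<open>Summing all thresholds up to j makes \<open>r\<close> monotone and at least
    \<open>N j\<close>; the extra j makes it unbounded.\<close>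
  define r where "r j = j + (\<Sum>i\<le>j. N i)" for j
  have rN: "r j \<ge> N j" for j
    unfolding r_def using member_le_sum[of j "{..j}" N] by auto
  have rSuc: "r (Suc j) \<ge> r j" for j unfolding r_def by simp
  have rj: "r j \<ge> j" for j unfolding r_def by simp
  have "L2_inner M (\<lambda>x. f (r (Suc j)) x - f (r j) x) (\<lambda>x. f (r (Suc j)) x - f (r j) x) \<le> 1 * (1/8)^j" for j
    using N[of j "r (Suc j)" "r j"] rN[of j] rSuc[of j] by simp
  from L2_fast_Cauchy_AE_convergent[of "\<lambda>j. f (r j)", OF f this]
  obtain g where gm: "g \<in> borel_measurable M" and g: "AE x in M. (\<lambda>j. f (r j) x) \<longlonglongrightarrow> g x" by auto
  have fat: "(\<lambda>x. f n x - g x) \<in> L2 M \<and> L2_inner M (\<lambda>x. f n x - g x) (\<lambda>x. f n x - g x) \<le> e"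
    if "\<forall>m\<ge>N'. \<forall>n\<ge>N'. L2_inner M (\<lambda>x. f m x - f n x) (\<lambda>x. f m x - f n x) < e" "n \<ge> N'" for e n N'
  proof -
    note Fatou = L2_Fatou[where f="\<lambda>j x. f n x - f (r j) x" and g="\<lambda>x. f n x - g x" and c=e]
    have 1: "(\<lambda>x. f n x - g x) \<in> borel_measurable M" using f[of n] gm by (auto simp: L2_def)
    have 2: "AE x in M. (\<lambda>j. f n x - f (r j) x) \<longlonglongrightarrow> f n x - g x"
      using g by eventually_elim (intro tendsto_intros)
    have 3: "\<forall>\<^sub>F j in sequentially. L2_inner M (\<lambda>x. f n x - f (r j) x) (\<lambda>x. f n x - f (r j) x) \<le> e"
      unfolding eventually_sequentially
      using that order_trans[OF _ rj] by (intro exI[of _ N'] allI impI less_imp_le) blast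
    show ?thesis using Fatou[OF L2.diff[OF f f] 1 2 3] by blast
  qed
  obtain N1 where N1: "\<forall>m\<ge>N1. \<forall>n\<ge>N1. L2_inner M (\<lambda>x. f m x - f n x) (\<lambda>x. f m x - f n x) < 1"
    using Cauchy[of 1] by auto
  have "g \<in> L2 M"
    using L2.diff[OF f[of N1] conjunct1[OF fat[OF N1 order_refl]]] by simp
  moreover have "(\<lambda>n. L2_inner M (\<lambda>x. f n x - g x) (\<lambda>x. f n x - g x)) \<longlonglongrightarrow> 0"
  proof (rule LIMSEQ_I)
    fix e :: real assume "e > 0"
    then obtain N' where N': "\<forall>m\<ge>N'. \<forall>n\<ge>N'. L2_inner M (\<lambda>x. f m x - f n x) (\<lambda>x. f m x - f n x) < e/2"
      using Cauchy[of "e/2"] by auto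
    then show "\<exists>no. \<forall>n\<ge>no. norm (L2_inner M (\<lambda>x. f n x - g x) (\<lambda>x. f n x - g x) - 0) < e"
      using fat[OF N'] L2.nonneg[of "\<lambda>x. f _ x - g x" M] \<open>e > 0\<close>
      by (intro exI[of _ N']) fastforce
  qed
  ultimately show ?thesis by blast
qed

section \<open>Reproducing kernel Hilbert spaces\<close>

text \<open>Stated for any space and inner product satisfying \<open>is_rkhs\<close> instead of for
  \<open>rkhs K\<close>, so that two candidates for the same kernel can be compared side by side in
  the uniqueness proof.\<close>

locale rkhs_space =
  fixes K :: "'t \<Rightarrow> 't \<Rightarrow> real" and H ip
  assumes is_rkhs: "is_rkhs K H ip"

sublocale rkhs_space \<subseteq> function_inner_product H ip
  using is_rkhs unfolding is_rkhs_def by unfold_locales blast+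

context rkhs_space
begin

abbreviation "sq f \<equiv> ip f f"

lemma kernel_in: "(\<lambda>s. K s t) \<in> H"
  using is_rkhs unfolding is_rkhs_def by blast

lemma reproducing: "f \<in> H \<Longrightarrow> ip f (\<lambda>s. K s t) = f t"
  using is_rkhs unfolding is_rkhs_def by blast

lemma complete:
  assumes u: "\<And>n. u n \<in> H"
    and Cauchy: "\<And>e. e > 0 \<Longrightarrow> \<exists>N. \<forall>m\<ge>N. \<forall>n\<ge>N. sq (\<lambda>t. u m t - u n t) < e"
  shows "\<exists>f\<in>H. (\<lambda>n. sq (\<lambda>t. u n t - f t)) \<longlonglongrightarrow> 0"
proof -
  have "\<exists>N. \<forall>m\<ge>N. \<forall>n\<ge>N. sqrt (sq (\<lambda>t. u m t - u n t)) < e" if e: "e > 0" for e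
  proof -
    obtain N where "\<forall>m\<ge>N. \<forall>n\<ge>N. sq (\<lambda>t. u m t - u n t) < e\<^sup>2"
      using Cauchy[OF zero_less_power[OF e]] by blast
    then show ?thesis
      using e real_sqrt_less_mono[of _ "e\<^sup>2"] by (intro exI[of _ N]) fastforce
  qed
  moreover have "\<forall>u. range u \<subseteq> H \<and>
        (\<forall>e>0. \<exists>N. \<forall>m\<ge>N. \<forall>n\<ge>N. sqrt (sq (\<lambda>t. u m t - u n t)) < e) \<longrightarrow>
        (\<exists>f\<in>H. (\<lambda>n. sqrt (sq (\<lambda>t. u n t - f t))) \<longlonglongrightarrow> 0)"
    using is_rkhs unfolding is_rkhs_def by blast
  ultimately obtain f where f: "f \<in> H" "(\<lambda>n. sqrt (sq (\<lambda>t. u n t - f t))) \<longlonglongrightarrow> 0"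
    using u by blast
  have "(\<lambda>n. (sqrt (sq (\<lambda>t. u n t - f t)))\<^sup>2) \<longlonglongrightarrow> 0\<^sup>2"
    by (intro tendsto_power f(2))
  then show ?thesis using f(1) u by (auto simp: nonneg diff)
qed

lemma eval_le: "f \<in> H \<Longrightarrow> (f t)\<^sup>2 \<le> sq f * K t t"
  using Cauchy_Schwarz[of f "\<lambda>s. K s t"] kernel_in reproducing by simp

lemma eval_diff_tendsto:
  assumes "\<And>n. u n \<in> H" "f \<in> H" "(\<lambda>n. sq (\<lambda>t. u n t - f t)) \<longlonglongrightarrow> 0"
  shows "(\<lambda>n. u n t) \<longlonglongrightarrow> f t"
proof -
  have "(\<lambda>n. (u n t - f t)\<^sup>2) \<longlonglongrightarrow> 0"
  proof (rule tendsto_sandwich[where f="\<lambda>_. 0" and h="\<lambda>n. sq (\<lambda>t. u n t - f t) * K t t"])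
    show "\<forall>\<^sub>F n in sequentially. (u n t - f t)\<^sup>2 \<le> sq (\<lambda>t. u n t - f t) * K t t"
      using eval_le[OF diff[OF assms(1,2)]] by simp
    show "(\<lambda>n. sq (\<lambda>t. u n t - f t) * K t t) \<longlonglongrightarrow> 0"
      using tendsto_mult_left_zero[OF assms(3)] by simp
  qed auto
  then show ?thesis by (simp add: LIM_zero_cancel)
qed

abbreviation "S \<equiv> finite_span (\<lambda>t s. K s t)"

lemma span_subset: "S \<subseteq> H"
  using finite_span_subset[of "\<lambda>t s. K s t"] kernel_in by blast

text \<open>A minimizing sequence for the distance of \<open>f\<close> to the span is Cauchy; since the error is
  asymptotically orthogonal to every \<open>K(\<cdot>, t)\<close>, the reproducing property identifies its limit
  with \<open>f\<close>.\<close>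

lemma span_dense:
  assumes f: "f \<in> H" and "e > 0"
  shows "\<exists>g\<in>S. sq (\<lambda>t. f t - g t) < e"
proof -
  note in_H = subsetD[OF span_subset]
  define D where "D = {sq (\<lambda>t. f t - g t) | g. g \<in> S}"
  have D: "D \<noteq> {}" "bdd_below D"
    using finite_span_zero nonneg[OF diff[OF f in_H]] by (auto simp: D_def intro!: bdd_belowI[of _ 0])
  have low: "Inf D \<le> sq (\<lambda>t. f t - g t)" if "g \<in> S" for g
    using that D by (intro cInf_lower) (auto simp: D_def)
  have "\<exists>g\<in>S. sq (\<lambda>t. f t - g t) < Inf D + 1 / Suc n" for n
    using cInf_lessD[OF D(1), of "Inf D + 1 / Suc n"] by (auto simp: D_def)
  then obtain g where gS: "\<And>n. g n \<in> S"
    and g: "\<And>n. sq (\<lambda>t. f t - g n t) < Inf D + 1 / Suc n" by metis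
  note gH = in_H[OF gS]
  \<comment> \<open>Moving from \<open>g n\<close> along h cannot lower the squared distance by more
    than 1/(n+1), so the corresponding quadratic polynomial in the step length has nonpositive
    discriminant.\<close>
  have orth: "(ip (\<lambda>t. f t - g n t) h)\<^sup>2 \<le> 1 / Suc n * sq h" if h: "h \<in> S" for n h
  proof (rule discriminant_nonpos)
    fix c
    have "Inf D \<le> sq (\<lambda>t. f t - (g n t + c * h t))"
      by (intro low finite_span_add finite_span_scale gS h)
    also have "(\<lambda>t. f t - (g n t + c * h t)) = (\<lambda>t. (f t - g n t) - c * h t)"
      by (simp add: algebra_simps)
    also have "sq \<dots> = sq (\<lambda>t. f t - g n t) - 2 * c * ip (\<lambda>t. f t - g n t) h + c\<^sup>2 * sq h"
      using norm_diff[OF diff[OF f gH] scale[OF in_H[OF h]], of n c]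
        sym[OF diff[OF f gH] scale[OF in_H[OF h]], of n c]
        sym[OF diff[OF f gH] in_H[OF h], of n]
        ip_scale[OF in_H[OF h] diff[OF f gH], of c n] norm_scale[OF in_H[OF h], of c]
      by simp
    finally show "0 \<le> 1 / Suc n - 2 * c * ip (\<lambda>t. f t - g n t) h + c\<^sup>2 * sq h"
      using g[of n] by simp
  qed (use nonneg in_H[OF h] in blast)
  \<comment> \<open>With h the difference of two approximants, the squared norm of h is the
    difference of the inner products of the two errors with h. Both are small by
    \<open>orth\<close>, and dividing by the squared norm of h gives the rate.\<close>
  have close: "sq (\<lambda>t. g m t - g n t) \<le> 2 * (1 / Suc m + 1 / Suc n)" for m n
  proof -
    define h where "h = (\<lambda>t. g m t - g n t)"
    have h: "h \<in> S" unfolding h_def by (intro finite_span_diff gS)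
    define b where "b n = ip (\<lambda>t. f t - g n t) h" for n
    have "(\<lambda>t. (f t - g n t) - (f t - g m t)) = h" by (auto simp: h_def)
    then have sq_h: "sq h = b n - b m"
      using ip_diff[OF diff[OF f gH] diff[OF f gH] in_H[OF h], of n m] by (simp add: b_def)
    have 1: "(sq h)\<^sup>2 \<le> 2 * ((b n)\<^sup>2 + (b m)\<^sup>2)"
      using zero_le_power2[of "b n + b m"] unfolding sq_h by (simp add: power2_diff power2_sum)
    have "(b n)\<^sup>2 \<le> 1 / Suc n * sq h" "(b m)\<^sup>2 \<le> 1 / Suc m * sq h"
      using orth[OF h] unfolding b_def by blast+
    then have "(b n)\<^sup>2 + (b m)\<^sup>2 \<le> 1 / Suc n * sq h + 1 / Suc m * sq h"
      by (rule add_mono)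
    then have "(sq h)\<^sup>2 \<le> 2 * (1 / Suc n * sq h + 1 / Suc m * sq h)"
      by (intro order_trans[OF 1] mult_left_mono) auto
    then have "(sq h)\<^sup>2 \<le> 2 * (1 / Suc m + 1 / Suc n) * sq h" by (simp only: algebra_simps)
    then show ?thesis
      using nonneg[OF in_H[OF h]] unfolding h_def[symmetric]
      by (cases "sq h = 0") (simp_all add: power2_eq_square)
  qed
  have "\<exists>N. \<forall>m\<ge>N. \<forall>n\<ge>N. sq (\<lambda>t. g m t - g n t) < e" if e: "e > 0" for e
  proof -
    have "e / 4 > 0" using e by simp
    from nat_approx_posE[OF this] obtain N where N: "1 / real (Suc N) < e / 4" by metis
    have *: "1 / real (Suc m) < e / 4" if "m \<ge> N" for m
      using that by (intro le_less_trans[OF _ N] divide_left_mono) auto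
    have "sq (\<lambda>t. g m t - g n t) < e" if "m \<ge> N" "n \<ge> N" for m n
      using close[of m n] *[OF that(1)] *[OF that(2)] by simp
    then show ?thesis by blast
  qed
  from complete[OF gH this] obtain f' where f': "f' \<in> H" "(\<lambda>n. sq (\<lambda>t. g n t - f' t)) \<longlonglongrightarrow> 0" by auto
  have "f' t = f t" for t
  proof -
    \<comment> \<open>Tested against the section of K at t, \<open>orth\<close> is a bound on the
      pointwise error.\<close>
    have "(\<lambda>n. (f t - g n t)\<^sup>2) \<longlonglongrightarrow> 0"
    proof (rule tendsto_sandwich[where f="\<lambda>_. 0" and h="\<lambda>n. 1 / real (Suc n) * K t t"])
      show "\<forall>\<^sub>F n in sequentially. (f t - g n t)\<^sup>2 \<le> 1 / real (Suc n) * K t t"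
        using orth[OF finite_span_base[of "\<lambda>t s. K s t" t]] reproducing[OF diff[OF f gH]]
          reproducing[OF kernel_in[of t], of t] by simp
      show "(\<lambda>n. 1 / real (Suc n) * K t t) \<longlonglongrightarrow> 0"
        by (intro tendsto_mult_left_zero LIMSEQ_Suc[OF lim_1_over_n])
    qed auto
    then have "(\<lambda>n. f t - g n t) \<longlonglongrightarrow> 0" by simp
    then have "(\<lambda>n. g n t) \<longlonglongrightarrow> f t"
      using tendsto_diff[OF tendsto_const[of "f t"], of "\<lambda>n. f t - g n t" 0] by simp
    then show ?thesis
      using eval_diff_tendsto[OF gH f'] LIMSEQ_unique by blast
  qed
  then have "f' = f" by auto
  with f'(2) have "\<forall>\<^sub>F n in sequentially. sq (\<lambda>t. g n t - f t) < e"
    using \<open>e > 0\<close> by (simp add: order_tendstoD)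
  then obtain n where "sq (\<lambda>t. g n t - f t) < e" using eventually_happens by force
  moreover have "sq (\<lambda>t. f t - g n t) = sq (\<lambda>t. g n t - f t)"
    using norm_diff[OF f gH[of n]] norm_diff[OF gH[of n] f] sym[OF f gH[of n]] by simp
  ultimately show ?thesis using gS[of n] by (intro bexI[of _ "g n"]) simp_all
qed

lemma span_inner:
  assumes "finite F" "w \<in> H"
  shows "ip (\<lambda>s. \<Sum>t\<in>F. a t * K s t) w = (\<Sum>t\<in>F. a t * w t)"
  using ip_lincomb[of F "\<lambda>t s. K s t" w a] kernel_in reproducing[OF assms(2)]
    sym[OF kernel_in assms(2)] assms by simp

end

text \<open>The inner product of kernel combinations is prescribed by K alone. Hence combinations
  converging to f in one space are Cauchy in the other, and as both limits are also pointwise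
  limits, they are the same function.\<close>

lemma is_rkhs_subset:
  assumes "is_rkhs K H ip" "is_rkhs K H' ip'"
  shows "H \<subseteq> H'"
proof
  interpret A: rkhs_space K H ip by unfold_locales fact
  interpret B: rkhs_space K H' ip' by unfold_locales fact
  fix f assume f: "f \<in> H"
  have eq: "ip u w = ip' u w" if u: "u \<in> A.S" and w: "w \<in> A.S" for u w
  proof -
    obtain F a where "finite F" "u = (\<lambda>s. \<Sum>t\<in>F. a t * K s t)"
      using u by (auto simp: finite_span_def)
    then show ?thesis
      using A.span_inner[of F w a] B.span_inner[of F w a] subsetD[OF A.span_subset w] subsetD[OF B.span_subset w] by simp
  qed
  have "\<exists>g\<in>A.S. A.sq (\<lambda>t. f t - g t) < 1 / Suc n" for n
    by (rule A.span_dense[OF f]) simp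
  then obtain g where gS: "\<And>n. g n \<in> A.S" and g: "\<And>n. A.sq (\<lambda>t. f t - g n t) < 1 / Suc n" by metis
  have gH: "g n \<in> H" and gH': "g n \<in> H'" for n using gS A.span_subset B.span_subset by auto
  have sym: "A.sq (\<lambda>t. g n t - f t) = A.sq (\<lambda>t. f t - g n t)" for n
    using A.norm_diff[OF f gH[of n]] A.norm_diff[OF gH[of n] f] A.sym[OF f gH[of n]] by simp
  have inv: "(\<lambda>n. 1 / real (Suc n)) \<longlonglongrightarrow> 0"
    by (rule LIMSEQ_Suc[OF lim_1_over_n])
  have lim: "(\<lambda>n. A.sq (\<lambda>t. g n t - f t)) \<longlonglongrightarrow> 0"
    by (rule tendsto_sandwich[OF _ _ tendsto_const inv])
       (use less_imp_le[OF g] A.nonneg[OF A.diff[OF f gH]] in \<open>simp_all add: sym\<close>)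
  have "\<exists>N. \<forall>m\<ge>N. \<forall>n\<ge>N. B.sq (\<lambda>t. g m t - g n t) < e" if e: "e > 0" for e
  proof -
    obtain N where N: "\<And>n. n \<ge> N \<Longrightarrow> A.sq (\<lambda>t. g n t - f t) < e / 4"
      using order_tendstoD(2)[OF lim, of "e/4"] e unfolding eventually_sequentially by (meson divide_pos_pos zero_less_numeral)
    have "A.sq (\<lambda>t. g m t - g n t) < e" if "m \<ge> N" "n \<ge> N" for m n
      using A.norm_diff_le[OF gH[of m] f gH[of n]] N[OF that(1)] N[OF that(2)] sym[of n] by simp
    then show ?thesis
      using eq[OF finite_span_diff[OF gS gS] finite_span_diff[OF gS gS]] by auto
  qed
  from B.complete[OF gH' this] obtain f' where f': "f' \<in> H'" "(\<lambda>n. B.sq (\<lambda>t. g n t - f' t)) \<longlonglongrightarrow> 0"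
    by auto
  have "f' t = f t" for t
    using A.eval_diff_tendsto[OF gH f lim] B.eval_diff_tendsto[OF gH' f'] LIMSEQ_unique by blast
  then show "f \<in> H'" using f'(1) by (metis ext)
qed

text \<open>Exchanging the two candidates in \<open>is_rkhs_subset\<close> gives equality, so that
  the definite description has a unique witness.\<close>

lemma rkhs_eqI: "is_rkhs K H ip \<Longrightarrow> rkhs K = H"
  unfolding rkhs_def using is_rkhs_subset by (intro the_equality) blast+

lemma is_rkhs_rkhs: "is_rkhs K H ip \<Longrightarrow> is_rkhs K (rkhs K) (rkhs_inner K)"
  using rkhs_eqI[of K H ip] unfolding rkhs_inner_def by (metis someI_ex)


text \<open>The Moore-Aronszajn construction relative to a feature map \<open>v\<close>, with the closed subspace
  \<open>W\<close> in the role of the closed span of the features.\<close>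

lemma is_rkhs_feature_map:
  fixes v :: "'t \<Rightarrow> 'n \<Rightarrow> real"
  assumes W: "W \<subseteq> L2 N" and zero: "(\<lambda>x. 0) \<in> W"
    and add: "\<And>f g. f \<in> W \<Longrightarrow> g \<in> W \<Longrightarrow> (\<lambda>x. f x + g x) \<in> W"
    and scale: "\<And>f c. f \<in> W \<Longrightarrow> (\<lambda>x. c * f x) \<in> W"
    and closed: "\<And>z f. (\<And>n::nat. z n \<in> W) \<Longrightarrow> f \<in> L2 N \<Longrightarrow>
      (\<lambda>n. L2_inner N (\<lambda>x. z n x - f x) (\<lambda>x. z n x - f x)) \<longlonglongrightarrow> 0 \<Longrightarrow> f \<in> W"
    and v: "\<And>t. v t \<in> W"
    and inj: "\<And>f. f \<in> W \<Longrightarrow> (\<And>t. L2_inner N f (v t) = 0) \<Longrightarrow> L2_inner N f f = 0"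
  shows "\<exists>ip. is_rkhs (\<lambda>s t. L2_inner N (v s) (v t)) ((\<lambda>f t. L2_inner N f (v t)) ` W) ip"
proof -
  define T where "T f t = L2_inner N f (v t)" for f t
  \<comment> \<open>T determines its argument only up to norm 0. A preimage is chosen here, and
    \<open>rep_inner\<close> shows that inner products do not depend on the choice.\<close>
  define rep where "rep h = (SOME f. f \<in> W \<and> T f = h)" for h
  define ip where "ip h h' = L2_inner N (rep h) (rep h')" for h h'
  note L = subsetD[OF W]
  have diff: "(\<lambda>x. f x - g x) \<in> W" if "f \<in> W" "g \<in> W" for f g
    using add[OF that(1) scale[OF that(2), of "-1"]] by simp
  have T_add: "T (\<lambda>x. f x + g x) = (\<lambda>t. T f t + T g t)" if "f \<in> W" "g \<in> W" for f g
    unfolding T_def using L2.ip_add[OF L L L] that v by blast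
  have T_diff: "T (\<lambda>x. f x - g x) = (\<lambda>t. T f t - T g t)" if "f \<in> W" "g \<in> W" for f g
    unfolding T_def using L2.ip_diff[OF L L L] that v by blast
  have T_scale: "T (\<lambda>x. c * f x) = (\<lambda>t. c * T f t)" if "f \<in> W" for f c
    unfolding T_def using L2.ip_scale[OF L L] that v by blast
  have rep: "rep (T f) \<in> W" "T (rep (T f)) = T f" if "f \<in> W" for f
    unfolding rep_def using someI[of "\<lambda>g. g \<in> W \<and> T g = T f" f] that by auto
  have rep_inner: "L2_inner N (rep (T f)) g = L2_inner N f g" if "f \<in> W" "g \<in> W" for f g
  proof -
    let ?d = "\<lambda>x. rep (T f) x - f x"
    have d: "?d \<in> W" using rep(1) that diff by blast
    have "L2_inner N ?d (v t) = 0" for t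
      using T_diff[OF rep(1)[OF that(1)] that(1)] rep(2)[OF that(1)] by (metis T_def diff_self)
    then have "L2_inner N ?d ?d = 0" by (rule inj[OF d])
    then have "(L2_inner N ?d g)\<^sup>2 \<le> 0"
      using L2.Cauchy_Schwarz[OF L[OF d] L[OF that(2)]] by simp
    then show ?thesis
      using L2.ip_diff[OF L[OF rep(1)] L L, of f f g] that by simp
  qed
  have ip: "ip (T f) (T g) = L2_inner N f g" if "f \<in> W" "g \<in> W" for f g
    unfolding ip_def using rep_inner[OF that(1) rep(1)[OF that(2)]] rep_inner[OF that(2,1)]
    by (simp add: mult.commute)
  have in_TW: "T f \<in> T ` W" if "f \<in> W" for f using that by blast
  have "is_rkhs (\<lambda>s t. L2_inner N (v s) (v t)) (T ` W) ip"
    unfolding is_rkhs_def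
  proof (intro conjI ballI allI impI; (elim imageE; clarify)?)
    show "(\<lambda>t. 0) \<in> T ` W"
      using in_TW[OF zero] by (simp add: T_def[abs_def])
  next
    fix f g assume "f \<in> W" "g \<in> W"
    then show "(\<lambda>t. T f t + T g t) \<in> T ` W" using T_add in_TW add by metis
  next
    fix c f assume "f \<in> W"
    then show "(\<lambda>t. c * T f t) \<in> T ` W" using T_scale in_TW scale by metis
  next
    fix f g assume "f \<in> W" "g \<in> W"
    then show "ip (T f) (T g) = ip (T g) (T f)" by (simp add: ip mult.commute)
  next
    fix f g h assume *: "f \<in> W" "g \<in> W" "h \<in> W"
    then show "ip (\<lambda>t. T f t + T g t) (T h) = ip (T f) (T h) + ip (T g) (T h)"
      unfolding T_add[OF *(1,2), symmetric] ip[OF add[OF *(1,2)] *(3)] ip[OF *(1,3)] ip[OF *(2,3)]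
      by (intro L2.ip_add L)
  next
    fix c f g assume *: "f \<in> W" "g \<in> W"
    then show "ip (\<lambda>t. c * T f t) (T g) = c * ip (T f) (T g)"
      unfolding T_scale[OF *(1), symmetric] ip[OF scale[OF *(1)] *(2)] ip[OF *]
      by (intro L2.ip_scale L)
  next
    fix f assume "f \<in> W"
    then show "0 \<le> ip (T f) (T f)" by (simp add: ip)
  next
    fix f assume f: "f \<in> W" and 0: "ip (T f) (T f) = 0"
    have "(T f t)\<^sup>2 \<le> 0" for t
      using L2.Cauchy_Schwarz[OF L[OF f] L[OF v[of t]]] ip[OF f f] 0 by (simp add: T_def)
    then show "T f = (\<lambda>t. 0)" by (auto simp: fun_eq_iff)
  next
    fix t
    have "(\<lambda>s. L2_inner N (v s) (v t)) = T (v t)" by (auto simp: T_def mult.commute)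
    then show "(\<lambda>s. L2_inner N (v s) (v t)) \<in> T ` W" using in_TW[OF v] by simp
  next
    fix f t assume f: "f \<in> W"
    have "(\<lambda>s. L2_inner N (v s) (v t)) = T (v t)" by (auto simp: T_def mult.commute)
    then show "ip (T f) (\<lambda>s. L2_inner N (v s) (v t)) = T f t" using ip[OF f v] by (simp add: T_def)
  next
    fix u :: "nat \<Rightarrow> 't \<Rightarrow> real"
    assume "range u \<subseteq> T ` W \<and>
      (\<forall>e>0. \<exists>N. \<forall>m\<ge>N. \<forall>n\<ge>N. sqrt (ip (\<lambda>t. u m t - u n t) (\<lambda>t. u m t - u n t)) < e)"
    then have u: "range u \<subseteq> T ` W"
      and Cauchy: "\<forall>e>0. \<exists>N. \<forall>m\<ge>N. \<forall>n\<ge>N. sqrt (ip (\<lambda>t. u m t - u n t) (\<lambda>t. u m t - u n t)) < e"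
      by blast+
    have "\<forall>n. \<exists>f. f \<in> W \<and> u n = T f" using u by blast
    then obtain z where z: "\<And>n. z n \<in> W" and uz: "\<And>n. u n = T (z n)" by metis
    let ?nd = "\<lambda>f g. L2_inner N (\<lambda>x. f x - g x) (\<lambda>x. f x - g x)"
    have nd: "ip (\<lambda>t. T f t - T g t) (\<lambda>t. T f t - T g t) = ?nd f g" if "f \<in> W" "g \<in> W" for f g
      unfolding T_diff[OF that, symmetric] by (rule ip[OF diff[OF that] diff[OF that]])
    have "\<exists>M. \<forall>m\<ge>M. \<forall>n\<ge>M. ?nd (z m) (z n) < e" if e: "e > 0" for e
    proof -
      obtain M where M: "\<forall>m\<ge>M. \<forall>n\<ge>M. sqrt (?nd (z m) (z n)) < sqrt e"
        using Cauchy[rule_format, of "sqrt e"] e by (auto simp: uz nd z)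
      then show ?thesis by (intro exI[of _ M]) simp
    qed
    from L2_complete[OF L[OF z] this] obtain f
      where f: "f \<in> L2 N" "(\<lambda>n. ?nd (z n) f) \<longlonglongrightarrow> 0" by blast
    have fW: "f \<in> W" by (rule closed[OF z f])
    have "(\<lambda>n. sqrt (?nd (z n) f)) \<longlonglongrightarrow> sqrt 0" by (intro tendsto_intros f(2))
    then show "\<exists>f\<in>T ` W. (\<lambda>n. sqrt (ip (\<lambda>t. u n t - f t) (\<lambda>t. u n t - f t))) \<longlonglongrightarrow> 0"
      using fW nd[OF z fW] by (intro bexI[of _ "T f"]) (auto simp: uz)
  qed
  moreover have "T ` W = (\<lambda>f t. L2_inner N f (v t)) ` W" by (auto simp: T_def[abs_def])
  ultimately show ?thesis by metis
qed

text \<open>The closed span W of the variables in L2 serves as feature space, with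
  \<open>X t\<close> as the feature at t. Existence for a covariance kernel thus follows from
  completeness of L2, without an abstract completion of kernel combinations.\<close>

lemma is_rkhs_covariance:
  fixes X :: "'t \<Rightarrow> 'w \<Rightarrow> real"
  assumes X: "\<And>t. X t \<in> L2 M"
  shows "\<exists>H ip. is_rkhs (\<lambda>s t. L2_inner M (X s) (X t)) H ip"
proof -
  let ?nd = "\<lambda>f g. L2_inner M (\<lambda>x. f x - g x) (\<lambda>x. f x - g x)"
  define S where "S = finite_span X"
  define W where "W = {f \<in> L2 M. \<forall>e>0. \<exists>u\<in>S. ?nd f u < e}"
  have S: "S \<subseteq> L2 M" unfolding S_def by (rule L2.finite_span_subset[OF X])
  have SW: "S \<subseteq> W"
  proof
    fix u assume "u \<in> S"
    then show "u \<in> W" using S by (auto simp: W_def intro!: bexI[of _ u])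
  qed
  have WD: "f \<in> L2 M" "\<And>e. e > 0 \<Longrightarrow> \<exists>u\<in>S. ?nd f u < e" if "f \<in> W" for f
    using that by (auto simp: W_def)
  \<comment> \<open>Approximation from W is as good as approximation from S; the closure properties
    of W below are reduced to this.\<close>
  have WI: "f \<in> W" if f: "f \<in> L2 M" and *: "\<And>e. e > 0 \<Longrightarrow> \<exists>u\<in>W. ?nd f u < e" for f
  proof -
    have "\<exists>u\<in>S. ?nd f u < e" if e: "e > 0" for e
    proof -
      obtain g where g: "g \<in> W" "?nd f g < e / 4" using *[of "e/4"] e by auto
      obtain u where u: "u \<in> S" "?nd g u < e / 4" using WD(2)[OF g(1), of "e/4"] e by auto
      have "?nd f u < e"
        using L2.norm_diff_le[OF f WD(1)[OF g(1)] subsetD[OF S u(1)]] g u by linarith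
      then show ?thesis using u by blast
    qed
    then show ?thesis using f by (simp add: W_def)
  qed
  have "\<exists>ip. is_rkhs (\<lambda>s t. L2_inner M (X s) (X t)) ((\<lambda>f t. L2_inner M f (X t)) ` W) ip"
  proof (rule is_rkhs_feature_map)
    show "W \<subseteq> L2 M" by (auto simp: W_def)
    show "(\<lambda>x. 0) \<in> W" by (rule subsetD[OF SW]) (simp add: S_def finite_span_zero)
    show "X t \<in> W" for t by (rule subsetD[OF SW]) (simp add: S_def finite_span_base)
  next
    fix f g assume f: "f \<in> W" and g: "g \<in> W"
    have "\<exists>u\<in>W. ?nd (\<lambda>x. f x + g x) u < e" if e: "e > 0" for e
    proof -
      obtain u where u: "u \<in> S" "?nd f u < e / 4" using WD(2)[OF f, of "e/4"] e by auto
      obtain w where w: "w \<in> S" "?nd g w < e / 4" using WD(2)[OF g, of "e/4"] e by auto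
      have "?nd (\<lambda>x. f x + g x) (\<lambda>x. u x + w x) \<le> 2 * ?nd f u + 2 * ?nd g w"
        using L2.norm_add_le[OF L2.diff[OF WD(1)[OF f] subsetD[OF S u(1)]]
            L2.diff[OF WD(1)[OF g] subsetD[OF S w(1)]]] by (simp add: algebra_simps)
      also have "\<dots> < e" using u w by linarith
      finally show ?thesis
        using subsetD[OF SW finite_span_add[of u X w, folded S_def, OF u(1) w(1)]]
        by (intro bexI[of _ "\<lambda>x. u x + w x"])
    qed
    then show "(\<lambda>x. f x + g x) \<in> W" by (rule WI[OF L2.add[OF WD(1)[OF f] WD(1)[OF g]]])
  next
    fix f and c :: real assume f: "f \<in> W"
    have "\<exists>u\<in>W. ?nd (\<lambda>x. c * f x) u < e" if e: "e > 0" for e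
    proof -
      \<comment> \<open>Adding 1 keeps the denominator positive for c = 0.\<close>
      have "e / (c\<^sup>2 + 1) > 0" using e by (simp add: add_nonneg_pos)
      from WD(2)[OF f this] obtain u where u: "u \<in> S" "?nd f u < e / (c\<^sup>2 + 1)" by blast
      have uL: "(\<lambda>x. f x - u x) \<in> L2 M" by (rule L2.diff[OF WD(1)[OF f] subsetD[OF S u(1)]])
      have "?nd (\<lambda>x. c * f x) (\<lambda>x. c * u x) = c\<^sup>2 * ?nd f u"
        using L2.norm_scale[OF uL, of c] by (simp only: right_diff_distrib)
      also have "\<dots> \<le> (c\<^sup>2 + 1) * ?nd f u"
        using L2.nonneg[OF uL] by (simp add: distrib_right)
      also have "\<dots> < e" using u(2) by (simp add: pos_less_divide_eq add_nonneg_pos mult.commute)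
      finally show ?thesis
        using subsetD[OF SW finite_span_scale[of u X, folded S_def, OF u(1)]]
        by (intro bexI[of _ "\<lambda>x. c * u x"])
    qed
    then show "(\<lambda>x. c * f x) \<in> W" by (rule WI[OF L2.scale[OF WD(1)[OF f]]])
  next
    fix z f assume z: "\<And>n::nat. z n \<in> W" and f: "f \<in> L2 M" and lim: "(\<lambda>n. ?nd (z n) f) \<longlonglongrightarrow> 0"
    have "\<exists>u\<in>W. ?nd f u < e" if "e > 0" for e
    proof -
      obtain n where "?nd (z n) f < e"
        using eventually_happens[OF order_tendstoD(2)[OF lim \<open>e > 0\<close>]] by auto
      then show ?thesis using L2.norm_swap[OF WD(1)[OF z] f, of n] z by (intro bexI[of _ "z n"]) simp_all
    qed
    then show "f \<in> W" by (rule WI[OF f])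
  next
    fix f assume f: "f \<in> W" and 0: "\<And>t. L2_inner M f (X t) = 0"
    \<comment> \<open>For u in the span, f is orthogonal to u, so by Pythagoras the squared norm of
      f is at most its squared distance to u.\<close>
    have "L2_inner M f f \<le> e" if "e > 0" for e
    proof -
      obtain u where u: "u \<in> S" "?nd f u < e" using WD(2)[OF f \<open>e > 0\<close>] by auto
      obtain F a where Fa: "finite F" "u = (\<lambda>x. \<Sum>t\<in>F. a t * X t x)"
        using u(1) by (auto simp: S_def finite_span_def)
      have uL: "u \<in> L2 M" using u S by auto
      have "L2_inner M u f = (\<Sum>t\<in>F. a t * L2_inner M (X t) f)"
        unfolding Fa(2) by (rule L2.ip_lincomb[OF Fa(1) X WD(1)[OF f]])
      also have "\<dots> = 0" using 0 by (simp add: mult.commute)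
      finally have "L2_inner M f u = 0" by (simp add: mult.commute)
      then show ?thesis
        using L2.norm_diff[OF WD(1)[OF f] uL] L2.nonneg[OF uL] u(2) by linarith
    qed
    then have "L2_inner M f f \<le> 0" using field_le_epsilon[of "L2_inner M f f" 0] by simp
    then show "L2_inner M f f = 0" using L2.nonneg[OF WD(1)[OF f]] by linarith
  qed
  then show ?thesis by blast
qed

section \<open>Scaled kernels\<close>

abbreviation "l2 \<equiv> L2 (count_space (UNIV :: nat set))"

lemma l2_iff: "z \<in> l2 \<longleftrightarrow> summable (\<lambda>n. (z n)\<^sup>2)"
  by (simp add: L2_def integrable_count_space_nat_iff)

lemma l2_inner:
  assumes "z \<in> l2" "w \<in> l2"
  shows "(\<lambda>n. z n * w n) sums (L2_inner (count_space UNIV) z w)"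
  using sums_integral_count_space_nat[OF L2_mult_integrable[OF assms]] .

lemma l2_sq:
  assumes "z \<in> l2"
  shows "(\<lambda>n. (z n)\<^sup>2) sums (L2_inner (count_space UNIV) z z)"
  using l2_inner[OF assms assms] by (simp add: power2_eq_square)

locale scaled_features =
  fixes \<phi> :: "nat \<Rightarrow> 't \<Rightarrow> real" and \<beta> :: "nat \<Rightarrow> real"
  assumes scaling: "scaling \<phi> \<beta>"
begin

text \<open>Coordinates of the scaled kernel's section at t relative to the functions
  \<open>sqrt (\<beta> n) * \<phi> n\<close>. The scaling condition says that they are
  square-summable.\<close>

definition feature :: "'t \<Rightarrow> nat \<Rightarrow> real" where
  "feature t n = sqrt (\<beta> n) * \<phi> n t"

lemma pos: "\<beta> n > 0" using scaling by (auto simp: scaling_def)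

lemma feature_l2: "feature t \<in> l2"
  using scaling pos by (simp add: l2_iff feature_def power_mult_distrib scaling_def less_imp_le)

lemma scaled_kernel_sums: "(\<lambda>n. \<beta> n * \<phi> n s * \<phi> n t) sums scaled_kernel \<beta> \<phi> s t"
  and scaled_kernel_inner: "scaled_kernel \<beta> \<phi> s t = L2_inner (count_space UNIV) (feature s) (feature t)"
proof -
  have "feature s n * feature t n = \<beta> n * \<phi> n s * \<phi> n t" for n
    using pos[of n] by (simp add: feature_def)
  then have *: "(\<lambda>n. \<beta> n * \<phi> n s * \<phi> n t) sums L2_inner (count_space UNIV) (feature s) (feature t)"
    using l2_inner[OF feature_l2 feature_l2, of s t] by simp
  then show "scaled_kernel \<beta> \<phi> s t = L2_inner (count_space UNIV) (feature s) (feature t)"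
    by (simp add: scaled_kernel_def sums_iff)
  with * show "(\<lambda>n. \<beta> n * \<phi> n s * \<phi> n t) sums scaled_kernel \<beta> \<phi> s t" by simp
qed

lemma normalized_l2: "summable (\<lambda>n. (c n)\<^sup>2 / \<beta> n) \<Longrightarrow> (\<lambda>n. c n / sqrt (\<beta> n)) \<in> l2"
  using pos by (simp add: l2_iff power_divide less_imp_le)

text \<open>The weights cancel in the pairing of the normalized coefficients with the features, so
  pointwise convergence of the expansion is convergence of an inner product in l2.\<close>

lemma expansion_inner:
  assumes "summable (\<lambda>n. (c n)\<^sup>2 / \<beta> n)"
  shows "expansion \<phi> c (\<lambda>t. L2_inner (count_space UNIV) (\<lambda>n. c n / sqrt (\<beta> n)) (feature t))"
proof -
  have "c n / sqrt (\<beta> n) * feature t n = c n * \<phi> n t" for n t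
    using pos[of n] by (simp add: feature_def)
  then show ?thesis
    using l2_inner[OF normalized_l2[OF assms] feature_l2] by (simp add: expansion_def)
qed

lemma expansion_unique: "expansion \<phi> c f \<Longrightarrow> expansion \<phi> c g \<Longrightarrow> f = g"
  by (auto simp: expansion_def fun_eq_iff intro: sums_unique2)

text \<open>Under \<open>inj\<close> no nonzero sequence in l2 is orthogonal to all features, so all
  of l2 can be the feature space and every coefficient sequence of finite weighted norm is
  realized.\<close>

lemma rkhs_scaled_kernel:
  assumes inj: "\<And>c. summable (\<lambda>n. (c n)\<^sup>2 / \<beta> n) \<Longrightarrow> expansion \<phi> c (\<lambda>t. 0) \<Longrightarrow> c = (\<lambda>n. 0)"
  shows "rkhs (scaled_kernel \<beta> \<phi>) = {f. \<exists>c. summable (\<lambda>n. (c n)\<^sup>2 / \<beta> n) \<and> expansion \<phi> c f}"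
proof -
  let ?T = "\<lambda>z t. L2_inner (count_space UNIV) z (feature t)"
  define coef where "coef z n = z n * sqrt (\<beta> n)" for z :: "nat \<Rightarrow> real" and n
  have coef: "coef z n / sqrt (\<beta> n) = z n" for z n
    using pos[of n] by (simp add: coef_def)
  have coef_summable: "summable (\<lambda>n. (coef z n)\<^sup>2 / \<beta> n)" if "z \<in> l2" for z
  proof -
    have "(coef z n)\<^sup>2 / \<beta> n = (z n)\<^sup>2" for n
      using pos[of n] by (simp add: coef_def power_mult_distrib)
    then show ?thesis using that by (simp add: l2_iff)
  qed
  have T: "expansion \<phi> (coef z) (?T z)" if "z \<in> l2" for z
    using expansion_inner[OF coef_summable[OF that]] unfolding coef .
  have "\<exists>ip. is_rkhs (\<lambda>s t. L2_inner (count_space UNIV) (feature s) (feature t)) (?T ` l2) ip"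
  proof (rule is_rkhs_feature_map)
    fix z assume z: "z \<in> l2" and 0: "\<And>t. ?T z t = 0"
    have "coef z = (\<lambda>n. 0)"
      by (rule inj[OF coef_summable[OF z]]) (use T[OF z] 0 in simp)
    then have "z n = 0" for n using coef[of z n] by simp
    then show "L2_inner (count_space UNIV) z z = 0" by simp
  qed (auto intro: feature_l2 L2.zero L2.add L2.scale)
  then have "rkhs (scaled_kernel \<beta> \<phi>) = ?T ` l2"
    using rkhs_eqI unfolding scaled_kernel_inner[abs_def] by blast
  also have "\<dots> = {f. \<exists>c. summable (\<lambda>n. (c n)\<^sup>2 / \<beta> n) \<and> expansion \<phi> c f}"
  proof (intro equalityI subsetI)
    fix f assume "f \<in> ?T ` l2"
    then obtain z where "z \<in> l2" "f = ?T z" by blast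
    then show "f \<in> {f. \<exists>c. summable (\<lambda>n. (c n)\<^sup>2 / \<beta> n) \<and> expansion \<phi> c f}"
      using T[of z] coef_summable[of z] by blast
  next
    fix f assume "f \<in> {f. \<exists>c. summable (\<lambda>n. (c n)\<^sup>2 / \<beta> n) \<and> expansion \<phi> c f}"
    then obtain c where c: "summable (\<lambda>n. (c n)\<^sup>2 / \<beta> n)" "expansion \<phi> c f" by blast
    then have "f = ?T (\<lambda>n. c n / sqrt (\<beta> n))"
      using expansion_unique[OF c(2) expansion_inner[OF c(1)]] by simp
    then show "f \<in> ?T ` l2" using normalized_l2[OF c(1)] by (intro image_eqI)
  qed
  finally show ?thesis .
qed

abbreviation "feature_sqdist s t \<equiv>
  L2_inner (count_space UNIV) (\<lambda>n. feature s n - feature t n) (\<lambda>n. feature s n - feature t n)"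

lemma feature_sqdist:
  "feature_sqdist s t = scaled_kernel \<beta> \<phi> s s - 2 * scaled_kernel \<beta> \<phi> s t + scaled_kernel \<beta> \<phi> t t"
  unfolding scaled_kernel_inner by (rule L2.norm_diff[OF feature_l2 feature_l2])

end

lemma feature_sqdist_tendsto:
  fixes \<phi> :: "nat \<Rightarrow> 't::metric_space \<Rightarrow> real"
  assumes "scaled_features \<phi> \<beta>" "continuous_kernel (scaled_kernel \<beta> \<phi>)"
  shows "((\<lambda>s. scaled_features.feature_sqdist \<phi> \<beta> s t) \<longlongrightarrow> 0) (at t)"
proof -
  interpret scaled_features \<phi> \<beta> by fact
  have K: "isCont (\<lambda>p. scaled_kernel \<beta> \<phi> (fst p) (snd p)) (s, t)" for s t
    using assms(2) by (simp add: continuous_kernel_def continuous_on_eq_continuous_at case_prod_beta')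
  have 1: "isCont (\<lambda>s. scaled_kernel \<beta> \<phi> s s) t"
    using isCont_o2[where f="\<lambda>s. (s, s)" and g="\<lambda>p. scaled_kernel \<beta> \<phi> (fst p) (snd p)" and a=t] K by simp
  have 2: "isCont (\<lambda>s. scaled_kernel \<beta> \<phi> s t) t"
    using isCont_o2[where f="\<lambda>s. (s, t)" and g="\<lambda>p. scaled_kernel \<beta> \<phi> (fst p) (snd p)" and a=t] K by simp
  have "((\<lambda>s. scaled_kernel \<beta> \<phi> s s - 2 * scaled_kernel \<beta> \<phi> s t + scaled_kernel \<beta> \<phi> t t) \<longlongrightarrow>
      scaled_kernel \<beta> \<phi> t t - 2 * scaled_kernel \<beta> \<phi> t t + scaled_kernel \<beta> \<phi> t t) (at t)"
    using 1 2 by (intro tendsto_intros) (simp_all add: isCont_def)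
  then show ?thesis unfolding feature_sqdist by simp
qed

text \<open>By Cauchy-Schwarz in l2, increments of f are controlled by the distance between
  features, which vanishes in the limit when the kernel is continuous.\<close>

lemma expansion_continuous:
  fixes \<phi> :: "nat \<Rightarrow> 't::metric_space \<Rightarrow> real"
  assumes \<beta>: "scaling \<phi> \<beta>" "continuous_kernel (scaled_kernel \<beta> \<phi>)"
    and c: "summable (\<lambda>n. (c n)\<^sup>2 / \<beta> n)" "expansion \<phi> c f"
  shows "continuous_on UNIV f"
proof -
  interpret scaled_features \<phi> \<beta> by unfold_locales fact
  define z where "z n = c n / sqrt (\<beta> n)" for n
  have z: "z \<in> l2" using normalized_l2[OF c(1)] by (simp add: z_def[abs_def])
  have f: "f t = L2_inner (count_space UNIV) (feature t) z" for t
    using expansion_unique[OF c(2) expansion_inner[OF c(1)]]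
    by (simp add: z_def[abs_def] mult.commute)
  have "isCont f t" for t
  proof -
    have "((\<lambda>s. f s - f t) \<longlongrightarrow> 0) (at t)"
    proof (rule tendsto_zero_sq_le)
      show "(f s - f t)\<^sup>2 \<le> feature_sqdist s t * L2_inner (count_space UNIV) z z" for s
        using L2.Cauchy_Schwarz[OF L2.diff[OF feature_l2 feature_l2] z, of s t]
        unfolding f L2.ip_diff[OF feature_l2 feature_l2 z] .
      show "((\<lambda>s. feature_sqdist s t * L2_inner (count_space UNIV) z z) \<longlongrightarrow> 0) (at t)"
        by (intro tendsto_mult_left_zero feature_sqdist_tendsto \<beta>) unfold_locales
    qed
    then show ?thesis by (simp add: isCont_def LIM_zero_iff)
  qed
  then show ?thesis by (simp add: continuous_at_imp_continuous_on)
qed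

text \<open>The squared distance of features is a series of nonnegative terms increasing in the
  weights, so it is small for \<beta> whenever it is small for \<alpha>. The features of \<beta> are
  thus continuous as a map into l2, and hence so is their inner product, the kernel.\<close>

lemma scaled_kernel_smaller:
  fixes \<phi> :: "nat \<Rightarrow> 't::metric_space \<Rightarrow> real"
  assumes \<alpha>: "scaling \<phi> \<alpha>" "continuous_kernel (scaled_kernel \<alpha> \<phi>)"
    and \<beta>: "\<And>n. 0 < \<beta> n" "\<And>n. \<beta> n \<le> \<alpha> n"
  shows "scaling \<phi> \<beta>" "continuous_kernel (scaled_kernel \<beta> \<phi>)"
proof -
  interpret A: scaled_features \<phi> \<alpha> by unfold_locales fact
  show s: "scaling \<phi> \<beta>"
    unfolding scaling_def
  proof (intro conjI allI \<beta>(1))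
    fix t
    show "summable (\<lambda>n. \<beta> n * (\<phi> n t)\<^sup>2)"
    proof (rule summable_comparison_test'[where N=0])
      show "summable (\<lambda>n. \<alpha> n * (\<phi> n t)\<^sup>2)" using \<alpha>(1) by (simp add: scaling_def)
      fix n
      have "0 \<le> \<beta> n" "\<beta> n \<le> \<alpha> n" using \<beta>[of n] by auto
      then show "norm (\<beta> n * (\<phi> n t)\<^sup>2) \<le> \<alpha> n * (\<phi> n t)\<^sup>2"
        by (simp add: abs_mult mult_right_mono)
    qed
  qed
  interpret B: scaled_features \<phi> \<beta> by unfold_locales fact
  have le: "B.feature_sqdist s t \<le> A.feature_sqdist s t" for s t
  proof (rule sums_le[OF _ l2_sq[OF L2.diff[OF B.feature_l2 B.feature_l2]] l2_sq[OF L2.diff[OF A.feature_l2 A.feature_l2]]])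
    fix n
    have "(B.feature s n - B.feature t n)\<^sup>2 = \<beta> n * (\<phi> n s - \<phi> n t)\<^sup>2"
      using \<beta>(1)[of n] by (simp add: B.feature_def right_diff_distrib[symmetric] power_mult_distrib)
    also have "\<dots> \<le> \<alpha> n * (\<phi> n s - \<phi> n t)\<^sup>2" by (intro mult_right_mono \<beta>) simp
    also have "\<dots> = (A.feature s n - A.feature t n)\<^sup>2"
      using A.pos[of n] by (simp add: A.feature_def right_diff_distrib[symmetric] power_mult_distrib)
    finally show "(B.feature s n - B.feature t n)\<^sup>2 \<le> (A.feature s n - A.feature t n)\<^sup>2" .
  qed
  have lim: "((\<lambda>s. B.feature_sqdist s t) \<longlongrightarrow> 0) (at t)" for t
    using feature_sqdist_tendsto[OF A.scaled_features_axioms \<alpha>(2), of t]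
    by (rule tendsto_sandwich[OF _ _ tendsto_const, rotated 2])
       (simp_all add: le L2.nonneg[OF L2.diff[OF B.feature_l2 B.feature_l2]])
  \<comment> \<open>Passes from the punctured to the full neighbourhood filter: one coordinate of a
    pair may equal its limit while the pair does not.\<close>
  have lim': "((\<lambda>s. B.feature_sqdist s t) \<longlongrightarrow> 0) (nhds t)" for t
    using lim[of t] by (simp add: tendsto_nhds_iff)
  have "isCont (\<lambda>p. scaled_kernel \<beta> \<phi> (fst p) (snd p)) (s0, t0)" for s0 t0
  proof -
    let ?a = "\<lambda>p n. B.feature (fst p) n - B.feature s0 n"
    let ?b = "\<lambda>p n. B.feature (snd p) n - B.feature t0 n"
    let ?ip = "L2_inner (count_space (UNIV::nat set))"
    have a: "?a p \<in> l2" and b: "?b p \<in> l2" for p by (intro L2.diff B.feature_l2)+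
    have fst: "filterlim fst (nhds s0) (at (s0, t0))" and snd: "filterlim snd (nhds t0) (at (s0, t0))"
      using tendsto_fst[OF tendsto_ident_at, of "(s0,t0)" UNIV] tendsto_snd[OF tendsto_ident_at, of "(s0,t0)" UNIV] by auto
    have la: "((\<lambda>p. ?ip (?a p) (?a p)) \<longlongrightarrow> 0) (at (s0,t0))"
      using filterlim_compose[OF lim' fst] by simp
    have lb: "((\<lambda>p. ?ip (?b p) (?b p)) \<longlongrightarrow> 0) (at (s0,t0))"
      using filterlim_compose[OF lim' snd] by simp
    have 1: "((\<lambda>p. ?ip (?a p) (?b p)) \<longlongrightarrow> 0) (at (s0,t0))"
      by (rule tendsto_zero_sq_le[OF L2.Cauchy_Schwarz[OF a b]]) (use tendsto_mult_zero[OF la lb] in simp)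
    have 2: "((\<lambda>p. ?ip (?a p) (B.feature t0)) \<longlongrightarrow> 0) (at (s0,t0))"
      by (rule tendsto_zero_sq_le[OF L2.Cauchy_Schwarz[OF a B.feature_l2]]) (rule tendsto_mult_left_zero[OF la])
    have 3: "((\<lambda>p. ?ip (?b p) (B.feature s0)) \<longlongrightarrow> 0) (at (s0,t0))"
      by (rule tendsto_zero_sq_le[OF L2.Cauchy_Schwarz[OF b B.feature_l2]]) (rule tendsto_mult_left_zero[OF lb])
    have eq: "?ip (?a p) (?b p) + ?ip (?a p) (B.feature t0) + ?ip (?b p) (B.feature s0) =
        scaled_kernel \<beta> \<phi> (fst p) (snd p) - scaled_kernel \<beta> \<phi> s0 t0" for p
    proof -
      note d = L2.ip_diff[OF B.feature_l2 B.feature_l2]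
      have d': "?ip (B.feature x) (?b p) = ?ip (B.feature x) (B.feature (snd p)) - ?ip (B.feature x) (B.feature t0)" for x
        using d[OF B.feature_l2[of x], of "snd p" t0] by (simp only: mult.commute)
      have "?ip (B.feature (snd p)) (B.feature s0) = ?ip (B.feature s0) (B.feature (snd p))"
        "?ip (B.feature t0) (B.feature s0) = ?ip (B.feature s0) (B.feature t0)"
        by (simp_all only: mult.commute)
      then show ?thesis
        unfolding B.scaled_kernel_inner d[OF B.feature_l2] d[OF b] d' by linarith
    qed
    have "((\<lambda>p. scaled_kernel \<beta> \<phi> (fst p) (snd p) - scaled_kernel \<beta> \<phi> s0 t0) \<longlongrightarrow> 0) (at (s0, t0))"
      using tendsto_add_zero[OF tendsto_add_zero[OF 1 2] 3] unfolding eq .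
    then show ?thesis by (simp add: isCont_def LIM_zero_iff)
  qed
  then show "continuous_kernel (scaled_kernel \<beta> \<phi>)"
    by (simp add: continuous_kernel_def case_prod_beta' continuous_at_imp_continuous_on)
qed

section \<open>Gaussian coefficients of the process\<close>

text \<open>Trades a mixed moment for fourth powers of single linear combinations, whose laws are
  one-dimensional.\<close>

lemma square_product_polarization:
  "u\<^sup>2 * v\<^sup>2 = ((u + v)^4 + (u - v)^4 - 2 * u^4 - 2 * v^4) / 12" for u v :: real
proof -
  have "(u + v)^4 + (u - v)^4 = 2 * u^4 + 12 * (u\<^sup>2 * v\<^sup>2) + 2 * v^4" by algebra
  then show ?thesis by simp
qed

lemma gaussian_law_mean:
  assumes "v \<ge> 0"
  shows "integral\<^sup>L (gaussian_law m v) (\<lambda>x. x) = m"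
proof (cases "v = 0")
  case True
  then show ?thesis by (simp add: gaussian_law_def integral_return)
next
  case False
  then have "sqrt v > 0" using assms by simp
  then show ?thesis
    using False by (simp add: gaussian_law_def integral_density integral_normal_moment_nz_1)
qed

lemma centered_gaussian_law_even_moments:
  assumes v: "v \<ge> 0"
  shows "integrable (gaussian_law 0 v) (\<lambda>x. x ^ (2 * k))"
    and "k > 0 \<Longrightarrow> integral\<^sup>L (gaussian_law 0 v) (\<lambda>x. x ^ (2 * k)) = fact (2 * k) / (2 ^ k * fact k) * v ^ k"
proof -
  have "integrable (gaussian_law 0 v) (\<lambda>x. x ^ (2 * k)) \<and>
    (k > 0 \<longrightarrow> integral\<^sup>L (gaussian_law 0 v) (\<lambda>x. x ^ (2 * k)) = fact (2 * k) / (2 ^ k * fact k) * v ^ k)"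
  proof (cases "v = 0")
    case True
    have "integrable (return borel 0) (\<lambda>x::real. x ^ (2 * k))"
      by (simp add: integrable_iff_bounded nn_integral_return)
    then show ?thesis using True by (simp add: gaussian_law_def integral_return power_0_left)
  next
    case False
    then have s: "sqrt v > 0" using v by simp
    have "integrable lborel (\<lambda>x. normal_density 0 (sqrt v) x * x ^ (2 * k))"
      using integrable_normal_moment[OF s, of 0 "2 * k"] by simp
    moreover have "(\<integral>x. normal_density 0 (sqrt v) x * x ^ (2 * k) \<partial>lborel) =
        fact (2 * k) / (2 ^ k * fact k) * v ^ k"
      using integral_normal_moment_even[OF s, of 0 k] v by (simp add: power_divide)
    ultimately show ?thesis
      using False by (simp add: gaussian_law_def integral_density integrable_density)
  qed
  then show "integrable (gaussian_law 0 v) (\<lambda>x. x ^ (2 * k))"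
    and "k > 0 \<Longrightarrow> integral\<^sup>L (gaussian_law 0 v) (\<lambda>x. x ^ (2 * k)) = fact (2 * k) / (2 ^ k * fact k) * v ^ k"
    by auto
qed

locale centered_gaussian = prob_space M
  for M :: "'w measure" +
  fixes X :: "'t \<Rightarrow> 'w \<Rightarrow> real" and K :: "'t \<Rightarrow> 't \<Rightarrow> real"
  assumes gaussian: "centered_gaussian_process M X K"
begin

lemma X_measurable [measurable]: "X t \<in> borel_measurable M"
  using gaussian by (simp add: centered_gaussian_process_def gaussian_process_def)

lemma span_measurable:
  assumes "U \<in> finite_span X"
  shows "U \<in> borel_measurable M"
proof -
  obtain F a where "U = (\<lambda>\<omega>. \<Sum>t\<in>F. a t * X t \<omega>)"
    using assms by (auto simp: finite_span_def)
  then show ?thesis by simp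
qed

lemma span_law_any:
  assumes "U \<in> finite_span X"
  obtains m v where "v \<ge> 0" "distr M borel U = gaussian_law m v"
proof -
  obtain F a where "finite F" "U = (\<lambda>\<omega>. \<Sum>t\<in>F. a t * X t \<omega>)"
    using assms by (auto simp: finite_span_def)
  then show ?thesis
    using gaussian that unfolding centered_gaussian_process_def gaussian_process_def by blast
qed

text \<open>Single variables are treated before their combinations: this law yields integrability of
  \<open>X t\<close>, on which linearity of the mean in \<open>span_law\<close> rests.\<close>

lemma X_law: obtains v where "v \<ge> 0" "distr M borel (X t) = gaussian_law 0 v"
proof -
  obtain m v where v: "v \<ge> 0" "distr M borel (X t) = gaussian_law m v"
    using span_law_any[OF finite_span_base] .
  have "m = integral\<^sup>L (distr M borel (X t)) (\<lambda>x. x)"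
    using gaussian_law_mean[OF v(1), of m] by (simp add: v(2))
  also have "\<dots> = 0"
    using gaussian by (simp add: integral_distr centered_gaussian_process_def)
  finally show ?thesis using that v by simp
qed

lemma moments:
  assumes "U \<in> borel_measurable M" "distr M borel U = gaussian_law 0 v" "v \<ge> 0"
  shows "integrable M (\<lambda>\<omega>. U \<omega> ^ (2 * k))"
    "k > 0 \<Longrightarrow> (\<integral>\<omega>. U \<omega> ^ (2 * k) \<partial>M) = fact (2 * k) / (2 ^ k * fact k) * v ^ k"
proof -
  show "integrable M (\<lambda>\<omega>. U \<omega> ^ (2 * k))"
    using centered_gaussian_law_even_moments(1)[OF assms(3), of k]
    unfolding assms(2)[symmetric] by (subst (asm) integrable_distr_eq) (use assms in auto)
  show "k > 0 \<Longrightarrow> (\<integral>\<omega>. U \<omega> ^ (2 * k) \<partial>M) = fact (2 * k) / (2 ^ k * fact k) * v ^ k"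
    using centered_gaussian_law_even_moments(2)[OF assms(3), of k]
    unfolding assms(2)[symmetric] by (subst (asm) integral_distr) (use assms in auto)
qed

lemma X_L2: "X t \<in> L2 M"
proof -
  obtain v where "v \<ge> 0" "distr M borel (X t) = gaussian_law 0 v" by (rule X_law)
  from moments(1)[OF _ this(2,1), of 1] show ?thesis by (simp add: L2_def)
qed

lemma span_L2: "finite_span X \<subseteq> L2 M"
  by (rule L2.finite_span_subset[OF X_L2])

lemma X_integrable: "integrable M (X t)"
  using square_integrable_imp_integrable[OF X_measurable] X_L2[of t] by (simp add: L2_def)

lemma X_inner: "L2_inner M (X s) (X t) = K s t"
  using gaussian unfolding centered_gaussian_process_def by blast

lemma span_law:
  assumes U: "U \<in> finite_span X"
  obtains v where "v \<ge> 0" "distr M borel U = gaussian_law 0 v"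
proof -
  obtain F a where Fa: "finite F" "U = (\<lambda>\<omega>. \<Sum>t\<in>F. a t * X t \<omega>)"
    using assms by (auto simp: finite_span_def)
  obtain m v where v: "v \<ge> 0" "distr M borel U = gaussian_law m v"
    using span_law_any[OF U] .
  have "m = integral\<^sup>L (distr M borel U) (\<lambda>x. x)"
    using gaussian_law_mean[OF v(1), of m] by (simp add: v(2))
  also have "\<dots> = integral\<^sup>L M U"
    using span_measurable[OF U] by (simp add: integral_distr)
  also have "\<dots> = 0"
    using gaussian X_integrable unfolding Fa(2) by (simp add: centered_gaussian_process_def)
  finally show ?thesis using that v by simp
qed

lemma fourth_moment:
  assumes "U \<in> finite_span X"
  shows "integrable M (\<lambda>\<omega>. U \<omega> ^ 4)" "(\<integral>\<omega>. U \<omega> ^ 4 \<partial>M) = 3 * (L2_inner M U U)\<^sup>2"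
proof -
  obtain v where v: "v \<ge> 0" "distr M borel U = gaussian_law 0 v" by (rule span_law[OF assms])
  note m = moments[OF span_measurable[OF assms] v(2,1)]
  show "integrable M (\<lambda>\<omega>. U \<omega> ^ 4)" using m(1)[of 2] by simp
  have "L2_inner M U U = v" using m(2)[of 1] by (simp add: power2_eq_square)
  moreover have "(\<integral>\<omega>. U \<omega> ^ 4 \<partial>M) = 3 * v\<^sup>2" using m(2)[of 2] by (simp add: fact_numeral)
  ultimately show "(\<integral>\<omega>. U \<omega> ^ 4 \<partial>M) = 3 * (L2_inner M U U)\<^sup>2" by simp
qed

text \<open>Isserlis' formula for two squares. For uncorrelated \<open>U\<close> and
  \<open>V\<close> the last term vanishes, which makes their squares uncorrelated as well.\<close>

lemma square_product_moment:
  assumes U: "U \<in> finite_span X" and V: "V \<in> finite_span X"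
  shows "integrable M (\<lambda>\<omega>. (U \<omega>)\<^sup>2 * (V \<omega>)\<^sup>2)"
    "(\<integral>\<omega>. (U \<omega>)\<^sup>2 * (V \<omega>)\<^sup>2 \<partial>M) = L2_inner M U U * L2_inner M V V + 2 * (L2_inner M U V)\<^sup>2"
proof -
  have eq: "(U \<omega>)\<^sup>2 * (V \<omega>)\<^sup>2 = ((U \<omega> + V \<omega>)^4 + (U \<omega> - V \<omega>)^4 - 2 * U \<omega> ^ 4 - 2 * V \<omega> ^ 4) / 12" for \<omega>
    by (rule square_product_polarization)
  note L = subsetD[OF span_L2]
  note i = fourth_moment[OF finite_span_add[OF U V]] fourth_moment[OF finite_span_diff[OF U V]]
    fourth_moment[OF U] fourth_moment[OF V]
  show "integrable M (\<lambda>\<omega>. (U \<omega>)\<^sup>2 * (V \<omega>)\<^sup>2)"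
    unfolding eq using i by simp
  have "(\<integral>\<omega>. (U \<omega>)\<^sup>2 * (V \<omega>)\<^sup>2 \<partial>M) =
      ((\<integral>\<omega>. (U \<omega> + V \<omega>)^4 \<partial>M) + (\<integral>\<omega>. (U \<omega> - V \<omega>)^4 \<partial>M)
        - 2 * (\<integral>\<omega>. U \<omega> ^ 4 \<partial>M) - 2 * (\<integral>\<omega>. V \<omega> ^ 4 \<partial>M)) / 12"
    unfolding eq using i(1,3,5,7) by simp
  also have "\<dots> = L2_inner M U U * L2_inner M V V + 2 * (L2_inner M U V)\<^sup>2"
    unfolding i(2,4,6,8) L2.norm_add[OF L[OF U] L[OF V]] L2.norm_diff[OF L[OF U] L[OF V]]
    by algebra
  finally show "(\<integral>\<omega>. (U \<omega>)\<^sup>2 * (V \<omega>)\<^sup>2 \<partial>M) =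
    L2_inner M U U * L2_inner M V V + 2 * (L2_inner M U V)\<^sup>2" .
qed

lemma ex_rkhs: "is_rkhs K (rkhs K) (rkhs_inner K)"
proof -
  have "(\<lambda>s t. L2_inner M (X s) (X t)) = K" by (simp add: X_inner fun_eq_iff)
  then show ?thesis
    using is_rkhs_covariance[of X M, OF X_L2] is_rkhs_rkhs by metis
qed

end

sublocale centered_gaussian \<subseteq> R: rkhs_space K "rkhs K" "rkhs_inner K"
  by unfold_locales (rule ex_rkhs)

locale gaussian_basis = centered_gaussian M X K
  for M :: "'w measure" and X :: "'t \<Rightarrow> 'w \<Rightarrow> real" and K +
  fixes \<phi> :: "nat \<Rightarrow> 't \<Rightarrow> real"
  assumes basis: "rkhs_orthonormal_basis K \<phi>"
begin

lemma \<phi>_in: "\<phi> n \<in> rkhs K"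
  and \<phi>_orth: "rkhs_inner K (\<phi> m) (\<phi> n) = (if m = n then 1 else 0)"
  using basis by (auto simp: rkhs_orthonormal_basis_def)

lemma double_sum_delta:
  fixes a :: "nat \<Rightarrow> real"
  shows "(\<Sum>m<N. \<Sum>n<N. a m * a n * (if m = n then 1 else 0)) = (\<Sum>n<N. (a n)\<^sup>2)"
proof (rule sum.cong[OF refl])
  fix m assume "m \<in> {..<N}"
  then have "(\<Sum>n<N. a m * a n * (if m = n then 1 else 0)) = (\<Sum>n<N. if m = n then a m * a n else 0)"
    by (intro sum.cong) auto
  also have "\<dots> = (a m)\<^sup>2" using \<open>m \<in> {..<N}\<close> by (simp add: power2_eq_square)
  finally show "(\<Sum>n<N. a m * a n * (if m = n then 1 else 0)) = (a m)\<^sup>2" .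
qed

text \<open>By the reproducing property the n-th coefficient of the kernel section at t is
  \<open>\<phi> n t\<close>, so the residual of its expansion has squared norm \<open>K t t\<close>
  minus the partial sum; completeness of the basis sends it to 0.\<close>

lemma Parseval: "(\<lambda>n. (\<phi> n t)\<^sup>2) sums K t t"
proof -
  let ?k = "\<lambda>s. K s t"
  have k: "rkhs_inner K ?k (\<phi> n) = \<phi> n t" for n
    using R.sym[OF R.kernel_in \<phi>_in] R.reproducing[OF \<phi>_in] by simp
  have p: "(\<lambda>s. \<Sum>n<N. \<phi> n t * \<phi> n s) \<in> rkhs K" for N by (rule R.lincomb) (auto intro: \<phi>_in)
  have sq: "R.sq (\<lambda>s. ?k s - (\<Sum>n<N. \<phi> n t * \<phi> n s)) = K t t - (\<Sum>n<N. (\<phi> n t)\<^sup>2)" for N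
  proof -
    have 1: "rkhs_inner K ?k (\<lambda>s. \<Sum>n<N. \<phi> n t * \<phi> n s) = (\<Sum>n<N. (\<phi> n t)\<^sup>2)"
      using R.sym[OF R.kernel_in p, of t N] R.reproducing[OF p, of N t] by (simp add: power2_eq_square)
    have c: "rkhs_inner K (\<phi> n) (\<lambda>s. \<Sum>m<N. \<phi> m t * \<phi> m s) =
        (\<Sum>m<N. \<phi> m t * (if n = m then 1 else 0))" for n
      using R.sym[OF \<phi>_in p, of n N] R.ip_lincomb[of "{..<N}" \<phi> "\<phi> n" "\<lambda>m. \<phi> m t"] \<phi>_in
      by (simp add: \<phi>_orth eq_commute[of n])
    have "R.sq (\<lambda>s. \<Sum>n<N. \<phi> n t * \<phi> n s) =
        (\<Sum>n<N. \<phi> n t * rkhs_inner K (\<phi> n) (\<lambda>s. \<Sum>m<N. \<phi> m t * \<phi> m s))"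
      by (rule R.ip_lincomb) (auto intro: \<phi>_in p)
    also have "\<dots> = (\<Sum>n<N. (\<phi> n t)\<^sup>2)"
      using double_sum_delta[of "\<lambda>n. \<phi> n t" N] by (simp add: c sum_distrib_left mult.assoc)
    finally have "R.sq (\<lambda>s. \<Sum>n<N. \<phi> n t * \<phi> n s) = (\<Sum>n<N. (\<phi> n t)\<^sup>2)" .
    then show ?thesis
      using R.norm_diff[OF R.kernel_in p, of t N] R.reproducing[OF R.kernel_in, of t t] 1 by simp
  qed
  have "(\<lambda>N. rkhs_norm K (\<lambda>s. ?k s - (\<Sum>n<N. rkhs_inner K ?k (\<phi> n) * \<phi> n s))) \<longlonglongrightarrow> 0"
    using basis R.kernel_in[of t] unfolding rkhs_orthonormal_basis_def by (elim conjE bspec)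
  then have "(\<lambda>N. (sqrt (K t t - (\<Sum>n<N. (\<phi> n t)\<^sup>2)))\<^sup>2) \<longlonglongrightarrow> 0\<^sup>2"
    unfolding k rkhs_norm_def sq by (rule tendsto_power)
  moreover have "(sqrt (K t t - (\<Sum>n<N. (\<phi> n t)\<^sup>2)))\<^sup>2 = K t t - (\<Sum>n<N. (\<phi> n t)\<^sup>2)" for N
    by (rule real_sqrt_pow2) (use R.nonneg[OF R.diff[OF R.kernel_in p], of t N] in \<open>simp only: sq\<close>)
  ultimately have "(\<lambda>N. K t t - (\<Sum>n<N. (\<phi> n t)\<^sup>2)) \<longlonglongrightarrow> 0" by simp
  then have "(\<lambda>N. K t t - (K t t - (\<Sum>n<N. (\<phi> n t)\<^sup>2))) \<longlonglongrightarrow> K t t - 0"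
    by (intro tendsto_intros)
  then show ?thesis by (simp add: sums_def)
qed

end

section \<open>Random coefficients and the almost sure expansion of the process\<close>

context gaussian_basis
begin

text \<open>\<open>K(\<cdot>, t) \<mapsto> X t\<close> is an isometry. The kernel combinations \<open>g n j\<close> tend to \<open>\<phi> n\<close> so fast
  that their images \<open>U n j\<close> converge almost surely, to the coefficient \<open>\<zeta> n\<close>. Properties of
  \<open>\<zeta>\<close> are obtained from those of \<open>U\<close> by Fatou's lemma only.\<close>

definition approx_coeffs :: "nat \<Rightarrow> nat \<Rightarrow> 't set \<times> ('t \<Rightarrow> real)" where
  "approx_coeffs n j = (SOME p. finite (fst p) \<and>
     R.sq (\<lambda>s. \<phi> n s - (\<Sum>t\<in>fst p. snd p t * K s t)) < (1/8)^j)"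

definition g :: "nat \<Rightarrow> nat \<Rightarrow> 't \<Rightarrow> real" where
  "g n j = (\<lambda>s. \<Sum>t\<in>fst (approx_coeffs n j). snd (approx_coeffs n j) t * K s t)"

definition U :: "nat \<Rightarrow> nat \<Rightarrow> 'w \<Rightarrow> real" where
  "U n j = (\<lambda>\<omega>. \<Sum>t\<in>fst (approx_coeffs n j). snd (approx_coeffs n j) t * X t \<omega>)"

lemma approx_coeffs: "finite (fst (approx_coeffs n j))" "R.sq (\<lambda>s. \<phi> n s - g n j s) < (1/8)^j"
proof -
  have "\<exists>p. finite (fst p) \<and> R.sq (\<lambda>s. \<phi> n s - (\<Sum>t\<in>fst p. snd p t * K s t)) < (1/8)^j"
  proof -
    have "(1/8)^j > (0::real)" by simp
    from R.span_dense[OF \<phi>_in[of n] this] obtain F a where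
      "finite F" "R.sq (\<lambda>s. \<phi> n s - (\<Sum>t\<in>F. a t * K s t)) < (1/8)^j"
      by (auto simp: finite_span_def)
    then show ?thesis by (intro exI[of _ "(F, a)"]) simp
  qed
  from someI_ex[OF this] show "finite (fst (approx_coeffs n j))" "R.sq (\<lambda>s. \<phi> n s - g n j s) < (1/8)^j"
    unfolding approx_coeffs_def[symmetric] g_def by auto
qed

lemma g_in: "g n j \<in> rkhs K"
proof -
  have "g n j \<in> R.S" unfolding g_def by (rule finite_spanI[OF approx_coeffs(1)])
  then show ?thesis using R.span_subset by blast
qed

lemma U_in: "U n j \<in> finite_span X"
  unfolding U_def by (rule finite_spanI[OF approx_coeffs(1)])

lemma U_L2: "U n j \<in> L2 M" using U_in span_L2 by blast

lemma U_inner: 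
  assumes "V \<in> L2 M"
  shows "L2_inner M (U n j) V = (\<Sum>t\<in>fst (approx_coeffs n j). snd (approx_coeffs n j) t * L2_inner M (X t) V)"
  unfolding U_def by (rule L2.ip_lincomb[OF approx_coeffs(1) X_L2 assms])

lemma kernel_sym: "K s t = K t s"
  unfolding X_inner[symmetric] by (rule L2.sym[OF X_L2 X_L2])

lemma U_X_inner: "L2_inner M (U n j) (X t) = g n j t"
  unfolding U_inner[OF X_L2] g_def X_inner by (intro sum.cong refl arg_cong2[of _ _ _ _ "(*)"] kernel_sym)

lemma X_U_inner: "L2_inner M (X t) (U n j) = g n j t"
  unfolding L2.sym[OF X_L2 U_L2] by (rule U_X_inner)

text \<open>The isometry between kernel combinations and random variables: each side combines the
  values of \<open>g m i\<close> with the coefficients that define \<open>g n j\<close>.\<close>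

lemma U_U_inner: "L2_inner M (U n j) (U m i) = rkhs_inner K (g n j) (g m i)"
  unfolding U_inner[OF U_L2] X_U_inner g_def[of n j] by (rule R.span_inner[OF approx_coeffs(1) g_in, symmetric])

lemma g_norm_tendsto: "(\<lambda>j. R.sq (\<lambda>s. g n j s - \<phi> n s)) \<longlonglongrightarrow> 0"
proof (rule tendsto_sandwich[OF _ _ tendsto_const])
  show "(\<lambda>j. (1/8::real)^j) \<longlonglongrightarrow> 0" by (rule LIMSEQ_realpow_zero) auto
qed (use approx_coeffs(2) R.norm_swap[OF g_in \<phi>_in] R.nonneg[OF R.diff[OF g_in \<phi>_in]] in \<open>simp_all add: less_imp_le\<close>)

lemma g_tendsto: "(\<lambda>j. g n j t) \<longlonglongrightarrow> \<phi> n t"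
  by (rule R.eval_diff_tendsto[where u="g n", OF g_in \<phi>_in g_norm_tendsto])

lemma U_U_tendsto: "(\<lambda>j. L2_inner M (U n j) (U m j)) \<longlonglongrightarrow> (if n = m then 1 else 0)"
  unfolding U_U_inner \<phi>_orth[symmetric]
  by (rule R.ip_tendsto[where u="g n" and w="g m", OF g_in \<phi>_in g_norm_tendsto g_in \<phi>_in g_norm_tendsto])

text \<open>The approximation rate 8^-j was built into \<open>approx_coeffs\<close> to meet the rate
  demanded by \<open>L2_fast_Cauchy_AE_convergent\<close>.\<close>

lemma U_fast: "L2_inner M (\<lambda>\<omega>. U n (Suc j) \<omega> - U n j \<omega>) (\<lambda>\<omega>. U n (Suc j) \<omega> - U n j \<omega>) \<le> 4 * (1/8)^j"
proof -
  have "L2_inner M (\<lambda>\<omega>. U n (Suc j) \<omega> - U n j \<omega>) (\<lambda>\<omega>. U n (Suc j) \<omega> - U n j \<omega>) =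
      R.sq (\<lambda>s. g n (Suc j) s - g n j s)"
    unfolding L2.norm_diff[OF U_L2 U_L2] R.norm_diff[OF g_in g_in] U_U_inner ..
  also have "\<dots> \<le> 2 * R.sq (\<lambda>s. g n (Suc j) s - \<phi> n s) + 2 * R.sq (\<lambda>s. \<phi> n s - g n j s)"
    by (rule R.norm_diff_le[OF g_in \<phi>_in g_in])
  also have "\<dots> \<le> 2 * (1/8)^Suc j + 2 * (1/8)^j"
    using approx_coeffs(2)[of n "Suc j"] approx_coeffs(2)[of n j] R.norm_swap[OF g_in \<phi>_in, of n "Suc j" n] by linarith
  also have "\<dots> \<le> 4 * (1/8)^j" by simp
  finally show ?thesis .
qed

definition \<zeta> :: "nat \<Rightarrow> 'w \<Rightarrow> real" where
  "\<zeta> n = (SOME f. f \<in> borel_measurable M \<and> (AE \<omega> in M. (\<lambda>j. U n j \<omega>) \<longlonglongrightarrow> f \<omega>))"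

lemma \<zeta>_measurable [measurable]: "\<zeta> n \<in> borel_measurable M"
  and \<zeta>_lim: "AE \<omega> in M. (\<lambda>j. U n j \<omega>) \<longlonglongrightarrow> \<zeta> n \<omega>"
proof -
  have "\<exists>f. f \<in> borel_measurable M \<and> (AE \<omega> in M. (\<lambda>j. U n j \<omega>) \<longlonglongrightarrow> f \<omega>)"
    using L2_fast_Cauchy_AE_convergent[where f="U n", OF U_L2 U_fast] by blast
  from someI_ex[OF this] show "\<zeta> n \<in> borel_measurable M"
    "AE \<omega> in M. (\<lambda>j. U n j \<omega>) \<longlonglongrightarrow> \<zeta> n \<omega>"
    unfolding \<zeta>_def[symmetric] by auto
qed

lemma \<zeta>_lim_all: "AE \<omega> in M. \<forall>n. (\<lambda>j. U n j \<omega>) \<longlonglongrightarrow> \<zeta> n \<omega>"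
  unfolding AE_all_countable using \<zeta>_lim by blast

text \<open>The squared norms of the approximants tend to 1, hence drop below 2, and Fatou keeps
  that bound. The value 2 instead of 1 is harmless: it serves as a bound uniform in n.\<close>

lemma \<zeta>_L2: "\<zeta> n \<in> L2 M" and \<zeta>_sq_le: "L2_inner M (\<zeta> n) (\<zeta> n) \<le> 2"
proof -
  have "(\<lambda>j. L2_inner M (U n j) (U n j)) \<longlonglongrightarrow> 1" using U_U_tendsto[of n n] by simp
  then have "\<forall>\<^sub>F j in sequentially. L2_inner M (U n j) (U n j) < 2" by (rule order_tendstoD) simp
  then have "\<forall>\<^sub>F j in sequentially. L2_inner M (U n j) (U n j) \<le> 2" by eventually_elim simp
  from L2_Fatou[OF U_L2 \<zeta>_measurable \<zeta>_lim this]
  show "\<zeta> n \<in> L2 M" "L2_inner M (\<zeta> n) (\<zeta> n) \<le> 2" by auto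
qed

text \<open>By monotone convergence the expected sum is at most twice the sum of the weights, and a
  nonnegative variable with finite expectation is finite almost surely.\<close>

lemma AE_summable_weighted_squares:
  assumes w: "summable w" "\<And>n. w n \<ge> 0"
  shows "AE \<omega> in M. summable (\<lambda>n. w n * (\<zeta> n \<omega>)\<^sup>2)"
proof -
  have "(\<integral>\<^sup>+\<omega>. (\<Sum>n. ennreal (w n * (\<zeta> n \<omega>)\<^sup>2)) \<partial>M) = (\<Sum>n. \<integral>\<^sup>+\<omega>. ennreal (w n * (\<zeta> n \<omega>)\<^sup>2) \<partial>M)"
    by (rule nn_integral_suminf) measurable
  also have "\<dots> \<le> (\<Sum>n. ennreal (w n * 2))"
  proof (rule suminf_le[OF _ summableI summableI])
    fix n
    have "(\<integral>\<^sup>+\<omega>. ennreal (w n * (\<zeta> n \<omega>)\<^sup>2) \<partial>M) = ennreal (w n) * (\<integral>\<^sup>+\<omega>. ennreal ((\<zeta> n \<omega>)\<^sup>2) \<partial>M)"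
      using w(2)[of n] by (subst nn_integral_cmult[symmetric]) (auto simp: ennreal_mult')
    also have "\<dots> = ennreal (w n * L2_inner M (\<zeta> n) (\<zeta> n))"
      using L2_inner_self_nn[OF \<zeta>_L2[of n]] w(2)[of n] by (simp add: ennreal_mult')
    also have "\<dots> \<le> ennreal (w n * 2)"
      using \<zeta>_sq_le[of n] w(2)[of n] by (intro ennreal_leI mult_left_mono) auto
    finally show "(\<integral>\<^sup>+\<omega>. ennreal (w n * (\<zeta> n \<omega>)\<^sup>2) \<partial>M) \<le> ennreal (w n * 2)" .
  qed
  also have "\<dots> < \<infinity>"
    using w by (subst suminf_ennreal2) (auto intro: summable_mult2)
  finally have fin: "(\<integral>\<^sup>+\<omega>. (\<Sum>n. ennreal (w n * (\<zeta> n \<omega>)\<^sup>2)) \<partial>M) < \<infinity>" .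
  have "AE \<omega> in M. (\<Sum>n. ennreal (w n * (\<zeta> n \<omega>)\<^sup>2)) \<noteq> \<infinity>"
    by (rule nn_integral_PInf_AE[OF _ less_imp_neq[OF fin]]) measurable
  then show ?thesis
    by eventually_elim (intro summable_suminf_not_top, simp_all add: w(2))
qed

text \<open>For the approximants \<open>U n j\<close> the squared norm expands into inner products
  whose limits are known; e absorbs the distance to the limit before Fatou is applied.\<close>

lemma residual_norm_le:
  assumes "e > 0"
  shows "(\<lambda>\<omega>. X t \<omega> - (\<Sum>n<N. \<phi> n t * \<zeta> n \<omega>)) \<in> L2 M"
    and "L2_inner M (\<lambda>\<omega>. X t \<omega> - (\<Sum>n<N. \<phi> n t * \<zeta> n \<omega>)) (\<lambda>\<omega>. X t \<omega> - (\<Sum>n<N. \<phi> n t * \<zeta> n \<omega>))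
      \<le> K t t - (\<Sum>n<N. (\<phi> n t)\<^sup>2) + e"
proof -
  let ?P = "\<lambda>j \<omega>. \<Sum>n<N. \<phi> n t * U n j \<omega>"
  have P: "?P j \<in> L2 M" for j by (rule L2.lincomb) (auto intro: U_L2)
  have XP: "L2_inner M (X t) (?P j) = (\<Sum>n<N. \<phi> n t * g n j t)" for j
    unfolding X_U_inner[symmetric] by (rule L2.ip_lincomb_right) (auto intro: U_L2 X_L2)
  have PP: "L2_inner M (?P j) (?P j) =
      (\<Sum>n<N. \<Sum>m<N. \<phi> n t * \<phi> m t * L2_inner M (U n j) (U m j))" for j
    by (rule L2.norm_lincomb) (auto intro: U_L2)
  have "(\<lambda>j. K t t - 2 * (\<Sum>n<N. \<phi> n t * g n j t)
        + (\<Sum>n<N. \<Sum>m<N. \<phi> n t * \<phi> m t * L2_inner M (U n j) (U m j)))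
      \<longlonglongrightarrow> K t t - 2 * (\<Sum>n<N. \<phi> n t * \<phi> n t)
        + (\<Sum>n<N. \<Sum>m<N. \<phi> n t * \<phi> m t * (if n = m then 1 else 0))"
    by (intro tendsto_intros g_tendsto U_U_tendsto)
  then have lim: "(\<lambda>j. L2_inner M (\<lambda>\<omega>. X t \<omega> - ?P j \<omega>) (\<lambda>\<omega>. X t \<omega> - ?P j \<omega>))
      \<longlonglongrightarrow> K t t - (\<Sum>n<N. (\<phi> n t)\<^sup>2)"
    unfolding double_sum_delta L2.norm_diff[OF X_L2 P] X_inner PP XP
    by (simp add: power2_eq_square)
  have "\<forall>\<^sub>F j in sequentially. L2_inner M (\<lambda>\<omega>. X t \<omega> - ?P j \<omega>) (\<lambda>\<omega>. X t \<omega> - ?P j \<omega>)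
      < K t t - (\<Sum>n<N. (\<phi> n t)\<^sup>2) + e"
    by (rule order_tendstoD(2)[OF lim]) (use assms in simp)
  then have ev: "\<forall>\<^sub>F j in sequentially. L2_inner M (\<lambda>\<omega>. X t \<omega> - ?P j \<omega>) (\<lambda>\<omega>. X t \<omega> - ?P j \<omega>)
      \<le> K t t - (\<Sum>n<N. (\<phi> n t)\<^sup>2) + e"
    by eventually_elim simp
  have AE: "AE \<omega> in M. (\<lambda>j. X t \<omega> - ?P j \<omega>) \<longlonglongrightarrow> X t \<omega> - (\<Sum>n<N. \<phi> n t * \<zeta> n \<omega>)"
    using \<zeta>_lim_all by eventually_elim (intro tendsto_intros, blast)
  have m: "(\<lambda>\<omega>. X t \<omega> - (\<Sum>n<N. \<phi> n t * \<zeta> n \<omega>)) \<in> borel_measurable M" by measurable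
  from L2_Fatou[OF L2.diff[OF X_L2 P] m AE ev]
  show "(\<lambda>\<omega>. X t \<omega> - (\<Sum>n<N. \<phi> n t * \<zeta> n \<omega>)) \<in> L2 M"
    and "L2_inner M (\<lambda>\<omega>. X t \<omega> - (\<Sum>n<N. \<phi> n t * \<zeta> n \<omega>)) (\<lambda>\<omega>. X t \<omega> - (\<Sum>n<N. \<phi> n t * \<zeta> n \<omega>))
      \<le> K t t - (\<Sum>n<N. (\<phi> n t)\<^sup>2) + e" by auto
qed

text \<open>Parseval drives the residual bounds to 0. Almost sure summability provides a pointwise
  limit of the partial sums, so Fatou applies once more and leaves a limiting residual of norm
  0.\<close>

lemma AE_expansion:
  assumes "AE \<omega> in M. summable (\<lambda>n. \<phi> n t * \<zeta> n \<omega>)"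
  shows "AE \<omega> in M. (\<lambda>n. \<phi> n t * \<zeta> n \<omega>) sums X t \<omega>"
proof -
  let ?f = "\<lambda>\<omega>. X t \<omega> - (\<Sum>n. \<phi> n t * \<zeta> n \<omega>)"
  have m: "?f \<in> borel_measurable M" by measurable
  have AE: "AE \<omega> in M. (\<lambda>N. X t \<omega> - (\<Sum>n<N. \<phi> n t * \<zeta> n \<omega>)) \<longlonglongrightarrow> ?f \<omega>"
    using assms by eventually_elim (intro tendsto_intros summable_LIMSEQ)
  have fat: "?f \<in> L2 M \<and> L2_inner M ?f ?f \<le> e" if e: "e > 0" for e
  proof -
    have "(\<lambda>N. K t t - (\<Sum>n<N. (\<phi> n t)\<^sup>2) + e / 2) \<longlonglongrightarrow> K t t - K t t + e / 2"
      using Parseval[of t] by (intro tendsto_intros) (simp add: sums_def)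
    then have "\<forall>\<^sub>F N in sequentially. K t t - (\<Sum>n<N. (\<phi> n t)\<^sup>2) + e / 2 < e"
      by (rule order_tendstoD) (use e in simp)
    then have "\<forall>\<^sub>F N in sequentially.
        L2_inner M (\<lambda>\<omega>. X t \<omega> - (\<Sum>n<N. \<phi> n t * \<zeta> n \<omega>)) (\<lambda>\<omega>. X t \<omega> - (\<Sum>n<N. \<phi> n t * \<zeta> n \<omega>)) \<le> e"
      using residual_norm_le(2)[of "e/2" t] e by (auto elim!: eventually_mono intro: order_trans less_imp_le)
    from L2_Fatou[OF residual_norm_le(1)[OF e] m AE this] show ?thesis by blast
  qed
  have L: "?f \<in> L2 M" using fat[of 1] by simp
  have "L2_inner M ?f ?f \<le> 0" using field_le_epsilon[of "L2_inner M ?f ?f" 0] fat by simp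
  then have "(\<integral>\<^sup>+\<omega>. ennreal ((?f \<omega>)\<^sup>2) \<partial>M) = 0"
    using L2_inner_self_nn[OF L] by (simp add: ennreal_neg)
  then have "AE \<omega> in M. ennreal ((?f \<omega>)\<^sup>2) = 0"
    by (subst (asm) nn_integral_0_iff_AE) measurable
  then show ?thesis
    using assms by eventually_elim (simp add: sums_iff)
qed

end

section \<open>Divergence of weighted sums of squared coefficients\<close>

context gaussian_basis
begin

lemma double_sum_2delta:
  fixes a :: "nat \<Rightarrow> real"
  shows "(\<Sum>m<N. \<Sum>n<N. a m * a n * (if m = n then 2 else 0)) = 2 * (\<Sum>n<N. (a n)\<^sup>2)"
proof -
  have "(\<Sum>m<N. \<Sum>n<N. a m * a n * (if m = n then 2 else 0)) =
      (\<Sum>m<N. \<Sum>n<N. 2 * (a m * a n * (if m = n then 1 else 0)))"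
    by (intro sum.cong) auto
  then show ?thesis by (simp only: double_sum_delta sum_distrib_left[symmetric])
qed

text \<open>The squares of uncorrelated jointly Gaussian variables are uncorrelated, so that Chebyshev's
  inequality takes the place of independence.\<close>

lemma centered_squares_norm_le:
  assumes "e > 0"
  shows "(\<lambda>\<omega>. \<Sum>n<N. w n * ((\<zeta> n \<omega>)\<^sup>2 - 1)) \<in> L2 M"
    and "L2_inner M (\<lambda>\<omega>. \<Sum>n<N. w n * ((\<zeta> n \<omega>)\<^sup>2 - 1)) (\<lambda>\<omega>. \<Sum>n<N. w n * ((\<zeta> n \<omega>)\<^sup>2 - 1))
      \<le> 2 * (\<Sum>n<N. (w n)\<^sup>2) + e"
proof -
  define V where "V n j = (\<lambda>\<omega>. (U n j \<omega>)\<^sup>2 - 1)" for n j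
  have sq_L2: "(\<lambda>\<omega>. (U n j \<omega>)\<^sup>2) \<in> L2 M" for n j
    using square_product_moment(1)[OF U_in U_in, of n j n j] span_measurable[OF U_in, of n j]
    by (simp add: L2_def power2_eq_square)
  have one: "(\<lambda>\<omega>. 1) \<in> L2 M" by (simp add: L2_def)
  have V: "V n j \<in> L2 M" for n j unfolding V_def by (rule L2.diff[OF sq_L2 one])
  have sq_int: "(\<integral>\<omega>. (U n j \<omega>)\<^sup>2 \<partial>M) = L2_inner M (U n j) (U n j)" for n j
    by (simp add: power2_eq_square)
  have VV: "L2_inner M (V n j) (V m j) =
      L2_inner M (U n j) (U n j) * L2_inner M (U m j) (U m j) + 2 * (L2_inner M (U n j) (U m j))\<^sup>2
      - L2_inner M (U n j) (U n j) - L2_inner M (U m j) (U m j) + 1" for n m j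
  proof -
    have "L2_inner M (V n j) (V m j) =
        L2_inner M (\<lambda>\<omega>. (U n j \<omega>)\<^sup>2) (V m j) - L2_inner M (\<lambda>\<omega>. 1) (V m j)"
      unfolding V_def[of n] by (rule L2.ip_diff[OF sq_L2 one V])
    also have "L2_inner M (\<lambda>\<omega>. (U n j \<omega>)\<^sup>2) (V m j) = L2_inner M (V m j) (\<lambda>\<omega>. (U n j \<omega>)\<^sup>2)"
      by (rule L2.sym[OF sq_L2 V])
    also have "\<dots> = L2_inner M (\<lambda>\<omega>. (U m j \<omega>)\<^sup>2) (\<lambda>\<omega>. (U n j \<omega>)\<^sup>2) - L2_inner M (\<lambda>\<omega>. 1) (\<lambda>\<omega>. (U n j \<omega>)\<^sup>2)"
      unfolding V_def[of m] by (rule L2.ip_diff[OF sq_L2 one sq_L2])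
    also have "L2_inner M (\<lambda>\<omega>. 1) (V m j) = L2_inner M (V m j) (\<lambda>\<omega>. 1)"
      by (rule L2.sym[OF one V])
    also have "\<dots> = L2_inner M (\<lambda>\<omega>. (U m j \<omega>)\<^sup>2) (\<lambda>\<omega>. 1) - L2_inner M (\<lambda>\<omega>. 1) (\<lambda>\<omega>. 1)"
      unfolding V_def[of m] by (rule L2.ip_diff[OF sq_L2 one one])
    finally show ?thesis
      using square_product_moment(2)[OF U_in[of m j] U_in[of n j]] L2.sym[OF U_L2[of m j] U_L2[of n j]]
      by (simp add: sq_int prob_space)
  qed
  \<comment> \<open>The vacuous tests n = n and m = m keep the form of \<open>U_U_tendsto\<close>.
    With d = 1 on the diagonal and 0 off it, the value is 1 + 2 d - 1 - 1 + 1 = 2 d.\<close>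
  have "(\<lambda>j. L2_inner M (V n j) (V m j)) \<longlonglongrightarrow>
      (if n = n then 1 else 0) * (if m = m then 1 else 0) + 2 * (if n = m then 1 else 0)\<^sup>2
      - (if n = n then 1 else 0) - (if m = m then 1 else 0) + 1" for n m
    unfolding VV by (intro tendsto_intros U_U_tendsto)
  then have VV_lim: "(\<lambda>j. L2_inner M (V n j) (V m j)) \<longlonglongrightarrow> (if n = m then 2 else 0)" for n m
    by (rule tendsto_eq_rhs) simp
  have norm: "L2_inner M (\<lambda>\<omega>. \<Sum>n<N. w n * V n j \<omega>) (\<lambda>\<omega>. \<Sum>n<N. w n * V n j \<omega>) =
      (\<Sum>n<N. \<Sum>m<N. w n * w m * L2_inner M (V n j) (V m j))" for j
    by (rule L2.norm_lincomb) (auto intro: V)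
  have lim: "(\<lambda>j. L2_inner M (\<lambda>\<omega>. \<Sum>n<N. w n * V n j \<omega>) (\<lambda>\<omega>. \<Sum>n<N. w n * V n j \<omega>))
      \<longlonglongrightarrow> 2 * (\<Sum>n<N. (w n)\<^sup>2)"
    unfolding norm double_sum_2delta[symmetric] by (intro tendsto_intros VV_lim)
  have "\<forall>\<^sub>F j in sequentially. L2_inner M (\<lambda>\<omega>. \<Sum>n<N. w n * V n j \<omega>) (\<lambda>\<omega>. \<Sum>n<N. w n * V n j \<omega>)
      < 2 * (\<Sum>n<N. (w n)\<^sup>2) + e"
    by (rule order_tendstoD(2)[OF lim]) (use assms in simp)
  then have ev: "\<forall>\<^sub>F j in sequentially. L2_inner M (\<lambda>\<omega>. \<Sum>n<N. w n * V n j \<omega>) (\<lambda>\<omega>. \<Sum>n<N. w n * V n j \<omega>)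
      \<le> 2 * (\<Sum>n<N. (w n)\<^sup>2) + e"
    by eventually_elim simp
  have AE: "AE \<omega> in M. (\<lambda>j. \<Sum>n<N. w n * V n j \<omega>) \<longlonglongrightarrow> (\<Sum>n<N. w n * ((\<zeta> n \<omega>)\<^sup>2 - 1))"
    using \<zeta>_lim_all unfolding V_def by eventually_elim (intro tendsto_intros, blast)
  have m: "(\<lambda>\<omega>. \<Sum>n<N. w n * ((\<zeta> n \<omega>)\<^sup>2 - 1)) \<in> borel_measurable M" by measurable
  have L: "(\<lambda>\<omega>. \<Sum>n<N. w n * V n j \<omega>) \<in> L2 M" for j by (rule L2.lincomb) (auto intro: V)
  from L2_Fatou[OF L m AE ev]
  show "(\<lambda>\<omega>. \<Sum>n<N. w n * ((\<zeta> n \<omega>)\<^sup>2 - 1)) \<in> L2 M"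
    and "L2_inner M (\<lambda>\<omega>. \<Sum>n<N. w n * ((\<zeta> n \<omega>)\<^sup>2 - 1)) (\<lambda>\<omega>. \<Sum>n<N. w n * ((\<zeta> n \<omega>)\<^sup>2 - 1))
      \<le> 2 * (\<Sum>n<N. (w n)\<^sup>2) + e" by auto
qed

text \<open>Chebyshev's inequality for the centered sum D, with m the sum of the weights: staying
  below B forces D to be at most -m/2, while the second moment of D is at most 2m + 1, hence 3m,
  because weights at most 1 dominate their squares. The quotient of 3m by m^2/4 is 12/m.\<close>

lemma prob_bounded_weighted_squares_le:
  assumes w: "\<And>n. w n \<ge> 0" "\<And>n. w n \<le> 1" and B: "B \<ge> 0"
    and N: "(\<Sum>n<N. w n) \<ge> 2 * B + 1"
  shows "prob {\<omega>\<in>space M. \<forall>N. (\<Sum>n<N. w n * (\<zeta> n \<omega>)\<^sup>2) \<le> B} \<le> 12 / (\<Sum>n<N. w n)"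
proof -
  define m where "m = (\<Sum>n<N. w n)"
  define D where "D = (\<lambda>\<omega>. \<Sum>n<N. w n * ((\<zeta> n \<omega>)\<^sup>2 - 1))"
  have m1: "m \<ge> 1" using N B by (simp add: m_def)
  have D: "D \<in> L2 M" "L2_inner M D D \<le> 2 * (\<Sum>n<N. (w n)\<^sup>2) + 1"
    unfolding D_def by (rule centered_squares_norm_le[OF zero_less_one])+
  have "(\<Sum>n<N. (w n)\<^sup>2) \<le> m"
    unfolding m_def using w by (intro sum_mono) (simp add: power2_eq_square mult_left_le)
  then have DD: "(\<integral>\<omega>. (D \<omega>)\<^sup>2 \<partial>M) \<le> 3 * m"
    using D(2) m1 by (simp add: power2_eq_square)
  have Dm[measurable]: "D \<in> borel_measurable M" using D(1) by (simp add: L2_def)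
  have "{\<omega>\<in>space M. \<forall>N. (\<Sum>n<N. w n * (\<zeta> n \<omega>)\<^sup>2) \<le> B} \<subseteq> {\<omega>\<in>space M. (D \<omega>)\<^sup>2 \<ge> m\<^sup>2 / 4}"
  proof safe
    fix \<omega> assume "\<forall>N. (\<Sum>n<N. w n * (\<zeta> n \<omega>)\<^sup>2) \<le> B"
    then have "(\<Sum>n<N. w n * (\<zeta> n \<omega>)\<^sup>2) \<le> B" by blast
    moreover have "D \<omega> = (\<Sum>n<N. w n * (\<zeta> n \<omega>)\<^sup>2) - m"
      by (simp add: D_def m_def right_diff_distrib sum_subtractf)
    ultimately have "m / 2 \<le> - D \<omega>" using N B by (simp add: m_def)
    then have "(m / 2)\<^sup>2 \<le> (- D \<omega>)\<^sup>2" using m1 by (intro power_mono) auto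
    then show "m\<^sup>2 / 4 \<le> (D \<omega>)\<^sup>2" by (simp add: power_divide)
  qed
  then have "prob {\<omega>\<in>space M. \<forall>N. (\<Sum>n<N. w n * (\<zeta> n \<omega>)\<^sup>2) \<le> B} \<le> prob {\<omega>\<in>space M. (D \<omega>)\<^sup>2 \<ge> m\<^sup>2 / 4}"
    by (rule finite_measure_mono) measurable
  also have "\<dots> \<le> (\<integral>\<omega>. (D \<omega>)\<^sup>2 \<partial>M) / (m\<^sup>2 / 4)"
    by (rule integral_Markov_inequality_measure[where A="{}"]) (use D(1) m1 in \<open>auto simp: L2_def\<close>)
  also have "\<dots> \<le> 3 * m / (m\<^sup>2 / 4)" using DD by (intro divide_right_mono) auto
  also have "\<dots> = 12 / m" using m1 by (simp add: power2_eq_square)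
  finally show ?thesis by (simp add: m_def)
qed

text \<open>The partial sums of w are unbounded, so the Chebyshev bound can be made arbitrarily
  small and each event that the random sums stay below B is null; integer values of B exhaust all
  bounds.\<close>

lemma AE_not_summable_bounded_weighted_squares:
  assumes w: "\<And>n. w n \<ge> 0" "\<And>n. w n \<le> 1" and div: "\<not> summable w"
  shows "AE \<omega> in M. \<not> summable (\<lambda>n. w n * (\<zeta> n \<omega>)\<^sup>2)"
proof -
  have large: "\<exists>N. (\<Sum>n<N. w n) > C" for C
    using summableI_nonneg_bounded[of w C] w(1) div by (meson not_le)
  have "AE \<omega> in M. \<not> (\<forall>N. (\<Sum>n<N. w n * (\<zeta> n \<omega>)\<^sup>2) \<le> real B)" for B :: nat
  proof -
    let ?A = "{\<omega>\<in>space M. \<forall>N. (\<Sum>n<N. w n * (\<zeta> n \<omega>)\<^sup>2) \<le> real B}"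
    have A: "?A \<in> sets M" by measurable
    have "prob ?A \<le> e" if e: "e > 0" for e
    proof -
      obtain N where N: "(\<Sum>n<N. w n) > max (2 * real B + 1) (12 / e)" using large by blast
      then have "prob ?A \<le> 12 / (\<Sum>n<N. w n)"
        by (intro prob_bounded_weighted_squares_le w) auto
      also have "\<dots> \<le> e"
      proof -
        have "0 < 12 / e" using e by simp
        then show ?thesis using N e by (simp add: field_simps)
      qed
      finally show ?thesis .
    qed
    then have "prob ?A \<le> 0" using field_le_epsilon[of "prob ?A" 0] by simp
    then have "emeasure M ?A = 0" by (simp add: emeasure_eq_measure measure_le_0_iff)
    then show ?thesis by (intro AE_I[OF _ _ A]) auto
  qed
  then have "AE \<omega> in M. \<forall>B::nat. \<not> (\<forall>N. (\<Sum>n<N. w n * (\<zeta> n \<omega>)\<^sup>2) \<le> real B)"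
    unfolding AE_all_countable by blast
  then show ?thesis
  proof eventually_elim
    case (elim \<omega>)
    show ?case
    proof
      assume s: "summable (\<lambda>n. w n * (\<zeta> n \<omega>)\<^sup>2)"
      obtain B :: nat where B: "(\<Sum>n. w n * (\<zeta> n \<omega>)\<^sup>2) \<le> real B" using real_arch_simple by blast
      have "(\<Sum>n<N. w n * (\<zeta> n \<omega>)\<^sup>2) \<le> real B" for N
        by (rule order_trans[OF sum_le_suminf[OF s] B]) (simp_all add: w(1))
      then show False using elim by blast
    qed
  qed
qed

text \<open>Truncation at 1 preserves divergence: a summable truncation is eventually below 1 and so
  eventually equal to w.\<close>

lemma AE_not_summable_weighted_squares:
  assumes w: "\<And>n. w n \<ge> 0" and div: "\<not> summable w"
  shows "AE \<omega> in M. \<not> summable (\<lambda>n. w n * (\<zeta> n \<omega>)\<^sup>2)"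
proof -
  let ?v = "\<lambda>n. min (w n) 1"
  have "\<not> summable ?v"
  proof
    assume s: "summable ?v"
    have "\<forall>\<^sub>F n in sequentially. ?v n < 1"
      by (rule order_tendstoD(2)[OF summable_LIMSEQ_zero[OF s]]) simp
    then have "\<forall>\<^sub>F n in sequentially. ?v n = w n" by eventually_elim (simp add: min_def split: if_splits)
    then show False using div s by (simp add: summable_cong)
  qed
  then have "AE \<omega> in M. \<not> summable (\<lambda>n. ?v n * (\<zeta> n \<omega>)\<^sup>2)"
    by (intro AE_not_summable_bounded_weighted_squares) (simp_all add: w)
  then show ?thesis
  proof eventually_elim
    case (elim \<omega>)
    show ?case
    proof
      assume "summable (\<lambda>n. w n * (\<zeta> n \<omega>)\<^sup>2)"
      then have "summable (\<lambda>n. ?v n * (\<zeta> n \<omega>)\<^sup>2)"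
        by (rule summable_comparison_test'[where N=0]) (simp add: abs_mult w mult_right_mono)
      then show False using elim by blast
    qed
  qed
qed

end

section \<open>The law on path space\<close>

locale scaled_gaussian =
  fixes K :: "'t::polish_space \<Rightarrow> 't \<Rightarrow> real"
    and M :: "'w measure" and X :: "'t \<Rightarrow> 'w \<Rightarrow> real"
    and \<phi> :: "nat \<Rightarrow> 't \<Rightarrow> real" and \<alpha> :: "nat \<Rightarrow> real"
  assumes gaussian: "centered_gaussian_process M X K"
    and paths: "\<And>\<omega>. \<omega> \<in> space M \<Longrightarrow> continuous_on UNIV (\<lambda>t. X t \<omega>)"
    and basis: "rkhs_orthonormal_basis K \<phi>"
    and well_defined: "coefficients_well_defined \<phi>"
    and \<alpha>_scaling: "scaling \<phi> \<alpha>" and \<alpha>_summable: "summable (\<lambda>n. inverse (\<alpha> n))"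
    and \<alpha>_continuous: "continuous_kernel (scaled_kernel \<alpha> \<phi>)"
begin

definition law :: "('t \<Rightarrow> real) measure" where
  "law = distr M (PiM UNIV (\<lambda>_. borel)) (\<lambda>\<omega> t. X t \<omega>)"

abbreviation C :: "('t \<Rightarrow> real) set" where "C \<equiv> continuous_functions"

lemma X_measurable: "X t \<in> borel_measurable M"
  using gaussian by (simp add: centered_gaussian_process_def gaussian_process_def)

lemma path_measurable: "(\<lambda>\<omega> t. X t \<omega>) \<in> M \<rightarrow>\<^sub>M PiM UNIV (\<lambda>_. borel)"
  by (rule measurable_PiM_single') (auto simp: X_measurable)

lemma space_law: "space law = UNIV" by (simp add: law_def space_PiM)

lemma coordinate_measurable: "(\<lambda>f. f t) \<in> borel_measurable law"
  unfolding law_def by (simp add: measurable_component_singleton)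

lemma prob_space_law: "prob_space law"
proof -
  interpret prob_space M using gaussian by (simp add: centered_gaussian_process_def gaussian_process_def)
  show ?thesis unfolding law_def by (rule prob_space_distr[OF path_measurable])
qed

text \<open>Under \<open>law\<close> the path itself is the sample point. Replacing \<open>X\<close>
  by the coordinates turns the coefficients \<open>\<zeta> n\<close> into functions of the path and
  lets almost sure statements speak about f directly.\<close>

lemma coordinates_gaussian: "centered_gaussian_process law (\<lambda>t f. f t) K"
proof -
  have d: "distr law borel h = distr M borel (\<lambda>\<omega>. h (\<lambda>t. X t \<omega>))" if "h \<in> borel_measurable law" for h
    using distr_distr[of h "PiM UNIV (\<lambda>_. borel)" borel "\<lambda>\<omega> t. X t \<omega>" M] that path_measurable
    by (simp add: law_def comp_def)
  have i: "integral\<^sup>L law h = integral\<^sup>L M (\<lambda>\<omega>. h (\<lambda>t. X t \<omega>))"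
    if "h \<in> borel_measurable law" for h :: "('t \<Rightarrow> real) \<Rightarrow> real"
    unfolding law_def by (rule integral_distr[OF path_measurable]) (use that in \<open>simp add: law_def\<close>)
  note [measurable] = coordinate_measurable
  show ?thesis
    unfolding centered_gaussian_process_def gaussian_process_def
  proof (intro conjI allI impI prob_space_law coordinate_measurable)
    fix F :: "'t set" and a :: "'t \<Rightarrow> real" assume "finite F"
    have "(\<lambda>f. \<Sum>t\<in>F. a t * f t) \<in> borel_measurable law" by measurable
    from d[OF this] show "\<exists>m v. 0 \<le> v \<and> distr law borel (\<lambda>f. \<Sum>t\<in>F. a t * f t) = gaussian_law m v"
      using gaussian \<open>finite F\<close> by (simp add: centered_gaussian_process_def gaussian_process_def)
  next
    fix s t
    show "integral\<^sup>L law (\<lambda>f. f t) = 0"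
      using gaussian by (subst i) (simp_all add: coordinate_measurable centered_gaussian_process_def)
    have "(\<lambda>f. f s * f t) \<in> borel_measurable law" by measurable
    from i[OF this] show "integral\<^sup>L law (\<lambda>f. f s * f t) = K s t"
      using gaussian by (simp add: centered_gaussian_process_def)
  qed
qed

end

sublocale scaled_gaussian \<subseteq> Y: gaussian_basis law "\<lambda>t f. f t" K \<phi>
  by (intro gaussian_basis.intro centered_gaussian.intro prob_space_law
      centered_gaussian_axioms.intro coordinates_gaussian gaussian_basis_axioms.intro basis)

section \<open>Membership in scaled RKHSs as summability\<close>

context scaled_gaussian
begin

definition admissible :: "(nat \<Rightarrow> real) \<Rightarrow> bool" where
  "admissible \<beta> \<longleftrightarrow> scaling \<phi> \<beta> \<and> continuous_kernel (scaled_kernel \<beta> \<phi>)"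

definition scaled_rkhs :: "(nat \<Rightarrow> real) \<Rightarrow> ('t \<Rightarrow> real) set" where
  "scaled_rkhs \<beta> = rkhs (scaled_kernel \<beta> \<phi>)"

lemma admissible_pos: "admissible \<beta> \<Longrightarrow> \<beta> n > 0"
  by (simp add: admissible_def scaling_def)

lemma admissible_\<alpha>: "admissible \<alpha>"
  using \<alpha>_scaling \<alpha>_continuous by (simp add: admissible_def)

lemma admissible_smaller: "(\<And>n. 0 < \<beta> n) \<Longrightarrow> (\<And>n. \<beta> n \<le> \<alpha> n) \<Longrightarrow> admissible \<beta>"
  unfolding admissible_def using scaled_kernel_smaller[OF \<alpha>_scaling \<alpha>_continuous] by blast

lemma admissible_add:
  assumes "admissible \<beta>" "admissible \<gamma>"
  shows "admissible (\<lambda>n. \<beta> n + \<gamma> n)"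
proof -
  interpret B: scaled_features \<phi> \<beta> using assms by unfold_locales (simp add: admissible_def)
  interpret G: scaled_features \<phi> \<gamma> using assms by unfold_locales (simp add: admissible_def)
  have "scaled_kernel (\<lambda>n. \<beta> n + \<gamma> n) \<phi> s t = scaled_kernel \<beta> \<phi> s t + scaled_kernel \<gamma> \<phi> s t" for s t
    using sums_unique[OF sums_add[OF B.scaled_kernel_sums G.scaled_kernel_sums], of s t]
    by (simp add: scaled_kernel_def distrib_right)
  then have "continuous_kernel (scaled_kernel (\<lambda>n. \<beta> n + \<gamma> n) \<phi>)"
    using assms unfolding admissible_def continuous_kernel_def case_prod_beta'
    by (simp add: continuous_on_add)
  moreover have "scaling \<phi> (\<lambda>n. \<beta> n + \<gamma> n)"
    using assms by (auto simp: admissible_def scaling_def distrib_right add_pos_pos intro: summable_add)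
  ultimately show ?thesis by (simp add: admissible_def)
qed

text \<open>Enlarging the weights to \<open>\<beta> + \<gamma>\<close> puts both expansions into one
  scaled RKHS, where uniqueness is available.\<close>

lemma coefficients_unique:
  assumes \<beta>: "admissible \<beta>" and \<gamma>: "admissible \<gamma>"
    and c: "summable (\<lambda>n. (c n)\<^sup>2 / \<beta> n)" "expansion \<phi> c f"
    and d: "summable (\<lambda>n. (d n)\<^sup>2 / \<gamma> n)" "expansion \<phi> d f"
  shows "c = d"
proof -
  have pos: "\<beta> n > 0" "\<gamma> n > 0" for n using \<beta> \<gamma> by (auto intro: admissible_pos)
  have "summable (\<lambda>n. (c n)\<^sup>2 / (\<beta> n + \<gamma> n))"
  proof (rule summable_comparison_test'[OF c(1), where N=0])
    fix n show "norm ((c n)\<^sup>2 / (\<beta> n + \<gamma> n)) \<le> (c n)\<^sup>2 / \<beta> n"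
      using pos[of n] by (simp add: divide_left_mono)
  qed
  moreover have "summable (\<lambda>n. (d n)\<^sup>2 / (\<beta> n + \<gamma> n))"
  proof (rule summable_comparison_test'[OF d(1), where N=0])
    fix n show "norm ((d n)\<^sup>2 / (\<beta> n + \<gamma> n)) \<le> (d n)\<^sup>2 / \<gamma> n"
      using pos[of n] by (simp add: divide_left_mono)
  qed
  ultimately show ?thesis
    using well_defined[unfolded coefficients_well_defined_def, rule_format, of "\<lambda>n. \<beta> n + \<gamma> n" c d f]
      admissible_add[OF \<beta> \<gamma>] c(2) d(2) by (simp add: admissible_def)
qed

lemma scaled_rkhs_eq:
  assumes \<beta>: "admissible \<beta>"
  shows "scaled_rkhs \<beta> = {f. \<exists>c. summable (\<lambda>n. (c n)\<^sup>2 / \<beta> n) \<and> expansion \<phi> c f}"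
proof -
  interpret B: scaled_features \<phi> \<beta> using \<beta> by unfold_locales (simp add: admissible_def)
  show ?thesis
    unfolding scaled_rkhs_def
  proof (rule B.rkhs_scaled_kernel)
    fix c assume c: "summable (\<lambda>n. (c n)\<^sup>2 / \<beta> n)" "expansion \<phi> c (\<lambda>t. 0)"
    show "c = (\<lambda>n. 0)"
      by (rule coefficients_unique[OF \<beta> \<beta> c]) (simp_all add: expansion_def)
  qed
qed

text \<open>Since coefficients agree across weights, one expansion of f decides membership in all
  these spaces at once: membership becomes a question about a numerical series.\<close>

lemma scaled_rkhs_iff:
  assumes \<beta>: "admissible \<beta>" and \<gamma>: "admissible \<gamma>"
    and c: "summable (\<lambda>n. (c n)\<^sup>2 / \<gamma> n)" "expansion \<phi> c f"
  shows "f \<in> scaled_rkhs \<beta> \<longleftrightarrow> summable (\<lambda>n. (c n)\<^sup>2 / \<beta> n)"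
proof
  assume "f \<in> scaled_rkhs \<beta>"
  then obtain d where d: "summable (\<lambda>n. (d n)\<^sup>2 / \<beta> n)" "expansion \<phi> d f"
    unfolding scaled_rkhs_eq[OF \<beta>] by blast
  from coefficients_unique[OF \<beta> \<gamma> d c] d(1) show "summable (\<lambda>n. (c n)\<^sup>2 / \<beta> n)" by simp
next
  assume "summable (\<lambda>n. (c n)\<^sup>2 / \<beta> n)"
  with c(2) show "f \<in> scaled_rkhs \<beta>" unfolding scaled_rkhs_eq[OF \<beta>] by (intro CollectI exI[of _ c] conjI)
qed

lemma scaled_rkhs_subset_C:
  assumes "admissible \<beta>"
  shows "scaled_rkhs \<beta> \<subseteq> C"
proof
  fix f assume "f \<in> scaled_rkhs \<beta>"
  then obtain c where "summable (\<lambda>n. (c n)\<^sup>2 / \<beta> n)" "expansion \<phi> c f"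
    unfolding scaled_rkhs_eq[OF assms] by blast
  then show "f \<in> C"
    using expansion_continuous[of \<phi> \<beta> c f] assms by (simp add: admissible_def continuous_functions_def)
qed

lemma expansion_exists:
  assumes "admissible \<beta>" "summable (\<lambda>n. (c n)\<^sup>2 / \<beta> n)"
  shows "\<exists>f. expansion \<phi> c f"
proof -
  interpret B: scaled_features \<phi> \<beta> using assms(1) by unfold_locales (simp add: admissible_def)
  show ?thesis using B.expansion_inner[OF assms(2)] by blast
qed

abbreviation "\<zeta> \<equiv> Y.\<zeta>"

lemma continuous_functions_eqI:
  assumes "f \<in> C" "h \<in> C" and D: "\<And>S. open S \<Longrightarrow> S \<noteq> {} \<Longrightarrow> \<exists>d\<in>D. d \<in> S" "\<And>t. t \<in> D \<Longrightarrow> f t = h t"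
  shows "f = h"
proof (rule ccontr)
  assume "f \<noteq> h"
  then have "- {t. f t = h t} \<noteq> {}" by auto
  moreover have "closed {t. f t = h t}"
    using assms(1,2) by (intro closed_Collect_eq) (simp_all add: continuous_functions_def)
  ultimately show False using D(1)[of "- {t. f t = h t}"] D(2) by (auto simp: open_Compl)
qed

text \<open>For fixed t the expansion holds outside a null set depending on t. A countable dense set
  of t keeps a single null set, and continuity of both f and the sum of the series extends the
  identity to all t.\<close>

lemma AE_path_expansion:
  "AE f in law. f \<in> C \<longrightarrow> summable (\<lambda>n. (\<zeta> n f)\<^sup>2 / \<alpha> n) \<and> expansion \<phi> (\<lambda>n. \<zeta> n f) f"
proof -
  obtain D :: "'t set" where D: "countable D" "\<And>S. open S \<Longrightarrow> S \<noteq> {} \<Longrightarrow> \<exists>d\<in>D. d \<in> S"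
    using countable_dense_exists[where 'a='t] by blast
  have "AE f in law. summable (\<lambda>n. inverse (\<alpha> n) * (\<zeta> n f)\<^sup>2)"
    by (rule Y.AE_summable_weighted_squares[OF \<alpha>_summable])
       (use admissible_pos[OF admissible_\<alpha>] in \<open>simp add: less_imp_le\<close>)
  then have 1: "AE f in law. summable (\<lambda>n. (\<zeta> n f)\<^sup>2 / \<alpha> n)"
    by (simp add: divide_inverse mult.commute)
  have "AE f in law. (\<lambda>n. \<phi> n t * \<zeta> n f) sums f t" for t
  proof (rule Y.AE_expansion, use 1 in eventually_elim)
    case (elim f)
    obtain h where "expansion \<phi> (\<lambda>n. \<zeta> n f) h"
      using expansion_exists[OF admissible_\<alpha> elim] by (rule exE)
    then have "(\<lambda>n. \<phi> n t * \<zeta> n f) sums h t" by (simp add: expansion_def mult.commute)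
    then show "summable (\<lambda>n. \<phi> n t * \<zeta> n f)" by (rule sums_summable)
  qed
  then have "AE f in law. \<forall>t\<in>D. (\<lambda>n. \<phi> n t * \<zeta> n f) sums f t"
    unfolding AE_ball_countable[OF D(1)] by (intro ballI)
  with 1 show ?thesis
  proof eventually_elim
    case (elim f)
    show ?case
    proof
      assume f: "f \<in> C"
      obtain h where h: "expansion \<phi> (\<lambda>n. \<zeta> n f) h"
        using expansion_exists[OF admissible_\<alpha> elim(1)] by (rule exE)
      have "h \<in> scaled_rkhs \<alpha>" by (rule scaled_rkhs_iff[OF admissible_\<alpha> admissible_\<alpha> elim(1) h, THEN iffD2, OF elim(1)])
      then have "h \<in> C" using scaled_rkhs_subset_C[OF admissible_\<alpha>] by blast
      have "f = h"
      proof (rule continuous_functions_eqI[OF f \<open>h \<in> C\<close> D(2)])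
        fix t assume "t \<in> D"
        then have "(\<lambda>n. \<phi> n t * \<zeta> n f) sums f t" using elim(2) by blast
        moreover have "(\<lambda>n. \<phi> n t * \<zeta> n f) sums h t" using h by (simp add: expansion_def mult.commute)
        ultimately show "f t = h t" by (rule sums_unique2)
      qed
      then show "summable (\<lambda>n. (\<zeta> n f)\<^sup>2 / \<alpha> n) \<and> expansion \<phi> (\<lambda>n. \<zeta> n f) f"
        using elim(1) h by simp
    qed
  qed
qed

text \<open>Restricted to continuous functions because \<open>C\<close> itself need not be an event
  of \<open>law\<close>. For A inside \<open>C\<close> it yields measure one under the trace
  law.\<close>

definition full :: "('t \<Rightarrow> real) set \<Rightarrow> bool" where
  "full A \<longleftrightarrow> (AE f in law. f \<in> C \<longrightarrow> f \<in> A)"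

lemma full_scaled_rkhs:
  assumes \<beta>: "admissible \<beta>" and "summable (\<lambda>n. inverse (\<beta> n))"
  shows "full (scaled_rkhs \<beta>)"
proof -
  have "AE f in law. summable (\<lambda>n. inverse (\<beta> n) * (\<zeta> n f)\<^sup>2)"
    by (rule Y.AE_summable_weighted_squares[OF assms(2)])
       (use admissible_pos[OF \<beta>] in \<open>simp add: less_imp_le\<close>)
  with AE_path_expansion show ?thesis unfolding full_def
  proof eventually_elim
    case (elim f)
    then show ?case
      using scaled_rkhs_iff[OF \<beta> admissible_\<alpha>, of "\<lambda>n. \<zeta> n f" f] by (simp add: divide_inverse mult.commute)
  qed
qed

lemma full_Compl_scaled_rkhs:
  assumes \<beta>: "admissible \<beta>" and "\<not> summable (\<lambda>n. inverse (\<beta> n))"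
  shows "full (C - scaled_rkhs \<beta>)"
proof -
  have "AE f in law. \<not> summable (\<lambda>n. inverse (\<beta> n) * (\<zeta> n f)\<^sup>2)"
    by (rule Y.AE_not_summable_weighted_squares[OF _ assms(2)])
       (use admissible_pos[OF \<beta>] in \<open>simp add: less_imp_le\<close>)
  with AE_path_expansion show ?thesis unfolding full_def
  proof eventually_elim
    case (elim f)
    then show ?case
      using scaled_rkhs_iff[OF \<beta> admissible_\<alpha>, of "\<lambda>n. \<zeta> n f" f] by (simp add: divide_inverse mult.commute)
  qed
qed

section \<open>The generated \<sigma>-algebra and its zero-one law\<close>

lemma rkhs_scaled_kernels: "rkhs ` scaled_kernels \<phi> = scaled_rkhs ` Collect admissible"
  unfolding scaled_kernels_def scaled_rkhs_def[abs_def] admissible_def[abs_def] by blast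

lemma rkhs_sigma_induct [consumes 1, case_names basic empty compl union]:
  assumes "A \<in> rkhs_sigma (scaled_kernels \<phi>)"
    and basic: "\<And>\<beta>. admissible \<beta> \<Longrightarrow> P (scaled_rkhs \<beta>)"
    and empty: "P {}"
    and compl: "\<And>A. A \<in> rkhs_sigma (scaled_kernels \<phi>) \<Longrightarrow> A \<subseteq> C \<Longrightarrow> P A \<Longrightarrow> P (C - A)"
    and union: "\<And>A. (\<And>i::nat. A i \<in> rkhs_sigma (scaled_kernels \<phi>)) \<Longrightarrow> (\<And>i. A i \<subseteq> C) \<Longrightarrow>
      (\<And>i. P (A i)) \<Longrightarrow> P (\<Union>i. A i)"
  shows "A \<subseteq> C \<and> P A"
  using assms(1) unfolding rkhs_sigma_def rkhs_scaled_kernels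
proof (induction rule: sigma_sets.induct)
  case (Basic A)
  then obtain \<beta> where "A = scaled_rkhs \<beta>" "admissible \<beta>" by blast
  then show ?case using basic scaled_rkhs_subset_C by simp
next
  case Empty
  show ?case using empty by simp
next
  case (Compl A)
  then show ?case using compl[of A] unfolding rkhs_sigma_def rkhs_scaled_kernels by simp
next
  case (Union A)
  then show ?case using union[of A] unfolding rkhs_sigma_def rkhs_scaled_kernels by blast
qed

text \<open>A zero-one law: the alternative is inherited by complements and countable unions, and
  the generators satisfy it according to whether their inverse weights are summable.\<close>

lemma rkhs_sigma_dichotomy:
  assumes "A \<in> rkhs_sigma (scaled_kernels \<phi>)"
  shows "A \<subseteq> C \<and> (full A \<or> full (C - A))"
  using assms
proof (induction rule: rkhs_sigma_induct)
  case (basic \<beta>)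
  then show ?case using full_scaled_rkhs full_Compl_scaled_rkhs by blast
next
  case empty
  show ?case by (simp add: full_def)
next
  case (compl A)
  moreover have "C - (C - A) = A" using compl by blast
  ultimately show ?case by auto
next
  case (union A)
  show ?case
  proof (cases "\<exists>i. full (A i)")
    case True
    then obtain i where "full (A i)" by blast
    then have "full (\<Union>i. A i)" unfolding full_def by eventually_elim blast
    then show ?thesis by blast
  next
    case False
    then have "\<forall>i. full (C - A i)" using union by blast
    then have "AE f in law. \<forall>i. f \<in> C \<longrightarrow> f \<in> C - A i" unfolding full_def AE_all_countable .
    then have "full (C - (\<Union>i. A i))" unfolding full_def by eventually_elim blast
    then show ?thesis by blast
  qed
qed

section \<open>The trace of the completed law on the continuous functions\<close>

abbreviation "cl \<equiv> completed_law M X"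

lemma cl_eq: "cl = completion law" by (simp add: completed_law_def law_def)

lemma space_cl: "space cl = UNIV" by (simp add: cl_eq space_law)

lemma sets_law_cl: "G \<in> sets law \<Longrightarrow> G \<in> sets cl \<and> emeasure cl G = emeasure law G"
  by (simp add: cl_eq)

lemma subset_null_set_cl: "B \<subseteq> N \<Longrightarrow> N \<in> null_sets law \<Longrightarrow> B \<in> sets cl \<and> emeasure cl B = 0"
  using null_sets_completion_subset[of B N law] null_sets_completionI[of N law] by (auto simp: cl_eq)

text \<open>Outer measure one of \<open>C\<close> in disguise: up to a null set, G is a measurable
  set that misses every path, so its preimage is empty.\<close>

lemma emeasure_cl_disjoint_C:
  assumes G: "G \<in> sets cl" "C \<inter> G = {}"
  shows "emeasure cl G = 0"
proof -
  obtain S N N' where G_eq: "G = S \<union> N" "N \<subseteq> N'" "N' \<in> null_sets law" "S \<in> sets law"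
    using sets_completionE[OF G(1)[unfolded cl_eq]] by metis
  have "(\<lambda>t. X t \<omega>) \<in> C" if "\<omega> \<in> space M" for \<omega>
    using paths[OF that] by (simp add: continuous_functions_def)
  then have "(\<lambda>\<omega> t. X t \<omega>) -` S \<inter> space M = {}" using G(2) G_eq(1) by blast
  then have "emeasure law S = 0"
    using emeasure_distr[OF path_measurable, of S] G_eq(4) by (simp add: law_def)
  then have "S \<union> N' \<in> null_sets law" using G_eq by (auto intro: null_setsI)
  then show ?thesis using subset_null_set_cl[of G "S \<union> N'"] G_eq by blast
qed

lemma emeasure_cl_trace_le:
  assumes "G \<in> sets cl" "G' \<in> sets cl" "C \<inter> G = C \<inter> G'"
  shows "emeasure cl G \<le> emeasure cl G'"
proof -
  have "emeasure cl G \<le> emeasure cl (G' \<union> (G - G'))"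
    using assms by (intro emeasure_mono) auto
  also have "\<dots> \<le> emeasure cl G' + emeasure cl (G - G')"
    using assms by (intro emeasure_subadditive) auto
  also have "emeasure cl (G - G') = 0"
    using assms by (intro emeasure_cl_disjoint_C) auto
  finally show ?thesis by simp
qed

lemma emeasure_cl_trace_eq:
  assumes "G \<in> sets cl" "G' \<in> sets cl" "C \<inter> G = C \<inter> G'"
  shows "emeasure cl G = emeasure cl G'"
  using emeasure_cl_trace_le[OF assms] emeasure_cl_trace_le[OF assms(2,1)] assms(3) by (simp add: antisym)

text \<open>The choice made in \<open>path_law\<close> is immaterial by
  \<open>emeasure_cl_trace_eq\<close>. What remains is that the resulting set function is a measure,
  without which \<open>measure_of\<close> would return the null measure.\<close>

lemma emeasure_path_law:
  assumes G: "G \<in> sets cl"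
  shows "emeasure (path_law M X) (C \<inter> G) = emeasure cl G"
proof -
  define \<T> where "\<T> = {C \<inter> G | G. G \<in> sets cl}"
  define \<mu> where "\<mu> A = emeasure cl (SOME G. G \<in> sets cl \<and> C \<inter> G = A)" for A
  have \<mu>: "\<mu> (C \<inter> G) = emeasure cl G" if G: "G \<in> sets cl" for G
  proof -
    let ?G = "SOME G'. G' \<in> sets cl \<and> C \<inter> G' = C \<inter> G"
    have "?G \<in> sets cl \<and> C \<inter> ?G = C \<inter> G"
      by (rule someI[of "\<lambda>G'. G' \<in> sets cl \<and> C \<inter> G' = C \<inter> G" G]) (simp add: G)
    then show ?thesis unfolding \<mu>_def using emeasure_cl_trace_eq G by blast
  qed
  have \<T>: "\<T> = sets (restrict_space cl C)" by (auto simp: \<T>_def sets_restrict_space)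
  have "sigma_algebra C \<T>"
    using sets.sigma_algebra_axioms[of "restrict_space cl C"] unfolding \<T>
    by (simp add: space_restrict_space space_cl)
  then have sets: "sets (path_law M X) = \<T>"
    unfolding path_law_def \<T>_def[symmetric] by (rule sigma_algebra.sets_measure_of_eq)
  have "emeasure (path_law M X) (C \<inter> G) = \<mu> (C \<inter> G)"
  proof (rule emeasure_measure_of[where \<Omega>=C and A=\<T>])
    show "path_law M X = measure_of C \<T> \<mu>"
      unfolding path_law_def \<T>_def[symmetric] \<mu>_def[abs_def] ..
    show "\<T> \<subseteq> Pow C" by (auto simp: \<T>_def)
    show "C \<inter> G \<in> Sigma_Algebra.sets (path_law M X)" using G unfolding sets \<T>_def by blast
    show "positive (Sigma_Algebra.sets (path_law M X)) \<mu>"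
      using \<mu>[of "{}"] by (simp add: positive_def)
    show "countably_additive (Sigma_Algebra.sets (path_law M X)) \<mu>"
      unfolding countably_additive_def
    proof (intro allI impI)
      fix A :: "nat \<Rightarrow> ('t \<Rightarrow> real) set"
      assume A: "range A \<subseteq> Sigma_Algebra.sets (path_law M X)" "disjoint_family A"
      have "\<exists>G. G \<in> sets cl \<and> A i = C \<inter> G" for i using A(1) unfolding sets \<T>_def by blast
      then obtain H where H: "\<And>i. H i \<in> Sigma_Algebra.sets cl" "\<And>i. A i = C \<inter> H i" by metis
      \<comment> \<open>The representatives \<open>H i\<close> may overlap outside \<open>C\<close>.
        Disjointing them leaves the traces unchanged, as these are disjoint already.\<close>
      let ?D = "disjointed H"
      have D: "?D i \<in> Sigma_Algebra.sets cl" for i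
        using sets.range_disjointed_sets[of H cl] H(1) by auto
      have AD: "A i = C \<inter> ?D i" for i
      proof -
        have "f \<notin> A j" if "f \<in> A i" "j \<in> {0..<i}" for f j
          using disjoint_family_onD[OF A(2), of i j] that by auto
        moreover have "C \<inter> ?D i = A i - (\<Union>j\<in>{0..<i}. A j)"
          unfolding disjointed_def H(2) by blast
        ultimately show ?thesis by blast
      qed
      have "(\<Sum>i. \<mu> (A i)) = (\<Sum>i. emeasure cl (?D i))"
        unfolding AD using \<mu>[OF D] by simp
      also have "\<dots> = emeasure cl (\<Union>i. ?D i)"
        using D by (intro suminf_emeasure disjoint_family_disjointed) auto
      also have "\<dots> = \<mu> (C \<inter> (\<Union>i. ?D i))" using D by (intro \<mu>[symmetric]) auto
      also have "C \<inter> (\<Union>i. ?D i) = (\<Union>i. A i)" unfolding AD by blast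
      finally show "(\<Sum>i. \<mu> (A i)) = \<mu> (\<Union>i. A i)" .
    qed
  qed
  then show ?thesis using \<mu>[OF G] by simp
qed

lemma full_null_set:
  assumes "full A"
  obtains N where "N \<in> null_sets law" "C - N \<subseteq> A"
proof -
  obtain N where "{f \<in> space law. \<not> (f \<in> C \<longrightarrow> f \<in> A)} \<subseteq> N" "N \<in> null_sets law"
    using assms unfolding full_def eventually_ae_filter by blast
  then show ?thesis using that[of N] by (auto simp: space_law)
qed

text \<open>A is the trace of the complement of a null set N enlarged by the subset
  \<open>A \<inter> N\<close> of N; the completion makes that part measurable.\<close>

lemma emeasure_full:
  assumes A: "A \<subseteq> C" "full A"
  shows "emeasure (path_law M X) A = 1"
proof -
  obtain N where N: "N \<in> null_sets law" "C - N \<subseteq> A" using full_null_set[OF A(2)] .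
  have U: "UNIV - N \<in> sets cl" "emeasure cl (UNIV - N) = 1"
  proof -
    have "UNIV - N \<in> sets law" using N(1) sets.compl_sets[of N law] by (auto simp: space_law)
    moreover have "emeasure law (UNIV - N) = 1"
      using N(1) emeasure_Diff_null_set[of N law UNIV] Y.emeasure_space_1 sets.top[of law] by (simp add: space_law)
    ultimately show "UNIV - N \<in> sets cl" "emeasure cl (UNIV - N) = 1" using sets_law_cl by auto
  qed
  have I: "A \<inter> N \<in> sets cl" "emeasure cl (A \<inter> N) = 0" using subset_null_set_cl[of "A \<inter> N" N] N by auto
  have "(UNIV - N) \<inter> (A \<inter> N) = {}" by blast
  then have "emeasure cl ((UNIV - N) \<union> (A \<inter> N)) = 1"
    using U I plus_emeasure[of "UNIV - N" cl "A \<inter> N"] by simp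
  moreover have "C \<inter> ((UNIV - N) \<union> (A \<inter> N)) = A" using A N by blast
  ultimately show ?thesis using emeasure_path_law[of "(UNIV - N) \<union> (A \<inter> N)"] U I by simp
qed

lemma emeasure_Compl_full:
  assumes A: "A \<subseteq> C" "full (C - A)"
  shows "emeasure (path_law M X) A = 0"
proof -
  obtain N where N: "N \<in> null_sets law" "C - N \<subseteq> C - A" using full_null_set[OF A(2)] .
  then have "A \<in> sets cl \<and> emeasure cl A = 0" using A by (intro subset_null_set_cl[of A N]) auto
  moreover have "C \<inter> A = A" using A by blast
  ultimately show ?thesis using emeasure_path_law[of A] by simp
qed

lemma emeasure_eq_1_iff_full:
  assumes "A \<in> rkhs_sigma (scaled_kernels \<phi>)"
  shows "emeasure (path_law M X) A = 1 \<longleftrightarrow> full A"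
  using rkhs_sigma_dichotomy[OF assms] emeasure_full emeasure_Compl_full by fastforce

end

section \<open>The sample support set\<close>

lemma strict_mono_selection:
  assumes "\<And>k m :: nat. \<exists>n>m. P k n"
  shows "\<exists>r :: nat \<Rightarrow> nat. strict_mono r \<and> (\<forall>k. P k (r k))"
proof -
  have "\<exists>r. \<forall>k. P k (r k) \<and> r k < r (Suc k)"
  proof (rule dependent_nat_choice)
    show "\<exists>n. P 0 n" using assms[of 0 0] by blast
    show "\<exists>n. P (Suc k) n \<and> m < n" for m k using assms[of m "Suc k"] by blast
  qed
  then show ?thesis by (auto simp: strict_mono_Suc_iff)
qed

text \<open>Transplants v to the positions \<open>r k\<close>. The perturbations of inverse weights
  and of squared coefficients are of this form, so that series against them become series over
  k.\<close>

definition spread :: "(nat \<Rightarrow> nat) \<Rightarrow> (nat \<Rightarrow> real) \<Rightarrow> nat \<Rightarrow> real" where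
  "spread r v n = (if n \<in> range r then v (inv r n) else 0)"

lemma spread_nonneg: "(\<And>k. v k \<ge> 0) \<Longrightarrow> spread r v n \<ge> 0"
  by (simp add: spread_def)

lemma spread_at: "strict_mono r \<Longrightarrow> spread r v (r k) = v k"
  by (simp add: spread_def strict_mono_imp_inj_on)

lemma summable_mult_spread:
  assumes "strict_mono r"
  shows "summable (\<lambda>n. a n * spread r v n) \<longleftrightarrow> summable (\<lambda>k. a (r k) * v k)"
  using summable_mono_reindex[OF assms, of "\<lambda>n. a n * spread r v n"]
  by (simp add: spread_at[OF assms]) (simp add: spread_def)

lemma coefficient_bounds_iff:
  fixes c :: "nat \<Rightarrow> real"
  shows "liminf (\<lambda>n. ereal ((c n)\<^sup>2)) > 0 \<and> (SUP n. ereal ((c n)\<^sup>2)) < \<infinity> \<longleftrightarrow>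
    (\<exists>a>0. \<forall>\<^sub>F n in sequentially. a \<le> (c n)\<^sup>2) \<and> (\<exists>b. \<forall>n. (c n)\<^sup>2 \<le> b)"
proof (intro arg_cong2[of _ _ _ _ "(\<and>)"] iffI)
  assume "liminf (\<lambda>n. ereal ((c n)\<^sup>2)) > 0"
  from ereal_dense2[OF this] obtain a where a: "0 < ereal a" "ereal a < liminf (\<lambda>n. ereal ((c n)\<^sup>2))" by blast
  have "\<forall>\<^sub>F n in sequentially. ereal a < ereal ((c n)\<^sup>2)" by (rule less_LiminfD[OF a(2)])
  then have "\<forall>\<^sub>F n in sequentially. a \<le> (c n)\<^sup>2" by eventually_elim simp
  then show "\<exists>a>0. \<forall>\<^sub>F n in sequentially. a \<le> (c n)\<^sup>2" using a(1) by auto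
next
  assume "\<exists>a>0. \<forall>\<^sub>F n in sequentially. a \<le> (c n)\<^sup>2"
  then obtain a where a: "a > 0" "\<forall>\<^sub>F n in sequentially. a \<le> (c n)\<^sup>2" by blast
  have "ereal a \<le> liminf (\<lambda>n. ereal ((c n)\<^sup>2))"
    by (rule Liminf_bounded) (use a(2) in simp)
  then show "liminf (\<lambda>n. ereal ((c n)\<^sup>2)) > 0" using a(1) by (metis ereal_less(2) less_le_trans)
next
  assume *: "(SUP n. ereal ((c n)\<^sup>2)) < \<infinity>"
  show "\<exists>b. \<forall>n. (c n)\<^sup>2 \<le> b"
  proof (rule ccontr)
    assume no: "\<not> ?thesis"
    have "(SUP n. ereal ((c n)\<^sup>2)) = \<infinity>"
    proof (rule SUP_PInfty)
      fix k :: nat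
      obtain n where "real k < (c n)\<^sup>2" using no by (meson not_le)
      then show "\<exists>n\<in>UNIV. ereal (real k) \<le> ereal ((c n)\<^sup>2)" by (intro bexI[of _ n]) auto
    qed
    with * show False by simp
  qed
next
  assume "\<exists>b. \<forall>n. (c n)\<^sup>2 \<le> b"
  then obtain b where "\<And>n. (c n)\<^sup>2 \<le> b" by blast
  then have "(SUP n. ereal ((c n)\<^sup>2)) \<le> ereal b" by (intro SUP_least) simp
  then show "(SUP n. ereal ((c n)\<^sup>2)) < \<infinity>" by (rule le_less_trans) simp
qed

text \<open>Comparison in both directions, with factor 1/a on a tail and factor b
  everywhere.\<close>

lemma summable_bounded_ratio_iff:
  fixes c \<beta> :: "nat \<Rightarrow> real"
  assumes "\<And>n. \<beta> n > 0" and a: "a > 0" "\<forall>\<^sub>F n in sequentially. a \<le> (c n)\<^sup>2" and b: "\<And>n. (c n)\<^sup>2 \<le> b"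
  shows "summable (\<lambda>n. (c n)\<^sup>2 / \<beta> n) \<longleftrightarrow> summable (\<lambda>n. inverse (\<beta> n))"
proof
  assume s: "summable (\<lambda>n. (c n)\<^sup>2 / \<beta> n)"
  show "summable (\<lambda>n. inverse (\<beta> n))"
  proof (rule summable_comparison_test_ev)
    show "summable (\<lambda>n. (c n)\<^sup>2 / \<beta> n / a)" by (rule summable_divide[OF s])
    show "\<forall>\<^sub>F n in sequentially. norm (inverse (\<beta> n)) \<le> (c n)\<^sup>2 / \<beta> n / a"
      using a(2)
    proof eventually_elim
      case (elim n)
      then show ?case using a(1) assms(1)[of n] by (simp add: field_simps)
    qed
  qed
next
  assume s: "summable (\<lambda>n. inverse (\<beta> n))"
  show "summable (\<lambda>n. (c n)\<^sup>2 / \<beta> n)"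
  proof (rule summable_comparison_test'[where N=0])
    show "summable (\<lambda>n. b * inverse (\<beta> n))" by (rule summable_mult[OF s])
    show "norm ((c n)\<^sup>2 / \<beta> n) \<le> b * inverse (\<beta> n)" for n
      using assms(1)[of n] b[of n] by (simp add: divide_inverse mult_right_mono)
  qed
qed

section \<open>Identification of the support set\<close>

context scaled_gaussian
begin

definition two_sided_bounded :: "('t \<Rightarrow> real) set" where
  "two_sided_bounded = {f. \<exists>c. expansion \<phi> c f \<and>
     liminf (\<lambda>n. ereal ((c n)\<^sup>2)) > 0 \<and> (SUP n. ereal ((c n)\<^sup>2)) < \<infinity>}"

lemma \<alpha>_pos: "\<alpha> n > 0" by (rule admissible_pos[OF admissible_\<alpha>])

lemma two_sided_boundedE:
  assumes "f \<in> two_sided_bounded"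
  obtains c a b where "expansion \<phi> c f" "a > 0" "\<forall>\<^sub>F n in sequentially. a \<le> (c n)\<^sup>2"
    "\<forall>n. (c n)\<^sup>2 \<le> b" "summable (\<lambda>n. (c n)\<^sup>2 / \<alpha> n)"
proof -
  obtain c where c: "expansion \<phi> c f"
    "liminf (\<lambda>n. ereal ((c n)\<^sup>2)) > 0 \<and> (SUP n. ereal ((c n)\<^sup>2)) < \<infinity>"
    using assms unfolding two_sided_bounded_def by blast
  from c(2) obtain a b where ab: "a > 0" "\<forall>\<^sub>F n in sequentially. a \<le> (c n)\<^sup>2" "\<And>n. (c n)\<^sup>2 \<le> b"
    unfolding coefficient_bounds_iff by blast
  have "summable (\<lambda>n. (c n)\<^sup>2 / \<alpha> n)"
    using summable_bounded_ratio_iff[OF \<alpha>_pos ab] \<alpha>_summable by simp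
  with c(1) ab show ?thesis using that by blast
qed

lemma two_sided_boundedI:
  "expansion \<phi> c f \<Longrightarrow> a > 0 \<Longrightarrow> \<forall>\<^sub>F n in sequentially. a \<le> (c n)\<^sup>2 \<Longrightarrow> (\<And>n. (c n)\<^sup>2 \<le> b) \<Longrightarrow> f \<in> two_sided_bounded"
  unfolding two_sided_bounded_def coefficient_bounds_iff by blast

lemma two_sided_bounded_subset_C: "two_sided_bounded \<subseteq> C"
proof
  fix f assume "f \<in> two_sided_bounded"
  then obtain c where "expansion \<phi> c f" "summable (\<lambda>n. (c n)\<^sup>2 / \<alpha> n)" by (rule two_sided_boundedE)
  then have "f \<in> scaled_rkhs \<alpha>" unfolding scaled_rkhs_eq[OF admissible_\<alpha>] by blast
  then show "f \<in> C" using scaled_rkhs_subset_C[OF admissible_\<alpha>] by blast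
qed

text \<open>Both together would give A the measures 1 and 0 under the path law.\<close>

lemma not_full_both: "A \<subseteq> C \<Longrightarrow> \<not> (full A \<and> full (C - A))"
  using emeasure_full[of A] emeasure_Compl_full[of A] by auto

lemma scaled_rkhs_in_sigma: "admissible \<beta> \<Longrightarrow> scaled_rkhs \<beta> \<in> rkhs_sigma (scaled_kernels \<phi>)"
  unfolding rkhs_sigma_def rkhs_scaled_kernels by (intro sigma_sets.Basic imageI CollectI)

lemma full_scaled_rkhs_iff:
  assumes "admissible \<beta>"
  shows "full (scaled_rkhs \<beta>) \<longleftrightarrow> summable (\<lambda>n. inverse (\<beta> n))"
  using full_scaled_rkhs[OF assms] full_Compl_scaled_rkhs[OF assms] not_full_both[OF scaled_rkhs_subset_C[OF assms]] by blast

text \<open>Membership is compatible with complements and countable unions for trivial reasons,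
  fullness by the zero-one law. Agreement on the generators, where both mean summability of the
  inverse weights, therefore spreads to the whole \<sigma>-algebra.\<close>

lemma two_sided_bounded_mem_iff_full:
  assumes f: "f \<in> two_sided_bounded" and A: "A \<in> rkhs_sigma (scaled_kernels \<phi>)"
  shows "f \<in> A \<longleftrightarrow> full A"
proof -
  obtain c a b where c: "expansion \<phi> c f" "a > 0" "\<forall>\<^sub>F n in sequentially. a \<le> (c n)\<^sup>2"
    "\<forall>n. (c n)\<^sup>2 \<le> b" "summable (\<lambda>n. (c n)\<^sup>2 / \<alpha> n)"
    using f by (rule two_sided_boundedE)
  have "A \<subseteq> C \<and> (f \<in> A \<longleftrightarrow> full A)"
    using A
  proof (induction rule: rkhs_sigma_induct)
    case (basic \<beta>)
    show ?case
      unfolding full_scaled_rkhs_iff[OF basic] scaled_rkhs_iff[OF basic admissible_\<alpha> c(5,1)]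
      by (rule summable_bounded_ratio_iff[OF admissible_pos[OF basic] c(2,3) c(4)[rule_format]])
  next
    case empty
    show ?case using not_full_both[of "{}"] by (simp add: full_def)
  next
    case (compl A)
    then show ?case
      using rkhs_sigma_dichotomy[OF compl(1)] not_full_both[OF compl(2)] f two_sided_bounded_subset_C by blast
  next
    case (union A)
    show ?case
    proof
      assume "f \<in> (\<Union>i. A i)"
      then obtain i where "full (A i)" using union(3) by blast
      then show "full (\<Union>i. A i)" unfolding full_def by eventually_elim blast
    next
      assume *: "full (\<Union>i. A i)"
      show "f \<in> (\<Union>i. A i)"
      proof (rule ccontr)
        assume "f \<notin> (\<Union>i. A i)"
        then have "\<forall>i. full (C - A i)"
          using rkhs_sigma_dichotomy[OF union(1)] union(3) by blast
        then have "AE f in law. \<forall>i. f \<in> C \<longrightarrow> f \<in> C - A i" unfolding full_def AE_all_countable .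
        then have "full (C - (\<Union>i. A i))" unfolding full_def by eventually_elim blast
        moreover have "(\<Union>i. A i) \<subseteq> C" using union(2) by blast
        ultimately show False using * not_full_both by blast
      qed
    qed
  qed
  then show ?thesis by blast
qed

text \<open>Increasing inverse weights means decreasing weights, so continuity is inherited from
  \<alpha>, whatever the size of u.\<close>

lemma perturbed_scaling:
  assumes u: "\<And>n. u n \<ge> 0"
  obtains \<beta> where "admissible \<beta>" "\<And>n. inverse (\<beta> n) = inverse (\<alpha> n) + u n"
proof
  have pos: "inverse (\<alpha> n) + u n > 0" for n using \<alpha>_pos[of n] u[of n] by (simp add: add_pos_nonneg)
  show "admissible (\<lambda>n. inverse (inverse (\<alpha> n) + u n))"
  proof (rule admissible_smaller)
    show "0 < inverse (inverse (\<alpha> n) + u n)" for n using pos[of n] by simp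
    have "inverse (inverse (\<alpha> n) + u n) \<le> inverse (inverse (\<alpha> n))" for n
      using \<alpha>_pos[of n] u[of n] by (intro le_imp_inverse_le) auto
    then show "inverse (inverse (\<alpha> n) + u n) \<le> \<alpha> n" for n by simp
  qed
qed simp

lemma separating_full_set:
  assumes f: "f \<in> C" "f \<notin> two_sided_bounded"
  shows "\<exists>A\<in>rkhs_sigma (scaled_kernels \<phi>). full A \<and> f \<notin> A"
proof (cases "f \<in> scaled_rkhs \<alpha>")
  case False
  then show ?thesis using full_scaled_rkhs[OF admissible_\<alpha> \<alpha>_summable] scaled_rkhs_in_sigma[OF admissible_\<alpha>] by blast
next
  case True
  then obtain c where c: "summable (\<lambda>n. (c n)\<^sup>2 / \<alpha> n)" "expansion \<phi> c f"
    unfolding scaled_rkhs_eq[OF admissible_\<alpha>] by blast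
  \<comment> \<open>The part of the series coming from \<alpha> converges already, so the
    perturbation alone decides.\<close>
  have mem: "f \<in> scaled_rkhs \<beta> \<longleftrightarrow> summable (\<lambda>n. (c n)\<^sup>2 * u n)"
    if \<beta>: "admissible \<beta>" "\<And>n. inverse (\<beta> n) = inverse (\<alpha> n) + u n" for \<beta> u
  proof -
    have "(c n)\<^sup>2 / \<beta> n = (c n)\<^sup>2 / \<alpha> n + (c n)\<^sup>2 * u n" for n
      by (simp add: divide_inverse \<beta>(2) distrib_left)
    then show ?thesis
      unfolding scaled_rkhs_iff[OF \<beta>(1) admissible_\<alpha> c]
      using summable_add[OF c(1), of "\<lambda>n. (c n)\<^sup>2 * u n"]
        summable_diff[of "\<lambda>n. (c n)\<^sup>2 / \<beta> n", OF _ c(1)] by auto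
  qed
  show ?thesis
  proof (cases "\<exists>b. \<forall>n. (c n)\<^sup>2 \<le> b")
    case False
    have "\<exists>n>m. 2 ^ k \<le> (c n)\<^sup>2" for k m :: nat
    proof (rule ccontr)
      assume no: "\<not> ?thesis"
      \<comment> \<open>Otherwise the squared coefficients would be bounded: by 2^k beyond m, and by
        a finite sum up to m.\<close>
      have "(c n)\<^sup>2 \<le> 2 ^ k + (\<Sum>i\<le>m. (c i)\<^sup>2)" for n
      proof (cases "n > m")
        case True
        then show ?thesis using no by (smt (verit) sum_nonneg zero_le_power2)
      next
        case False
        then have "(c n)\<^sup>2 \<le> (\<Sum>i\<le>m. (c i)\<^sup>2)" by (intro member_le_sum) auto
        then show ?thesis by (simp add: add_increasing)
      qed
      with False show False by blast
    qed
    then obtain r where r: "strict_mono r" "\<And>k::nat. 2 ^ k \<le> (c (r k))\<^sup>2"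
      using strict_mono_selection[of "\<lambda>k n. 2 ^ k \<le> (c n)\<^sup>2"] by blast
    \<comment> \<open>The values 2^-k are summable, so the space stays full, but against squared
      coefficients of at least 2^k every term is at least 1.\<close>
    define u where "u = spread r (\<lambda>k. (1/2) ^ k)"
    have "u n \<ge> 0" for n unfolding u_def by (rule spread_nonneg) simp
    then obtain \<beta> where \<beta>: "admissible \<beta>" "\<And>n. inverse (\<beta> n) = inverse (\<alpha> n) + u n"
      using perturbed_scaling by blast
    have "summable u"
      using summable_mult_spread[OF r(1), of "\<lambda>_. 1" "\<lambda>k. (1/2) ^ k"] by (simp add: u_def)
    then have "full (scaled_rkhs \<beta>)"
      unfolding full_scaled_rkhs_iff[OF \<beta>(1)] \<beta>(2) by (rule summable_add[OF \<alpha>_summable])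
    moreover have "\<not> summable (\<lambda>n. (c n)\<^sup>2 * u n)"
    proof
      assume "summable (\<lambda>n. (c n)\<^sup>2 * u n)"
      then have "summable (\<lambda>k. (c (r k))\<^sup>2 * (1/2) ^ k)"
        unfolding u_def by (subst (asm) summable_mult_spread[OF r(1)])
      from summable_LIMSEQ_zero[OF this] have "\<forall>\<^sub>F k in sequentially. (c (r k))\<^sup>2 * (1/2) ^ k < 1"
        by (rule order_tendstoD) simp
      then obtain k where "(c (r k))\<^sup>2 * (1/2) ^ k < 1" using eventually_happens by force
      then show False using r(2)[of k] by (simp add: power_one_over field_simps)
    qed
    ultimately show ?thesis using mem[OF \<beta>] scaled_rkhs_in_sigma[OF \<beta>(1)] by blast
  next
    case True
    then obtain b where b: "\<And>n. (c n)\<^sup>2 \<le> b" by blast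
    have ev: "\<not> (\<forall>\<^sub>F n in sequentially. a \<le> (c n)\<^sup>2)" if "a > 0" for a
      using two_sided_boundedI[OF c(2) that _ b] f(2) by blast
    have "\<exists>n>m. (c n)\<^sup>2 < (1/2) ^ k" for k m :: nat
      using ev[of "(1/2)^k"] unfolding eventually_sequentially by (simp add: not_le) (meson Suc_le_eq)
    then obtain r where r: "strict_mono r" "\<And>k::nat. (c (r k))\<^sup>2 < (1/2) ^ k"
      using strict_mono_selection[of "\<lambda>k n. (c n)\<^sup>2 < (1/2) ^ k"] by blast
    \<comment> \<open>The opposite design: unit perturbations destroy summability of the inverse
      weights, so almost no path lies in the space, whereas f stays in it because its squared
      coefficients along \<open>r\<close> are below 2^-k.\<close>
    define u where "u = spread r (\<lambda>k. 1)"
    have u: "u n \<ge> 0" for n unfolding u_def by (rule spread_nonneg) simp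
    then obtain \<beta> where \<beta>: "admissible \<beta>" "\<And>n. inverse (\<beta> n) = inverse (\<alpha> n) + u n"
      using perturbed_scaling by blast
    have "\<not> summable u"
      using summable_mult_spread[OF r(1), of "\<lambda>_. 1" "\<lambda>k. 1"] by (simp add: u_def summable_const_iff)
    then have "\<not> summable (\<lambda>n. inverse (\<beta> n))"
      unfolding \<beta>(2) using summable_diff[of "\<lambda>n. inverse (\<alpha> n) + u n", OF _ \<alpha>_summable] by auto
    then have "full (C - scaled_rkhs \<beta>)" by (rule full_Compl_scaled_rkhs[OF \<beta>(1)])
    moreover have "summable (\<lambda>n. (c n)\<^sup>2 * u n)"
      unfolding u_def summable_mult_spread[OF r(1)]
      by (rule summable_comparison_test'[where g="\<lambda>k. (1/2)^k" and N=0])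
         (use r(2) in \<open>simp_all add: less_imp_le\<close>)
    moreover have "C - scaled_rkhs \<beta> \<in> rkhs_sigma (scaled_kernels \<phi>)"
      using scaled_rkhs_in_sigma[OF \<beta>(1)] unfolding rkhs_sigma_def by (rule sigma_sets.Compl)
    ultimately show ?thesis using mem[OF \<beta>] by blast
  qed
qed

text \<open>Maximality is checked pointwise: a single full set omitting f already bars f from every
  competing S.\<close>

lemma sample_support_eq: "sample_support M X (scaled_kernels \<phi>) = two_sided_bounded"
  unfolding sample_support_def
proof (rule Greatest_equality)
  show "two_sided_bounded \<subseteq> C \<and> (\<forall>H\<in>rkhs_sigma (scaled_kernels \<phi>). emeasure (path_law M X) H = 1 \<longrightarrow> two_sided_bounded \<subseteq> H)"
    using two_sided_bounded_subset_C two_sided_bounded_mem_iff_full by (simp add: emeasure_eq_1_iff_full subset_iff)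
next
  fix S assume S: "S \<subseteq> C \<and> (\<forall>H\<in>rkhs_sigma (scaled_kernels \<phi>). emeasure (path_law M X) H = 1 \<longrightarrow> S \<subseteq> H)"
  show "S \<subseteq> two_sided_bounded"
  proof (rule subsetI, rule ccontr)
    fix f assume "f \<in> S" "f \<notin> two_sided_bounded"
    then obtain A where "A \<in> rkhs_sigma (scaled_kernels \<phi>)" "full A" "f \<notin> A"
      using separating_full_set S by blast
    then show False using S \<open>f \<in> S\<close> by (simp add: emeasure_eq_1_iff_full subset_iff)
  qed
qed

text \<open>Sets decided by countably many generators form a \<sigma>-algebra: complements keep the
  family W, and countable unions take the union of the families.\<close>

lemma countably_determined:
  assumes "A \<in> rkhs_sigma (scaled_kernels \<phi>)"
  shows "\<exists>W. countable W \<and> W \<subseteq> Collect admissible \<and>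
    (\<forall>f\<in>C. \<forall>g\<in>C. (\<forall>\<beta>\<in>W. f \<in> scaled_rkhs \<beta> \<longleftrightarrow> g \<in> scaled_rkhs \<beta>) \<longrightarrow> (f \<in> A \<longleftrightarrow> g \<in> A))"
proof -
  have "A \<subseteq> C \<and> (\<exists>W. countable W \<and> W \<subseteq> Collect admissible \<and>
    (\<forall>f\<in>C. \<forall>g\<in>C. (\<forall>\<beta>\<in>W. f \<in> scaled_rkhs \<beta> \<longleftrightarrow> g \<in> scaled_rkhs \<beta>) \<longrightarrow> (f \<in> A \<longleftrightarrow> g \<in> A)))"
    using assms
  proof (induction rule: rkhs_sigma_induct)
    case (basic \<beta>)
    then show ?case by (intro exI[of _ "{\<beta>}"]) simp
  next
    case empty
    show ?case by (intro exI[of _ "{}"]) simp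
  next
    case (compl A)
    from compl(3) show ?case by (elim exE conjE) (intro exI conjI, assumption, assumption, blast)
  next
    case (union A)
    then obtain W where W: "\<And>i. countable (W i)" "\<And>i. W i \<subseteq> Collect admissible"
      "\<And>i. \<forall>f\<in>C. \<forall>g\<in>C. (\<forall>\<beta>\<in>W i. f \<in> scaled_rkhs \<beta> \<longleftrightarrow> g \<in> scaled_rkhs \<beta>) \<longrightarrow> (f \<in> A i \<longleftrightarrow> g \<in> A i)"
      by metis
    show ?case
    proof (intro exI[of _ "\<Union>i. W i"] conjI ballI impI)
      show "countable (\<Union>i. W i)" using W(1) by simp
      show "(\<Union>i. W i) \<subseteq> Collect admissible" using W(2) by blast
      fix f g assume fg: "f \<in> C" "g \<in> C" "\<forall>\<beta>\<in>\<Union>i. W i. f \<in> scaled_rkhs \<beta> \<longleftrightarrow> g \<in> scaled_rkhs \<beta>"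
      have "f \<in> A i \<longleftrightarrow> g \<in> A i" for i
        using W(3)[of i, THEN bspec, OF fg(1), THEN bspec, OF fg(2)] fg(3) by simp
      then show "f \<in> (\<Union>i. A i) \<longleftrightarrow> g \<in> (\<Union>i. A i)" by simp
    qed
  qed
  then show ?thesis by blast
qed

text \<open>A function \<open>g\<close> outside \<open>two_sided_bounded\<close> that belongs to the same ones of the countably many RKHSs
  determining \<open>H\<close> as the function \<open>f\<close> with all coefficients 1: the squared coefficients of \<open>g\<close>
  are 1 except along a sparse subsequence, along which they are unbounded.\<close>

lemma full_set_not_subset_two_sided_bounded:
  assumes H: "H \<in> rkhs_sigma (scaled_kernels \<phi>)" "full H"
  shows "\<exists>g\<in>C. g \<in> H \<and> g \<notin> two_sided_bounded"
proof -
  obtain W where W: "countable W" "W \<subseteq> Collect admissible"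
    "\<forall>f\<in>C. \<forall>g\<in>C. (\<forall>\<beta>\<in>W. f \<in> scaled_rkhs \<beta> \<longleftrightarrow> g \<in> scaled_rkhs \<beta>) \<longrightarrow> (f \<in> H \<longleftrightarrow> g \<in> H)"
    using countably_determined[OF H(1)] by blast
  \<comment> \<open>Inserting \<alpha> makes the enumerated family nonempty and ensures that the
    coefficients of g will be summable against \<alpha> too.\<close>
  define B where "B = from_nat_into (insert \<alpha> W)"
  have range_B: "range B = insert \<alpha> W"
    unfolding B_def by (rule range_from_nat_into) (use W(1) in simp_all)
  have B: "admissible (B k)" for k
    using rangeI[of B k] W(2) admissible_\<alpha> unfolding range_B by auto
  \<comment> \<open>A diagonal choice: at level k only the first k + 1 weight sequences are
    controlled, which suffices because finitely many terms do not affect summability; 4^-k beats the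
    growth 2^k of the new squared coefficients.\<close>
  define Q where "Q k n \<longleftrightarrow> (\<forall>j\<in>{..k}. summable (\<lambda>n. inverse (B j n)) \<longrightarrow> inverse (B j n) \<le> (1/4) ^ k)" for k n :: nat
  have sel: "\<exists>n>m. Q k n" for k m :: nat
  proof -
    have "\<forall>\<^sub>F n in sequentially. summable (\<lambda>n. inverse (B j n)) \<longrightarrow> inverse (B j n) \<le> (1/4) ^ k" for j
    proof (cases "summable (\<lambda>n. inverse (B j n))")
      case True
      have "\<forall>\<^sub>F n in sequentially. inverse (B j n) < (1/4) ^ k"
        by (rule order_tendstoD(2)[OF summable_LIMSEQ_zero[OF True]]) simp
      then show ?thesis by eventually_elim simp
    qed simp
    then have "\<forall>\<^sub>F n in sequentially. Q k n"
      unfolding Q_def by (intro eventually_ball_finite) auto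
    then have "\<forall>\<^sub>F n in sequentially. n > m \<and> Q k n"
      using eventually_gt_at_top[of m] by eventually_elim blast
    from eventually_happens[OF this] show ?thesis by simp
  qed
  obtain r where r: "strict_mono r" "\<And>k. Q k (r k)"
    using strict_mono_selection[of Q, OF sel] by blast
  define d where "d n = sqrt (1 + spread r (\<lambda>k. 2 ^ k) n)" for n
  have spread: "spread r (\<lambda>k. 2 ^ k) n \<ge> 0" for n by (rule spread_nonneg) simp
  have d_sq: "(d n)\<^sup>2 = 1 + spread r (\<lambda>k. 2 ^ k) n" for n
    using spread[of n] by (simp add: d_def)
  have d_summable: "summable (\<lambda>n. (d n)\<^sup>2 / B j n) \<longleftrightarrow> summable (\<lambda>n. inverse (B j n))" for j
  proof
    assume "summable (\<lambda>n. (d n)\<^sup>2 / B j n)"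
    then show "summable (\<lambda>n. inverse (B j n))"
    proof (rule summable_comparison_test'[where N=0])
      show "norm (inverse (B j n)) \<le> (d n)\<^sup>2 / B j n" for n
        using admissible_pos[OF B, of j n] spread[of n] by (simp add: d_sq field_simps)
    qed
  next
    assume s: "summable (\<lambda>n. inverse (B j n))"
    have "summable (\<lambda>k. inverse (B j (r k)) * 2 ^ k)"
    \<comment> \<open>The comparison starts at j, since \<open>Q k\<close> controls
      \<open>B j\<close> only for k at least j.\<close>
    proof (rule summable_comparison_test'[where g="\<lambda>k. (1/2) ^ k" and N=j])
      fix k assume "j \<le> k"
      then have "inverse (B j (r k)) \<le> (1/4) ^ k" using r(2)[of k] s by (simp add: Q_def)
      then have "inverse (B j (r k)) * 2 ^ k \<le> (1/4) ^ k * 2 ^ k" by (intro mult_right_mono) auto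
      also have "\<dots> = (1/2::real) ^ k" by (simp flip: power_mult_distrib)
      finally show "norm (inverse (B j (r k)) * 2 ^ k) \<le> (1/2) ^ k"
        using admissible_pos[OF B, of j "r k"] by (simp add: abs_mult)
    qed simp
    then have "summable (\<lambda>n. inverse (B j n) * spread r (\<lambda>k. 2 ^ k) n)"
      unfolding summable_mult_spread[OF r(1)] .
    from summable_add[OF s this] show "summable (\<lambda>n. (d n)\<^sup>2 / B j n)"
      by (simp add: d_sq divide_inverse algebra_simps)
  qed
  obtain j0 where j0: "B j0 = \<alpha>" using range_B by (metis insertI1 rangeE)
  have d\<alpha>: "summable (\<lambda>n. (d n)\<^sup>2 / \<alpha> n)" using d_summable[of j0] \<alpha>_summable by (simp add: j0)
  have one\<alpha>: "summable (\<lambda>n. 1\<^sup>2 / \<alpha> n)" using \<alpha>_summable by (simp add: divide_inverse)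
  obtain g where g: "expansion \<phi> d g" using expansion_exists[OF admissible_\<alpha> d\<alpha>] by (rule exE)
  obtain f where f: "expansion \<phi> (\<lambda>n. 1) f" using expansion_exists[OF admissible_\<alpha> one\<alpha>] by (rule exE)
  have "f \<in> two_sided_bounded" by (rule two_sided_boundedI[OF f, of 1 1]) simp_all
  then have fC: "f \<in> C" and fH: "f \<in> H" using two_sided_bounded_subset_C two_sided_bounded_mem_iff_full[OF _ H(1)] H(2) by blast+
  have "g \<in> scaled_rkhs \<alpha>" unfolding scaled_rkhs_iff[OF admissible_\<alpha> admissible_\<alpha> d\<alpha> g] by (rule d\<alpha>)
  then have gC: "g \<in> C" using scaled_rkhs_subset_C[OF admissible_\<alpha>] by blast
  have "f \<in> scaled_rkhs \<beta> \<longleftrightarrow> g \<in> scaled_rkhs \<beta>" if \<beta>: "\<beta> \<in> W" for \<beta>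
  proof -
    have "\<beta> \<in> range B" using \<beta> range_B by simp
    then obtain j where j: "\<beta> = B j" by (rule rangeE)
    show ?thesis
      unfolding j scaled_rkhs_iff[OF B admissible_\<alpha> d\<alpha> g] scaled_rkhs_iff[OF B admissible_\<alpha> one\<alpha> f] d_summable
      by (simp add: divide_inverse)
  qed
  then have "g \<in> H" using W(3)[THEN bspec, OF fC, THEN bspec, OF gC] fH by simp
  moreover have "g \<notin> two_sided_bounded"
  proof
    assume "g \<in> two_sided_bounded"
    then obtain c a b where c: "expansion \<phi> c g" "a > 0" "\<forall>\<^sub>F n in sequentially. a \<le> (c n)\<^sup>2"
      "\<forall>n. (c n)\<^sup>2 \<le> b" "summable (\<lambda>n. (c n)\<^sup>2 / \<alpha> n)" by (rule two_sided_boundedE)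
    \<comment> \<open>A different, bounded expansion of g is excluded by uniqueness.\<close>
    have "c = d" by (rule coefficients_unique[OF admissible_\<alpha> admissible_\<alpha> c(5,1) d\<alpha> g])
    then have "2 ^ k \<le> b" for k :: nat
      using c(4)[rule_format, of "r k"] by (simp add: d_sq spread_at[OF r(1)])
    moreover obtain k where "b < 2 ^ k" using real_arch_pow[of 2 b] by auto
    ultimately show False by (meson not_le)
  qed
  ultimately show ?thesis using gC by blast
qed

lemma sigma_Int:
  "A \<in> rkhs_sigma (scaled_kernels \<phi>) \<Longrightarrow> A' \<in> rkhs_sigma (scaled_kernels \<phi>) \<Longrightarrow>
    A \<inter> A' \<in> rkhs_sigma (scaled_kernels \<phi>)"
proof -
  interpret sigma_algebra C "rkhs_sigma (scaled_kernels \<phi>)"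
    unfolding rkhs_sigma_def rkhs_scaled_kernels
    by (rule sigma_algebra_sigma_sets) (use scaled_rkhs_subset_C in blast)
  show "A \<in> rkhs_sigma (scaled_kernels \<phi>) \<Longrightarrow> A' \<in> rkhs_sigma (scaled_kernels \<phi>) \<Longrightarrow>
    A \<inter> A' \<in> rkhs_sigma (scaled_kernels \<phi>)" by (rule Int)
qed

text \<open>Some g in H lies outside the support and is omitted by a full set A, which makes
  \<open>H \<inter> A\<close> smaller than H. This intersection is again full, so it too contains a
  function outside the support, and the other inclusion is strict as well.\<close>

lemma no_smallest_full_set:
  assumes H: "H \<in> rkhs_sigma (scaled_kernels \<phi>)" "full H"
  shows "\<exists>F\<in>rkhs_sigma (scaled_kernels \<phi>). two_sided_bounded \<subset> F \<and> F \<subset> H"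
proof -
  obtain g where g: "g \<in> C" "g \<in> H" "g \<notin> two_sided_bounded" using full_set_not_subset_two_sided_bounded[OF H] by blast
  obtain A where A: "A \<in> rkhs_sigma (scaled_kernels \<phi>)" "full A" "g \<notin> A"
    using separating_full_set[OF g(1,3)] by blast
  have F: "H \<inter> A \<in> rkhs_sigma (scaled_kernels \<phi>)" by (rule sigma_Int[OF H(1) A(1)])
  have full: "full (H \<inter> A)" using H(2) A(2) unfolding full_def by eventually_elim blast
  have "two_sided_bounded \<subseteq> H \<inter> A" using two_sided_bounded_mem_iff_full[OF _ F] full by blast
  moreover have "two_sided_bounded \<noteq> H \<inter> A" using full_set_not_subset_two_sided_bounded[OF F full] by blast
  ultimately have "two_sided_bounded \<subset> H \<inter> A" by blast
  moreover have "H \<inter> A \<subset> H" using g(2) A(3) by blast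
  ultimately show ?thesis using F by blast
qed

end

theorem mainTheorem2:
  fixes K :: "'t::polish_space \<Rightarrow> 't \<Rightarrow> real"
    and M :: "'w measure"
    and X :: "'t \<Rightarrow> 'w \<Rightarrow> real"
    and \<phi> :: "nat \<Rightarrow> 't \<Rightarrow> real"
    and \<alpha> :: "nat \<Rightarrow> real"
  assumes "psd_kernel K" and "continuous_kernel K"
    and "rkhs_infinite_dim K" and "rkhs_separable K"
    and "centered_gaussian_process M X K"
    and "\<And>\<omega>. \<omega> \<in> space M \<Longrightarrow> continuous_on UNIV (\<lambda>t. X t \<omega>)"
    and "rkhs_orthonormal_basis K \<phi>"
    and "coefficients_well_defined \<phi>"
    and "scaling \<phi> \<alpha>" and "summable (\<lambda>n. inverse (\<alpha> n))"
    and "continuous_kernel (scaled_kernel \<alpha> \<phi>)"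
    and "Metric_space UNIV (kernel_dist K)"
  shows "sample_support M X (scaled_kernels \<phi>) =
           {f. \<exists>c :: nat \<Rightarrow> real. expansion \<phi> c f \<and>
                 liminf (\<lambda>n. ereal ((c n)\<^sup>2)) > 0 \<and> (SUP n. ereal ((c n)\<^sup>2)) < \<infinity>} \<and>
         (\<forall>H\<in>rkhs_sigma (scaled_kernels \<phi>). emeasure (path_law M X) H = 1 \<longrightarrow>
           (\<exists>F\<in>rkhs_sigma (scaled_kernels \<phi>).
              sample_support M X (scaled_kernels \<phi>) \<subset> F \<and> F \<subset> H))"
proof -
  interpret scaled_gaussian K M X \<phi> \<alpha> by unfold_locales (fact assms)+
  show ?thesis
  proof (intro conjI ballI impI)
    fix H assume "H \<in> rkhs_sigma (scaled_kernels \<phi>)" "emeasure (path_law M X) H = 1"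
    then show "\<exists>F\<in>rkhs_sigma (scaled_kernels \<phi>). sample_support M X (scaled_kernels \<phi>) \<subset> F \<and> F \<subset> H"
      unfolding sample_support_eq by (intro no_smallest_full_set) (simp_all add: emeasure_eq_1_iff_full)
  qed (simp only: sample_support_eq two_sided_bounded_def)
qed

end
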